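(* Let $k$ be an algebraically closed field, let $(\mathcal C,\boxtimes,1)$ be a lax monoidal $k$-linear 2-category, and let $\varrho$ and $\pi$ be 2-representations of a finite group $G$ on objects $V$ and $W$ of $\mathcal C$, with all $\mathbb{T}r(\varrho(g))$ and $\mathbb{T}r(\pi(g))$ finite dimensional (so that the 2-characters $\chi_\varrho$ and $\chi_\pi$ are defined). Assume that the object $(\varrho\boxtimes\pi)^G=(V\boxtimes W)^G$ exists. Then the inner product $\langle\varrho,\pi\rangle_G:=\mathcal{D}\mathrm{im}\bigl((\varrho\boxtimes\pi)^G\bigr)$ satisfies $$\dim_k\langle\varrho,\pi\rangle_G=\frac1{|G|}\sum_{gh=hg}\chi_\varrho(g,h)\cdot\chi_\pi(g,h),$$ where the sum is over all pairs $(g,h)\in G\times G$ with $gh=hg$.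
   Context: A $k$-linear 2-category has additive $k$-linear categories of 1-morphisms and bilinear compositions; a monoidal one carries a tensor product $\boxtimes$ which is a pseudofunctor in two variables, bilinear on 2-morphisms. $\circ$ is vertical composition, juxtaposition is horizontal composition. For a 1-endomorphism $F$ of $V$, $\mathbb{T}r(F)=2\mathrm{Hom}(\mathrm{id}_V,F)$; $\mathcal{D}\mathrm{im}(V)=\mathbb{T}r(\mathrm{id}_V)$. A 2-representation $\varrho$ of $G$ on $V$: 1-endomorphisms $\varrho(g)$ (abbreviated $g$) of $V$ and 2-isomorphisms $\phi_{g,h}:\varrho(g)\varrho(h)\Rightarrow\varrho(gh)$, $\phi_1:\varrho(1)\Rightarrow\mathrm{id}_V$ with $\phi_{gh,k}\circ(\phi_{g,h}k)=\phi_{g,hk}\circ(g\phi_{h,k})$, $\phi_{1,g}=\phi_1 g$, $\phi_{g,1}=g\phi_1$. The group $G$ acts on $V\boxtimes W$ by $g\mapsto\varrho(g)\boxtimes\pi(g)$, with structure isomorphisms obtained by applying $\boxtimes$ to those of $\varrho$ and $\pi$; this 2-representation is $\varrho\boxtimes\pi$. Characters: for $s,g\in G$, $\psi_s:\mathbb{T}r(\varrho(g))\to\mathbb{T}r(\varrho(sgs^{-1}))$ sends $\xi$ to $\mathrm{id}_V\cong\varrho(s)\varrho(s^{-1})\xrightarrow{s\xi s^{-1}}\varrho(s)\varrho(g)\varrho(s^{-1})\cong\varrho(sgs^{-1})$, the isomorphisms being built from the $\phi$'s. For $gh=hg$, $\chi_\varrho(g,h)=\mathrm{tr}\bigl(\psi_h:\mathbb{T}r(\varrho(g))\to\mathbb{T}r(\varrho(g))\bigr)$.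 Equivariant 1-morphisms. For $W,V$ with 2-representations of $G$, $1\mathrm{Hom}_G(W,V)$ has objects $(F,\{\tau_g\})$, $F:W\to V$, with 2-isomorphisms $\tau_g:gF\Rightarrow Fg$ such that $\tau_{gh}\circ(\phi_{g,h}F)=(F\phi_{g,h})\circ(\tau_g h)\circ(g\tau_h)$ and $\tau_1$ is the map $1F\cong F\cong F1$; morphisms are 2-morphisms commuting with the $\tau_g$. If $F,H$ have flips $\tau,\sigma$ and $HF$ is defined, it has flips $(H\tau_g)\circ(\sigma_gF)$. $1\mathrm{Hom}_G^{triv}(W,V)$ has objects $(F,\{\tau_g\},\{\epsilon_g\})$, where moreover $\epsilon_g:F\Rightarrow gF$ are 2-isomorphisms (a trivialization) with $(\phi_{g,h}F)\circ(g\epsilon_h)\circ\epsilon_g=\epsilon_{gh}$ and $(\phi_{s,g}F)\circ(s\epsilon_g)\circ\tau_s^{-1}=(\phi_{sgs^{-1},s}F)\circ\bigl((sgs^{-1})\tau_s^{-1}\bigr)\circ(\epsilon_{sgs^{-1}}s)$; morphisms must commute with the $\tau_g$ and $\epsilon_g$. "$V^G$ exists" (for an object $V$ with 2-representation) means: there are an object $V^G$ with a 2-representation of $G$ and a trivialization $\epsilon_g:\mathrm{id}_{V^G}\Rightarrow g$ of its identity, and an equivariant 1-morphism $U:V^G\to V$ with flips $\tau^U_g$, such that for every $W$ with 2-representation of $G$ the functor $1\mathrm{Hom}_G(W,V^G)\to 1\mathrm{Hom}_G^{triv}(W,V)$, $F\mapsto UF$, is an equivalence, where $UF$ is trivialized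 by $((\tau^U_g)^{-1}F)\circ(U\epsilon_gF)$.
   Formalization: Two hypotheses are added: |G| is nonzero in k, so that 1/|G| makes sense; and for each g the canonical pairing of Tr(ϱ(g)) and Tr(π(g)) into Tr(ϱ(g)⊠π(g)) induces an isomorphism from the tensor product, without which the formula fails. *)

theory Defs
  imports "HOL-Algebra.Group" "HOL-Computational_Algebra.Computational_Algebra"
begin

section \<open>Linear algebra on subspaces of an ambient vector space\<close>

definition basis_of :: "('k::field \<Rightarrow> 'm::ab_group_add \<Rightarrow> 'm) \<Rightarrow> 'm set \<Rightarrow> 'm set \<Rightarrow> bool" where
  "basis_of sc S B \<longleftrightarrow> B \<subseteq> S \<and> \<not> module.dependent sc B \<and> S \<subseteq> module.span sc B"

definition fin_dim :: "('k::field \<Rightarrow> 'm::ab_group_add \<Rightarrow> 'm) \<Rightarrow> 'm set \<Rightarrow> bool" where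
  "fin_dim sc S \<longleftrightarrow> (\<exists>B. finite B \<and> B \<subseteq> S \<and> S \<subseteq> module.span sc B)"

definition trace_on :: "('k::field \<Rightarrow> 'm::ab_group_add \<Rightarrow> 'm) \<Rightarrow> 'm set \<Rightarrow> ('m \<Rightarrow> 'm) \<Rightarrow> 'k" where
  "trace_on sc S f =
     (let B = (SOME B. basis_of sc S B) in \<Sum>b\<in>B. module.representation sc B (f b) b)"

definition bilinear_on ::
  "('k::field \<Rightarrow> 'm::ab_group_add \<Rightarrow> 'm) \<Rightarrow> 'm set \<Rightarrow> 'm set \<Rightarrow> ('m \<Rightarrow> 'm \<Rightarrow> 'm) \<Rightarrow> bool" where
  "bilinear_on sc S T b \<longleftrightarrow>
     (\<forall>x\<in>S. \<forall>x'\<in>S. \<forall>y\<in>T. b (x + x') y = b x y + b x' y) \<and>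
     (\<forall>x\<in>S. \<forall>y\<in>T. \<forall>y'\<in>T. b x (y + y') = b x y + b x y') \<and>
     (\<forall>c. \<forall>x\<in>S. \<forall>y\<in>T. b (sc c x) y = sc c (b x y) \<and> b x (sc c y) = sc c (b x y))"

text \<open>The linear map from the tensor product of \<open>S\<close> and \<open>T\<close> to \<open>D\<close> induced by the bilinear
  map \<open>b\<close> is an isomorphism. As there is no tensor product of subspaces to refer to, this is
  spelled out on bases.\<close>

definition tensor_iso ::
  "('k::field \<Rightarrow> 'm::ab_group_add \<Rightarrow> 'm) \<Rightarrow> 'm set \<Rightarrow> 'm set \<Rightarrow> 'm set \<Rightarrow> ('m \<Rightarrow> 'm \<Rightarrow> 'm) \<Rightarrow> bool" where
  "tensor_iso sc S T D b \<longleftrightarrow>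
     bilinear_on sc S T b \<and>
     (\<forall>A B. basis_of sc S A \<longrightarrow> basis_of sc T B \<longrightarrow>
        inj_on (\<lambda>(x, y). b x y) (A \<times> B) \<and> basis_of sc D ((\<lambda>(x, y). b x y) ` (A \<times> B)))"

section \<open>Categories, functors, equivalences\<close>

text \<open>Sets of morphisms between different pairs of objects may overlap, so the action of a functor
  on morphisms takes the source and the target as arguments.\<close>

record ('x, 'm) cat =
  objs :: "'x set"
  mors :: "'x \<Rightarrow> 'x \<Rightarrow> 'm set"
  ids :: "'x \<Rightarrow> 'm"
  cmp :: "'m \<Rightarrow> 'm \<Rightarrow> 'm"

definition is_functor ::
  "('x, 'm) cat \<Rightarrow> ('y, 'n) cat \<Rightarrow> ('x \<Rightarrow> 'y) \<Rightarrow> ('x \<Rightarrow> 'x \<Rightarrow> 'm \<Rightarrow> 'n) \<Rightarrow> bool" where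
  "is_functor A B Fo Fm \<longleftrightarrow>
     (\<forall>X\<in>objs A. Fo X \<in> objs B) \<and>
     (\<forall>X\<in>objs A. \<forall>Y\<in>objs A. \<forall>f\<in>mors A X Y. Fm X Y f \<in> mors B (Fo X) (Fo Y)) \<and>
     (\<forall>X\<in>objs A. Fm X X (ids A X) = ids B (Fo X)) \<and>
     (\<forall>X\<in>objs A. \<forall>Y\<in>objs A. \<forall>Z\<in>objs A. \<forall>f\<in>mors A X Y. \<forall>g\<in>mors A Y Z.
        Fm X Z (cmp A g f) = cmp B (Fm Y Z g) (Fm X Y f))"

definition natural_iso ::
  "('x, 'm) cat \<Rightarrow> ('y, 'n) cat \<Rightarrow> ('x \<Rightarrow> 'y) \<Rightarrow> ('x \<Rightarrow> 'x \<Rightarrow> 'm \<Rightarrow> 'n)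
     \<Rightarrow> ('x \<Rightarrow> 'y) \<Rightarrow> ('x \<Rightarrow> 'x \<Rightarrow> 'm \<Rightarrow> 'n) \<Rightarrow> ('x \<Rightarrow> 'n) \<Rightarrow> bool" where
  "natural_iso A B Fo Fm Ho Hm \<eta> \<longleftrightarrow>
     (\<forall>X\<in>objs A. \<eta> X \<in> mors B (Fo X) (Ho X) \<and>
        (\<exists>\<theta>\<in>mors B (Ho X) (Fo X). cmp B \<theta> (\<eta> X) = ids B (Fo X) \<and> cmp B (\<eta> X) \<theta> = ids B (Ho X))) \<and>
     (\<forall>X\<in>objs A. \<forall>Y\<in>objs A. \<forall>f\<in>mors A X Y.
        cmp B (\<eta> Y) (Fm X Y f) = cmp B (Hm X Y f) (\<eta> X))"

definition is_equivalence ::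
  "('x, 'm) cat \<Rightarrow> ('y, 'n) cat \<Rightarrow> ('x \<Rightarrow> 'y) \<Rightarrow> ('x \<Rightarrow> 'x \<Rightarrow> 'm \<Rightarrow> 'n) \<Rightarrow> bool" where
  "is_equivalence A B Fo Fm \<longleftrightarrow>
     is_functor A B Fo Fm \<and>
     (\<exists>Ho Hm \<eta> \<theta>. is_functor B A Ho Hm \<and>
        natural_iso A A (\<lambda>X. X) (\<lambda>X Y f. f)
          (\<lambda>X. Ho (Fo X)) (\<lambda>X Y f. Hm (Fo X) (Fo Y) (Fm X Y f)) \<eta> \<and>
        natural_iso B B (\<lambda>X. Fo (Ho X)) (\<lambda>X Y f. Fm (Ho X) (Ho Y) (Hm X Y f))
          (\<lambda>X. X) (\<lambda>X Y f. f) \<theta>)"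

section \<open>Linear 2-categories\<close>

text \<open>The 2-categories are strict. Objects are the elements of the type \<open>'o\<close>, and
  \<open>hom1 C V W\<close> is the set of 1-morphisms from \<open>V\<close> to \<open>W\<close>. The spaces \<open>hom2 C F F'\<close> of
  2-morphisms are subspaces of one ambient vector space \<open>'m\<close>; this is no restriction, as one can
  take for \<open>'m\<close> the direct sum of all spaces of 2-morphisms. Compositions are
  written in the order of functions.\<close>

record ('k, 'o, 'a, 'm) two_cat =
  hom1 :: "'o \<Rightarrow> 'o \<Rightarrow> 'a set"
  id1 :: "'o \<Rightarrow> 'a"
  comp1 :: "'a \<Rightarrow> 'a \<Rightarrow> 'a" (infixl \<open>\<cdot>\<index>\<close> 75)
  hom2 :: "'a \<Rightarrow> 'a \<Rightarrow> 'm set"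
  id2 :: "'a \<Rightarrow> 'm"
  vcomp :: "'m \<Rightarrow> 'm \<Rightarrow> 'm" (infixl \<open>\<bullet>\<index>\<close> 65)
  hcomp :: "'m \<Rightarrow> 'm \<Rightarrow> 'm" (infixl \<open>\<star>\<index>\<close> 75)
  smul :: "'k \<Rightarrow> 'm \<Rightarrow> 'm"

text \<open>The whiskerings \<open>H \<alpha>\<close> and \<open>\<alpha> F\<close>.\<close>

definition lwhisk :: "('k, 'o, 'a, 'm, 'z) two_cat_scheme \<Rightarrow> 'a \<Rightarrow> 'm \<Rightarrow> 'm"
    (infixr \<open>\<triangleright>\<index>\<close> 70) where
  "lwhisk C H \<alpha> = hcomp C (id2 C H) \<alpha>"

definition rwhisk :: "('k, 'o, 'a, 'm, 'z) two_cat_scheme \<Rightarrow> 'm \<Rightarrow> 'a \<Rightarrow> 'm"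
    (infixl \<open>\<triangleleft>\<index>\<close> 71) where
  "rwhisk C \<alpha> F = hcomp C \<alpha> (id2 C F)"

locale klinear_2category =
  fixes C :: "('k::field, 'o, 'a, 'm::ab_group_add, 'z) two_cat_scheme" (structure)
  assumes vector_space: "vector_space (smul C)"
    and id1_closed: "id1 C V \<in> hom1 C V V"
    and comp1_closed: "\<lbrakk>F \<in> hom1 C V W; H \<in> hom1 C W X\<rbrakk> \<Longrightarrow> H \<cdot> F \<in> hom1 C V X"
    and comp1_assoc: "\<lbrakk>F \<in> hom1 C V W; H \<in> hom1 C W X; K \<in> hom1 C X Y\<rbrakk>
          \<Longrightarrow> (K \<cdot> H) \<cdot> F = K \<cdot> (H \<cdot> F)"
    and comp1_id_left: "F \<in> hom1 C V W \<Longrightarrow> id1 C W \<cdot> F = F"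
    and comp1_id_right: "F \<in> hom1 C V W \<Longrightarrow> F \<cdot> id1 C V = F"
    \<comment> \<open>linear categories of 1-morphisms\<close>
    and hom2_subspace: "\<lbrakk>F \<in> hom1 C V W; F' \<in> hom1 C V W\<rbrakk>
          \<Longrightarrow> module.subspace (smul C) (hom2 C F F')"
    and id2_closed: "F \<in> hom1 C V W \<Longrightarrow> id2 C F \<in> hom2 C F F"
    and vcomp_closed: "\<lbrakk>F \<in> hom1 C V W; F' \<in> hom1 C V W; F'' \<in> hom1 C V W;
          \<alpha> \<in> hom2 C F F'; \<beta> \<in> hom2 C F' F''\<rbrakk> \<Longrightarrow> \<beta> \<bullet> \<alpha> \<in> hom2 C F F''"
    and vcomp_assoc: "\<lbrakk>F \<in> hom1 C V W; F' \<in> hom1 C V W; F'' \<in> hom1 C V W; F''' \<in> hom1 C V W;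
          \<alpha> \<in> hom2 C F F'; \<beta> \<in> hom2 C F' F''; \<gamma> \<in> hom2 C F'' F'''\<rbrakk>
          \<Longrightarrow> (\<gamma> \<bullet> \<beta>) \<bullet> \<alpha> = \<gamma> \<bullet> (\<beta> \<bullet> \<alpha>)"
    and vcomp_id_left: "\<lbrakk>F \<in> hom1 C V W; F' \<in> hom1 C V W; \<alpha> \<in> hom2 C F F'\<rbrakk>
          \<Longrightarrow> id2 C F' \<bullet> \<alpha> = \<alpha>"
    and vcomp_id_right: "\<lbrakk>F \<in> hom1 C V W; F' \<in> hom1 C V W; \<alpha> \<in> hom2 C F F'\<rbrakk>
          \<Longrightarrow> \<alpha> \<bullet> id2 C F = \<alpha>"
    and vcomp_bilinear: "\<lbrakk>F \<in> hom1 C V W; F' \<in> hom1 C V W; F'' \<in> hom1 C V W\<rbrakk>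
          \<Longrightarrow> bilinear_on (smul C) (hom2 C F' F'') (hom2 C F F') (vcomp C)"
    \<comment> \<open>additivity: zero object and binary direct sums\<close>
    and zero_object: "\<exists>Z\<in>hom1 C V W. \<forall>F\<in>hom1 C V W. hom2 C Z F = {0} \<and> hom2 C F Z = {0}"
    and direct_sum: "\<lbrakk>F \<in> hom1 C V W; F' \<in> hom1 C V W\<rbrakk> \<Longrightarrow>
          \<exists>S\<in>hom1 C V W. \<exists>i\<in>hom2 C F S. \<exists>i'\<in>hom2 C F' S. \<exists>p\<in>hom2 C S F. \<exists>p'\<in>hom2 C S F'.
            p \<bullet> i = id2 C F \<and> p' \<bullet> i' = id2 C F' \<and> p \<bullet> i' = 0 \<and> p' \<bullet> i = 0 \<and>
            (i \<bullet> p) + (i' \<bullet> p') = id2 C S"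
    \<comment> \<open>horizontal composition\<close>
    and hcomp_closed: "\<lbrakk>F \<in> hom1 C V W; F' \<in> hom1 C V W; H \<in> hom1 C W X; H' \<in> hom1 C W X;
          \<alpha> \<in> hom2 C F F'; \<beta> \<in> hom2 C H H'\<rbrakk> \<Longrightarrow> \<beta> \<star> \<alpha> \<in> hom2 C (H \<cdot> F) (H' \<cdot> F')"
    and hcomp_assoc: "\<lbrakk>F \<in> hom1 C V W; F' \<in> hom1 C V W; H \<in> hom1 C W X; H' \<in> hom1 C W X;
          K \<in> hom1 C X Y; K' \<in> hom1 C X Y;
          \<alpha> \<in> hom2 C F F'; \<beta> \<in> hom2 C H H'; \<gamma> \<in> hom2 C K K'\<rbrakk>
          \<Longrightarrow> (\<gamma> \<star> \<beta>) \<star> \<alpha> = \<gamma> \<star> (\<beta> \<star> \<alpha>)"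
    and hcomp_id_left: "\<lbrakk>F \<in> hom1 C V W; F' \<in> hom1 C V W; \<alpha> \<in> hom2 C F F'\<rbrakk>
          \<Longrightarrow> id2 C (id1 C W) \<star> \<alpha> = \<alpha>"
    and hcomp_id_right: "\<lbrakk>F \<in> hom1 C V W; F' \<in> hom1 C V W; \<alpha> \<in> hom2 C F F'\<rbrakk>
          \<Longrightarrow> \<alpha> \<star> id2 C (id1 C V) = \<alpha>"
    and hcomp_id2: "\<lbrakk>F \<in> hom1 C V W; H \<in> hom1 C W X\<rbrakk> \<Longrightarrow> id2 C H \<star> id2 C F = id2 C (H \<cdot> F)"
    and interchange: "\<lbrakk>F \<in> hom1 C V W; F' \<in> hom1 C V W; F'' \<in> hom1 C V W;
          H \<in> hom1 C W X; H' \<in> hom1 C W X; H'' \<in> hom1 C W X;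
          \<alpha> \<in> hom2 C F F'; \<alpha>' \<in> hom2 C F' F''; \<beta> \<in> hom2 C H H'; \<beta>' \<in> hom2 C H' H''\<rbrakk>
          \<Longrightarrow> (\<beta>' \<bullet> \<beta>) \<star> (\<alpha>' \<bullet> \<alpha>) = (\<beta>' \<star> \<alpha>') \<bullet> (\<beta> \<star> \<alpha>)"
    and hcomp_bilinear: "\<lbrakk>F \<in> hom1 C V W; F' \<in> hom1 C V W; H \<in> hom1 C W X; H' \<in> hom1 C W X\<rbrakk>
          \<Longrightarrow> bilinear_on (smul C) (hom2 C H H') (hom2 C F F') (hcomp C)"

definition inverse2 :: "('k, 'o, 'a, 'm, 'z) two_cat_scheme \<Rightarrow> 'a \<Rightarrow> 'a \<Rightarrow> 'm \<Rightarrow> 'm \<Rightarrow> bool" where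
  "inverse2 C F F' \<alpha> \<beta> \<longleftrightarrow> \<beta> \<in> hom2 C F' F \<and>
     vcomp C \<beta> \<alpha> = id2 C F \<and> vcomp C \<alpha> \<beta> = id2 C F'"

definition iso2 :: "('k, 'o, 'a, 'm, 'z) two_cat_scheme \<Rightarrow> 'a \<Rightarrow> 'a \<Rightarrow> 'm set" where
  "iso2 C F F' = {\<alpha> \<in> hom2 C F F'. \<exists>\<beta>. inverse2 C F F' \<alpha> \<beta>}"

text \<open>\<open>inv2 C F F' \<alpha>\<close> is the inverse of \<open>\<alpha> : F \<Rightarrow> F'\<close>.\<close>

definition inv2 :: "('k, 'o, 'a, 'm, 'z) two_cat_scheme \<Rightarrow> 'a \<Rightarrow> 'a \<Rightarrow> 'm \<Rightarrow> 'm" where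
  "inv2 C F F' \<alpha> = (THE \<beta>. inverse2 C F F' \<alpha> \<beta>)"

text \<open>The categorical trace of a 1-endomorphism \<open>F\<close> of \<open>V\<close>, and the categorical dimension.\<close>

definition cat_trace :: "('k, 'o, 'a, 'm, 'z) two_cat_scheme \<Rightarrow> 'o \<Rightarrow> 'a \<Rightarrow> 'm set" where
  "cat_trace C V F = hom2 C (id1 C V) F"

definition cat_dim :: "('k, 'o, 'a, 'm, 'z) two_cat_scheme \<Rightarrow> 'o \<Rightarrow> 'm set" where
  "cat_dim C V = cat_trace C V (id1 C V)"

section \<open>Monoidal linear 2-categories\<close>

text \<open>The tensor product is a pseudofunctor in two variables, with structure 2-isomorphisms
  \<open>ten_comp C H H' F F' : (H \<otimes> H') (F \<otimes> F') \<Rightarrow> H F \<otimes> H' F'\<close> and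
  \<open>ten_id C V W : id \<Rightarrow> id \<otimes> id\<close>. No associativity or unit constraints are imposed: neither these
  nor the unit object enter into the result, which thus holds for any choice of them.\<close>

record ('k, 'o, 'a, 'm) monoidal_two_cat = "('k, 'o, 'a, 'm) two_cat" +
  unit_ob :: 'o
  ten0 :: "'o \<Rightarrow> 'o \<Rightarrow> 'o" (infixl \<open>\<otimes>\<^sub>0\<index>\<close> 80)
  ten1 :: "'a \<Rightarrow> 'a \<Rightarrow> 'a" (infixl \<open>\<otimes>\<^sub>1\<index>\<close> 80)
  ten2 :: "'m \<Rightarrow> 'm \<Rightarrow> 'm" (infixl \<open>\<otimes>\<^sub>2\<index>\<close> 80)
  ten_comp :: "'a \<Rightarrow> 'a \<Rightarrow> 'a \<Rightarrow> 'a \<Rightarrow> 'm"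
  ten_id :: "'o \<Rightarrow> 'o \<Rightarrow> 'm"

locale monoidal_klinear_2category = klinear_2category C
  for C :: "('k::field, 'o, 'a, 'm::ab_group_add, 'z) monoidal_two_cat_scheme" (structure) +
  assumes ten1_closed: "\<lbrakk>F \<in> hom1 C V W; F' \<in> hom1 C V' W'\<rbrakk>
          \<Longrightarrow> F \<otimes>\<^sub>1 F' \<in> hom1 C (V \<otimes>\<^sub>0 V') (W \<otimes>\<^sub>0 W')"
    and ten2_closed: "\<lbrakk>F \<in> hom1 C V W; H \<in> hom1 C V W; F' \<in> hom1 C V' W'; H' \<in> hom1 C V' W';
          \<alpha> \<in> hom2 C F H; \<alpha>' \<in> hom2 C F' H'\<rbrakk> \<Longrightarrow> \<alpha> \<otimes>\<^sub>2 \<alpha>' \<in> hom2 C (F \<otimes>\<^sub>1 F') (H \<otimes>\<^sub>1 H')"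
    and ten2_id: "\<lbrakk>F \<in> hom1 C V W; F' \<in> hom1 C V' W'\<rbrakk>
          \<Longrightarrow> id2 C F \<otimes>\<^sub>2 id2 C F' = id2 C (F \<otimes>\<^sub>1 F')"
    and ten2_vcomp: "\<lbrakk>F \<in> hom1 C V W; H \<in> hom1 C V W; K \<in> hom1 C V W;
          F' \<in> hom1 C V' W'; H' \<in> hom1 C V' W'; K' \<in> hom1 C V' W';
          \<alpha> \<in> hom2 C F H; \<beta> \<in> hom2 C H K; \<alpha>' \<in> hom2 C F' H'; \<beta>' \<in> hom2 C H' K'\<rbrakk>
          \<Longrightarrow> (\<beta> \<bullet> \<alpha>) \<otimes>\<^sub>2 (\<beta>' \<bullet> \<alpha>') = (\<beta> \<otimes>\<^sub>2 \<beta>') \<bullet> (\<alpha> \<otimes>\<^sub>2 \<alpha>')"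
    and ten2_bilinear: "\<lbrakk>F \<in> hom1 C V W; H \<in> hom1 C V W; F' \<in> hom1 C V' W'; H' \<in> hom1 C V' W'\<rbrakk>
          \<Longrightarrow> bilinear_on (smul C) (hom2 C F H) (hom2 C F' H') (ten2 C)"
    and ten_comp_iso: "\<lbrakk>F \<in> hom1 C V W; H \<in> hom1 C W X; F' \<in> hom1 C V' W'; H' \<in> hom1 C W' X'\<rbrakk>
          \<Longrightarrow> ten_comp C H H' F F' \<in> iso2 C ((H \<otimes>\<^sub>1 H') \<cdot> (F \<otimes>\<^sub>1 F')) ((H \<cdot> F) \<otimes>\<^sub>1 (H' \<cdot> F'))"
    and ten_comp_natural: "\<lbrakk>F \<in> hom1 C V W; K \<in> hom1 C V W; H \<in> hom1 C W X; L \<in> hom1 C W X;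
          F' \<in> hom1 C V' W'; K' \<in> hom1 C V' W'; H' \<in> hom1 C W' X'; L' \<in> hom1 C W' X';
          \<alpha> \<in> hom2 C F K; \<beta> \<in> hom2 C H L; \<alpha>' \<in> hom2 C F' K'; \<beta>' \<in> hom2 C H' L'\<rbrakk>
          \<Longrightarrow> ten_comp C L L' K K' \<bullet> ((\<beta> \<otimes>\<^sub>2 \<beta>') \<star> (\<alpha> \<otimes>\<^sub>2 \<alpha>'))
              = ((\<beta> \<star> \<alpha>) \<otimes>\<^sub>2 (\<beta>' \<star> \<alpha>')) \<bullet> ten_comp C H H' F F'"
    and ten_comp_assoc: "\<lbrakk>F \<in> hom1 C V W; H \<in> hom1 C W X; K \<in> hom1 C X Y;
          F' \<in> hom1 C V' W'; H' \<in> hom1 C W' X'; K' \<in> hom1 C X' Y'\<rbrakk>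
          \<Longrightarrow> ten_comp C (K \<cdot> H) (K' \<cdot> H') F F' \<bullet> (ten_comp C K K' H H' \<triangleleft> (F \<otimes>\<^sub>1 F'))
              = ten_comp C K K' (H \<cdot> F) (H' \<cdot> F') \<bullet> ((K \<otimes>\<^sub>1 K') \<triangleright> ten_comp C H H' F F')"
    and ten_id_iso: "ten_id C V V' \<in> iso2 C (id1 C (V \<otimes>\<^sub>0 V')) (id1 C V \<otimes>\<^sub>1 id1 C V')"
    and ten_id_right: "\<lbrakk>F \<in> hom1 C V W; F' \<in> hom1 C V' W'\<rbrakk>
          \<Longrightarrow> ten_comp C F F' (id1 C V) (id1 C V') \<bullet> ((F \<otimes>\<^sub>1 F') \<triangleright> ten_id C V V')
              = id2 C (F \<otimes>\<^sub>1 F')"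
    and ten_id_left: "\<lbrakk>F \<in> hom1 C V W; F' \<in> hom1 C V' W'\<rbrakk>
          \<Longrightarrow> ten_comp C (id1 C W) (id1 C W') F F' \<bullet> (ten_id C W W' \<triangleleft> (F \<otimes>\<^sub>1 F'))
              = id2 C (F \<otimes>\<^sub>1 F')"

text \<open>The canonical pairing of \<open>cat_trace C V F\<close> and \<open>cat_trace C V' F'\<close> with values in
  \<open>cat_trace C (V \<otimes> V') (F \<otimes> F')\<close>.\<close>

definition trace_pairing ::
  "('k, 'o, 'a, 'm, 'z) monoidal_two_cat_scheme \<Rightarrow> 'o \<Rightarrow> 'o \<Rightarrow> 'm \<Rightarrow> 'm \<Rightarrow> 'm" where
  "trace_pairing C V V' \<xi> \<xi>' = vcomp C (ten2 C \<xi> \<xi>') (ten_id C V V')"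

section \<open>2-representations and their characters\<close>

record ('g, 'a, 'm) rep2 =
  act :: "'g \<Rightarrow> 'a"
  act_mult :: "'g \<Rightarrow> 'g \<Rightarrow> 'm"
  act_one :: 'm

locale two_representation =
  fixes C :: "('k, 'o, 'a, 'm, 'z) two_cat_scheme" (structure)
    and G :: "('g, 'y) monoid_scheme" and V :: 'o and R :: "('g, 'a, 'm) rep2"
  assumes act_closed: "g \<in> carrier G \<Longrightarrow> act R g \<in> hom1 C V V"
    and act_mult_iso: "\<lbrakk>g \<in> carrier G; h \<in> carrier G\<rbrakk>
          \<Longrightarrow> act_mult R g h \<in> iso2 C (act R g \<cdot> act R h) (act R (g \<otimes>\<^bsub>G\<^esub> h))"
    and act_one_iso: "act_one R \<in> iso2 C (act R \<one>\<^bsub>G\<^esub>) (id1 C V)"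
    and act_mult_assoc: "\<lbrakk>g \<in> carrier G; h \<in> carrier G; l \<in> carrier G\<rbrakk>
          \<Longrightarrow> act_mult R (g \<otimes>\<^bsub>G\<^esub> h) l \<bullet> (act_mult R g h \<triangleleft> act R l)
              = act_mult R g (h \<otimes>\<^bsub>G\<^esub> l) \<bullet> (act R g \<triangleright> act_mult R h l)"
    and act_one_left: "g \<in> carrier G \<Longrightarrow> act_mult R \<one>\<^bsub>G\<^esub> g = act_one R \<triangleleft> act R g"
    and act_one_right: "g \<in> carrier G \<Longrightarrow> act_mult R g \<one>\<^bsub>G\<^esub> = act R g \<triangleright> act_one R"

definition tensor_rep ::
  "('k, 'o, 'a, 'm, 'z) monoidal_two_cat_scheme \<Rightarrow> ('g, 'y) monoid_scheme
     \<Rightarrow> 'o \<Rightarrow> ('g, 'a, 'm) rep2 \<Rightarrow> 'o \<Rightarrow> ('g, 'a, 'm) rep2 \<Rightarrow> ('g, 'a, 'm) rep2" where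
  "tensor_rep C G V R W Q =
     \<lparr> act = (\<lambda>g. ten1 C (act R g) (act Q g)),
       act_mult = (\<lambda>g h. vcomp C (ten2 C (act_mult R g h) (act_mult Q g h))
                            (ten_comp C (act R g) (act Q g) (act R h) (act Q h))),
       act_one = vcomp C (inv2 C (id1 C (ten0 C V W)) (ten1 C (id1 C V) (id1 C W)) (ten_id C V W))
                   (ten2 C (act_one R) (act_one Q)) \<rparr>"

text \<open>The map \<open>\<psi>\<^sub>s\<close> from the categorical trace of \<open>act R g\<close> to that of \<open>act R (s g s\<inverse>)\<close>.\<close>

definition conj_map ::
  "('k, 'o, 'a, 'm, 'z) two_cat_scheme \<Rightarrow> ('g, 'y) monoid_scheme \<Rightarrow> 'o \<Rightarrow> ('g, 'a, 'm) rep2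
     \<Rightarrow> 'g \<Rightarrow> 'g \<Rightarrow> 'm \<Rightarrow> 'm" where
  "conj_map C G V R s g \<xi> =
     (let s' = inv\<^bsub>G\<^esub> s in
        act_mult R (s \<otimes>\<^bsub>G\<^esub> g) s' \<bullet>
        (act_mult R s g \<triangleleft> act R s') \<bullet>
        (act R s \<triangleright> \<xi> \<triangleleft> act R s') \<bullet>
        inv2 C (act R s \<cdot> act R s') (act R \<one>\<^bsub>G\<^esub>) (act_mult R s s') \<bullet>
        inv2 C (act R \<one>\<^bsub>G\<^esub>) (id1 C V) (act_one R))"
  for C (structure)

definition two_character ::
  "('k::field, 'o, 'a, 'm::ab_group_add, 'z) two_cat_scheme \<Rightarrow> ('g, 'y) monoid_scheme
     \<Rightarrow> 'o \<Rightarrow> ('g, 'a, 'm) rep2 \<Rightarrow> 'g \<Rightarrow> 'g \<Rightarrow> 'k" where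
  "two_character C G V R g h =
     trace_on (smul C) (cat_trace C V (act R g)) (conj_map C G V R h g)"

section \<open>Equivariant 1-morphisms and invariants\<close>

text \<open>Equivariant 1-morphisms are pairs \<open>(F, \<tau>)\<close> and trivialized ones are triples
  \<open>(F, \<tau>, \<epsilon>)\<close>; the values of \<open>\<tau>\<close> and \<open>\<epsilon>\<close> outside the group are irrelevant.\<close>

definition is_flip ::
  "('k, 'o, 'a, 'm, 'z) two_cat_scheme \<Rightarrow> ('g, 'y) monoid_scheme \<Rightarrow> 'o \<Rightarrow> ('g, 'a, 'm) rep2
     \<Rightarrow> 'o \<Rightarrow> ('g, 'a, 'm) rep2 \<Rightarrow> 'a \<Rightarrow> ('g \<Rightarrow> 'm) \<Rightarrow> bool" where
  "is_flip C G W Q V R F \<tau> \<longleftrightarrow>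
     F \<in> hom1 C W V \<and>
     (\<forall>g\<in>carrier G. \<tau> g \<in> iso2 C (act R g \<cdot> F) (F \<cdot> act Q g)) \<and>
     (\<forall>g\<in>carrier G. \<forall>h\<in>carrier G.
        \<tau> (g \<otimes>\<^bsub>G\<^esub> h) \<bullet> (act_mult R g h \<triangleleft> F)
        = (F \<triangleright> act_mult Q g h) \<bullet> (\<tau> g \<triangleleft> act Q h) \<bullet> (act R g \<triangleright> \<tau> h)) \<and>
     \<tau> \<one>\<^bsub>G\<^esub> = inv2 C (F \<cdot> act Q \<one>\<^bsub>G\<^esub>) F (F \<triangleright> act_one Q) \<bullet> (act_one R \<triangleleft> F)"
  for C (structure)

definition is_trivialization ::
  "('k, 'o, 'a, 'm, 'z) two_cat_scheme \<Rightarrow> ('g, 'y) monoid_scheme \<Rightarrow> 'o \<Rightarrow> ('g, 'a, 'm) rep2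
     \<Rightarrow> 'o \<Rightarrow> ('g, 'a, 'm) rep2 \<Rightarrow> 'a \<Rightarrow> ('g \<Rightarrow> 'm) \<Rightarrow> ('g \<Rightarrow> 'm) \<Rightarrow> bool" where
  "is_trivialization C G W Q V R F \<tau> \<epsilon> \<longleftrightarrow>
     (\<forall>g\<in>carrier G. \<epsilon> g \<in> iso2 C F (act R g \<cdot> F)) \<and>
     (\<forall>g\<in>carrier G. \<forall>h\<in>carrier G.
        (act_mult R g h \<triangleleft> F) \<bullet> (act R g \<triangleright> \<epsilon> h) \<bullet> \<epsilon> g = \<epsilon> (g \<otimes>\<^bsub>G\<^esub> h)) \<and>
     (\<forall>s\<in>carrier G. \<forall>g\<in>carrier G.
        let t = s \<otimes>\<^bsub>G\<^esub> g \<otimes>\<^bsub>G\<^esub> inv\<^bsub>G\<^esub> s;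
            \<tau>' = inv2 C (act R s \<cdot> F) (F \<cdot> act Q s) (\<tau> s)
        in (act_mult R s g \<triangleleft> F) \<bullet> (act R s \<triangleright> \<epsilon> g) \<bullet> \<tau>'
           = (act_mult R t s \<triangleleft> F) \<bullet> (act R t \<triangleright> \<tau>') \<bullet> (\<epsilon> t \<triangleleft> act Q s))"
  for C (structure)

definition commutes_flips ::
  "('k, 'o, 'a, 'm, 'z) two_cat_scheme \<Rightarrow> ('g, 'y) monoid_scheme \<Rightarrow> ('g, 'a, 'm) rep2
     \<Rightarrow> ('g, 'a, 'm) rep2 \<Rightarrow> ('g \<Rightarrow> 'm) \<Rightarrow> ('g \<Rightarrow> 'm) \<Rightarrow> 'm \<Rightarrow> bool" where
  "commutes_flips C G Q R \<tau> \<tau>' \<alpha> \<longleftrightarrow>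
     (\<forall>g\<in>carrier G. \<tau>' g \<bullet> (act R g \<triangleright> \<alpha>) = (\<alpha> \<triangleleft> act Q g) \<bullet> \<tau> g)"
  for C (structure)

definition commutes_triv ::
  "('k, 'o, 'a, 'm, 'z) two_cat_scheme \<Rightarrow> ('g, 'y) monoid_scheme
     \<Rightarrow> ('g, 'a, 'm) rep2 \<Rightarrow> ('g \<Rightarrow> 'm) \<Rightarrow> ('g \<Rightarrow> 'm) \<Rightarrow> 'm \<Rightarrow> bool" where
  "commutes_triv C G R \<epsilon> \<epsilon>' \<alpha> \<longleftrightarrow>
     (\<forall>g\<in>carrier G. \<epsilon>' g \<bullet> \<alpha> = (act R g \<triangleright> \<alpha>) \<bullet> \<epsilon> g)"
  for C (structure)

definition Hom_G ::
  "('k, 'o, 'a, 'm, 'z) two_cat_scheme \<Rightarrow> ('g, 'y) monoid_scheme \<Rightarrow> 'o \<Rightarrow> ('g, 'a, 'm) rep2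
     \<Rightarrow> 'o \<Rightarrow> ('g, 'a, 'm) rep2 \<Rightarrow> ('a \<times> ('g \<Rightarrow> 'm), 'm) cat" where
  "Hom_G C G W Q V R =
     \<lparr> objs = {(F, \<tau>). is_flip C G W Q V R F \<tau>},
       mors = (\<lambda>(F, \<tau>) (F', \<tau>'). {\<alpha> \<in> hom2 C F F'. commutes_flips C G Q R \<tau> \<tau>' \<alpha>}),
       ids = (\<lambda>(F, \<tau>). id2 C F),
       cmp = vcomp C \<rparr>"

definition Hom_G_triv ::
  "('k, 'o, 'a, 'm, 'z) two_cat_scheme \<Rightarrow> ('g, 'y) monoid_scheme \<Rightarrow> 'o \<Rightarrow> ('g, 'a, 'm) rep2
     \<Rightarrow> 'o \<Rightarrow> ('g, 'a, 'm) rep2 \<Rightarrow> ('a \<times> ('g \<Rightarrow> 'm) \<times> ('g \<Rightarrow> 'm), 'm) cat" where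
  "Hom_G_triv C G W Q V R =
     \<lparr> objs = {(F, \<tau>, \<epsilon>). is_flip C G W Q V R F \<tau> \<and> is_trivialization C G W Q V R F \<tau> \<epsilon>},
       mors = (\<lambda>(F, \<tau>, \<epsilon>) (F', \<tau>', \<epsilon>'). {\<alpha> \<in> hom2 C F F'.
                  commutes_flips C G Q R \<tau> \<tau>' \<alpha> \<and> commutes_triv C G R \<epsilon> \<epsilon>' \<alpha>}),
       ids = (\<lambda>(F, \<tau>, \<epsilon>). id2 C F),
       cmp = vcomp C \<rparr>"

text \<open>Action on objects of the functor \<open>F \<mapsto> U F\<close>, where \<open>(U, \<tau>\<^sub>U)\<close> is an equivariant
  1-morphism from \<open>X\<close> to \<open>V\<close>, the 2-representations on \<open>X\<close> and \<open>V\<close> are \<open>S\<close> and \<open>R\<close>, and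
  \<open>\<epsilon>\<close> trivializes the identity of \<open>X\<close>.\<close>

definition post_comp ::
  "('k, 'o, 'a, 'm, 'z) two_cat_scheme \<Rightarrow> ('g, 'a, 'm) rep2 \<Rightarrow> ('g \<Rightarrow> 'm) \<Rightarrow> ('g, 'a, 'm) rep2
     \<Rightarrow> 'a \<Rightarrow> ('g \<Rightarrow> 'm) \<Rightarrow> 'a \<times> ('g \<Rightarrow> 'm) \<Rightarrow> 'a \<times> ('g \<Rightarrow> 'm) \<times> ('g \<Rightarrow> 'm)" where
  "post_comp C S \<epsilon> R U \<tau>\<^sub>U = (\<lambda>(F, \<tau>).
     (U \<cdot> F,
      \<lambda>g. (U \<triangleright> \<tau> g) \<bullet> (\<tau>\<^sub>U g \<triangleleft> F),
      \<lambda>g. (inv2 C (act R g \<cdot> U) (U \<cdot> act S g) (\<tau>\<^sub>U g) \<triangleleft> F) \<bullet> (U \<triangleright> \<epsilon> g \<triangleleft> F)))"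
  for C (structure)

text \<open>The object \<open>X\<close> with its 2-representation \<open>S\<close>, the trivialization \<open>\<epsilon>\<close> of its identity and
  the equivariant 1-morphism \<open>(U, \<tau>\<^sub>U)\<close> are the invariants of the 2-representation \<open>R\<close> on \<open>V\<close>.
  The flips of the identity of \<open>X\<close> are identities.\<close>

definition is_invariants ::
  "('k, 'o, 'a, 'm, 'z) two_cat_scheme \<Rightarrow> ('g, 'y) monoid_scheme \<Rightarrow> 'o \<Rightarrow> ('g, 'a, 'm) rep2
     \<Rightarrow> 'o \<Rightarrow> ('g, 'a, 'm) rep2 \<Rightarrow> ('g \<Rightarrow> 'm) \<Rightarrow> 'a \<Rightarrow> ('g \<Rightarrow> 'm) \<Rightarrow> bool" where
  "is_invariants C G V R X S \<epsilon> U \<tau>\<^sub>U \<longleftrightarrow>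
     two_representation C G X S \<and>
     is_trivialization C G X S X S (id1 C X) (\<lambda>g. id2 C (act S g)) \<epsilon> \<and>
     is_flip C G X S V R U \<tau>\<^sub>U \<and>
     (\<forall>W Q. two_representation C G W Q \<longrightarrow>
        is_equivalence (Hom_G C G W Q X S) (Hom_G_triv C G W Q V R)
          (post_comp C S \<epsilon> R U \<tau>\<^sub>U) (\<lambda>_ _ \<alpha>. U \<triangleright> \<alpha>))"
  for C (structure)

end

theory Submission
  imports Defs
begin

text \<open>The theorem is a formula for one 2-representation combined with multiplicativity of characters.
If \<open>X\<close> is the object of invariants of a 2-representation \<open>R\<close> on \<open>V\<close>, then the dimension of
\<open>Dim(X)\<close> is the average over \<open>G\<close> of the sums of \<open>\<chi>_R(g, h)\<close> over commuting pairs (\<open>dim_invariants\<close>),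
and on commuting pairs the character of a tensor product is the product of the characters
(\<open>two_character_tensor\<close>).

For the formula, let \<open>U\<close> be the universal 1-morphism from \<open>X\<close> to \<open>V\<close>. Inverting its trivialization
gives an action of \<open>R\<close> on \<open>U\<close>, that is, compatible isomorphisms \<open>act_U g : g U \<Rightarrow> U\<close>. The universal
property is only ever tested on objects with the trivial 2-representation. There it says that the
2-morphisms \<open>F \<Rightarrow> F'\<close> between 1-morphisms to \<open>X\<close> are the equivariant 2-morphisms \<open>U F \<Rightarrow> U F'\<close>
(\<open>lift_equivariant\<close>, \<open>U_faithful\<close>), and that every 1-morphism to \<open>V\<close> with an action of \<open>R\<close> has the
form \<open>U L\<close> (\<open>action_factors\<close>). Taking \<open>F\<close> and \<open>F'\<close> to be the identity of \<open>X\<close>, one finds that \<open>Dim(X)\<close>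
is the space of fixed vectors of \<open>G\<close> acting by conjugation on \<open>E = 2Hom(U, U)\<close>. Since the order of \<open>G\<close>
is invertible, its dimension is the average of the traces of the elements of \<open>G\<close> on \<open>E\<close>
(\<open>averaging_dim\<close>).

The space \<open>E\<close> is the direct sum of the categorical traces \<open>Tr(R(g))\<close>, where \<open>\<xi>\<close> in \<open>Tr(R(g))\<close>
corresponds to \<open>act_U g\<close> after \<open>\<xi> U\<close> (\<open>trace_decomposition\<close>). The reason is an adjunction. The direct
sum \<open>P\<close> of all \<open>R(g)\<close> carries the regular action, so \<open>P\<close> is isomorphic to \<open>U L\<close> for some \<open>L\<close>. The sum
of the \<open>act_U g\<close> is an equivariant 2-morphism from \<open>P U\<close>, which is \<open>U L U\<close>, to \<open>U\<close>. Hence it lifts to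
a 2-morphism from \<open>L U\<close> to the identity, the counit of an adjunction in which \<open>L\<close> is left adjoint
to \<open>U\<close>; and 2-morphisms \<open>U \<Rightarrow> U\<close> become 2-morphisms \<open>id \<Rightarrow> U L\<close>, which are those from the identity
to \<open>P\<close>. Conjugation by \<open>s\<close> maps the summand of \<open>g\<close> to that of \<open>s g s\<inverse>\<close> by \<open>\<psi>\<^sub>s\<close> (\<open>Act_Phi\<close>). Only the
\<open>g\<close> that commute with \<open>s\<close> contribute to the trace of \<open>s\<close>, each with \<open>\<chi>_R(g, s)\<close>.

For the tensor product, the structure 2-isomorphisms of the pseudofunctor can be moved past the
structure isomorphisms of both 2-representations, whence \<open>\<psi>\<^sub>s\<close> of a pairing of \<open>\<xi>\<close> and \<open>\<xi>'\<close> is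
the pairing of \<open>\<psi>\<^sub>s \<xi>\<close> and \<open>\<psi>\<^sub>s \<xi>'\<close> (\<open>conj_map_pairing\<close>).

All computations with 2-morphisms are carried out in a calculus of cells, in which the laws of
whiskering hold as equations between arbitrary terms.\<close>

section \<open>Traces and dimensions by frames\<close>

definition linear_on ::
  "('k::field \<Rightarrow> 'm::ab_group_add \<Rightarrow> 'm) \<Rightarrow> ('k \<Rightarrow> 'n::ab_group_add \<Rightarrow> 'n) \<Rightarrow> 'm set \<Rightarrow> ('m \<Rightarrow> 'n) \<Rightarrow> bool" where
  "linear_on sc sc' S f \<longleftrightarrow>
     (\<forall>x\<in>S. \<forall>y\<in>S. f (x + y) = f x + f y) \<and> (\<forall>a. \<forall>x\<in>S. f (sc a x) = sc' a (f x))"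

text \<open>A finite family of vectors that may be linearly dependent, together with a linear choice of
coordinates. Traces can be computed from frames as from bases, and the image of a frame under a
linear map with a section is again a frame, whereas a basis would have to be checked for
independence.\<close>

definition frame ::
  "('k::field \<Rightarrow> 'm::ab_group_add \<Rightarrow> 'm) \<Rightarrow> 'm set \<Rightarrow> 'i set \<Rightarrow> ('i \<Rightarrow> 'm) \<Rightarrow> ('i \<Rightarrow> 'm \<Rightarrow> 'k) \<Rightarrow> bool" where
  "frame sc S I e c \<longleftrightarrow> finite I \<and> e ` I \<subseteq> S \<and> (\<forall>i\<in>I. linear_on sc (*) S (c i)) \<and>
     (\<forall>x\<in>S. (\<Sum>i\<in>I. sc (c i x) (e i)) = x)"

lemma linear_onI:
  assumes "\<And>x y. x \<in> S \<Longrightarrow> y \<in> S \<Longrightarrow> f (x + y) = f x + f y"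
    and "\<And>a x. x \<in> S \<Longrightarrow> f (sc a x) = sc' a (f x)"
  shows "linear_on sc sc' S f"
  unfolding linear_on_def using assms by blast

lemma linear_on_compose:
  assumes "linear_on sc sc' S f" "linear_on sc' sc'' T g" "f ` S \<subseteq> T"
  shows "linear_on sc sc'' S (\<lambda>x. g (f x))"
proof (rule linear_onI)
  have T: "f x \<in> T" if "x \<in> S" for x using assms(3) that by blast
  show "g (f (x + y)) = g (f x) + g (f y)" if "x \<in> S" "y \<in> S" for x y
    using assms(1,2) T[OF that(1)] T[OF that(2)] that unfolding linear_on_def by metis
  show "g (f (sc a x)) = sc'' a (g (f x))" if "x \<in> S" for a x
    using assms(1,2) T[OF that] that unfolding linear_on_def by metis
qed

context vector_space
begin

lemma linear_on_sum:
  assumes S: "subspace S" and lin: "linear_on scale sc' S f" and v: "vector_space sc'"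
    and fin: "finite I" and x: "\<And>i. i \<in> I \<Longrightarrow> x i \<in> S"
  shows "f (\<Sum>i\<in>I. scale (a i) (x i)) = (\<Sum>i\<in>I. sc' (a i) (f (x i)))"
  using fin x
proof (induction I)
  case empty
  interpret w: vector_space sc' by (fact v)
  have "f (scale 0 0) = sc' 0 (f 0)"
    using lin subspace_0[OF S] unfolding linear_on_def by blast
  then show ?case by simp
next
  case (insert i I)
  have "(\<Sum>i\<in>I. scale (a i) (x i)) \<in> S"
    using insert by (intro subspace_sum[OF S] subspace_scale[OF S]) auto
  moreover have "scale (a i) (x i) \<in> S" using insert by (intro subspace_scale[OF S]) auto
  ultimately show ?case
    using insert lin unfolding linear_on_def by simp
qed

text \<open>Expanding each vector of one frame in the other turns both sides into the same double sum.\<close>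

lemma frame_trace_unique:
  assumes S: "subspace S" and B: "frame scale S I e c" and D: "frame scale S J u d"
    and f: "linear_on scale scale S f" and fS: "f ` S \<subseteq> S"
  shows "(\<Sum>i\<in>I. c i (f (e i))) = (\<Sum>j\<in>J. d j (f (u j)))"
proof -
  have v: "vector_space ((*) :: 'a \<Rightarrow> 'a \<Rightarrow> 'a)"
    by unfold_locales (auto simp: algebra_simps)
  have vs: "vector_space scale" ..
  have eS: "\<And>i. i \<in> I \<Longrightarrow> e i \<in> S" and uS: "\<And>j. j \<in> J \<Longrightarrow> u j \<in> S"
    and fin: "finite I" "finite J"
    and cl: "\<And>i. i \<in> I \<Longrightarrow> linear_on scale (*) S (c i)"
    and dl: "\<And>i. i \<in> J \<Longrightarrow> linear_on scale (*) S (d i)"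
    and ex: "\<And>x. x \<in> S \<Longrightarrow> (\<Sum>i\<in>I. scale (c i x) (e i)) = x"
    and ux: "\<And>x. x \<in> S \<Longrightarrow> (\<Sum>i\<in>J. scale (d i x) (u i)) = x"
    using B D unfolding frame_def by blast+
  have fu: "\<And>j. j \<in> J \<Longrightarrow> f (u j) \<in> S" using fS uS by blast
  have fe: "f (e i) = (\<Sum>j\<in>J. scale (d j (e i)) (f (u j)))" if "i \<in> I" for i
    using linear_on_sum[OF S f vs fin(2), of u "\<lambda>j. d j (e i)"] uS ux[OF eS[OF that]] by simp
  have 1: "c i (f (e i)) = (\<Sum>j\<in>J. d j (e i) * c i (f (u j)))" if "i \<in> I" for i
    unfolding fe[OF that] by (rule linear_on_sum[OF S cl[OF that] v fin(2)]) (rule fu)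
  have 2: "d j (f (u j)) = (\<Sum>i\<in>I. c i (f (u j)) * d j (e i))" if "j \<in> J" for j
  proof -
    have "d j (f (u j)) = d j (\<Sum>i\<in>I. scale (c i (f (u j))) (e i))"
      using ex[OF fu[OF that]] by simp
    also have "\<dots> = (\<Sum>i\<in>I. c i (f (u j)) * d j (e i))"
      by (rule linear_on_sum[OF S dl[OF that] v fin(1)]) (rule eS)
    finally show ?thesis .
  qed
  have "(\<Sum>i\<in>I. c i (f (e i))) = (\<Sum>i\<in>I. \<Sum>j\<in>J. d j (e i) * c i (f (u j)))"
    using 1 by simp
  also have "\<dots> = (\<Sum>j\<in>J. \<Sum>i\<in>I. c i (f (u j)) * d j (e i))"
    by (subst sum.swap) (simp add: mult.commute)
  also have "\<dots> = (\<Sum>j\<in>J. d j (f (u j)))" using 2 by simp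
  finally show ?thesis .
qed

lemma frame_of_basis:
  assumes S: "subspace S" and B: "basis_of scale S B" and fin: "finite B"
  shows "frame scale S B (\<lambda>b. b) (\<lambda>b x. representation B x b)"
proof -
  have B': "B \<subseteq> S" "independent B" "S \<subseteq> span B"
    using B unfolding basis_of_def by auto
  show ?thesis
    unfolding frame_def
  proof (intro conjI ballI)
    show "linear_on scale (*) S (\<lambda>x. representation B x b)" for b
      by (rule linear_onI)
        (simp_all add: representation_add[OF B'(2)] representation_scale[OF B'(2)] subsetD[OF B'(3)])
    show "(\<Sum>b\<in>B. scale (representation B x b) b) = x" if "x \<in> S" for x
      by (rule sum_representation_eq[OF B'(2) subsetD[OF B'(3) that] fin]) simp
  qed (use fin B' in auto)
qed

lemma basis_of_finite:
  assumes "basis_of scale S B" "fin_dim scale S"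
  shows "finite B"
proof -
  obtain D where D: "finite D" "S \<subseteq> span D" using assms(2) unfolding fin_dim_def by auto
  have B: "B \<subseteq> S" "independent B" using assms(1) unfolding basis_of_def by simp_all
  show ?thesis
    using independent_span_bound[OF D(1) B(2) subset_trans[OF B(1) D(2)]] by simp
qed

lemma basis_of_exists: "\<exists>B. basis_of scale S B"
proof -
  obtain B where "B \<subseteq> S" "independent B" "S \<subseteq> span B"
    using basis_exists[of S] .
  then have "basis_of scale S B" by (simp add: basis_of_def)
  then show ?thesis ..
qed

lemma frame_fin_dim:
  assumes "frame scale S I e c" shows "fin_dim scale S"
  unfolding fin_dim_def
proof (intro exI[of _ "e ` I"] conjI subsetI)
  show "finite (e ` I)" "\<And>x. x \<in> e ` I \<Longrightarrow> x \<in> S" using assms unfolding frame_def by auto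
  show "x \<in> span (e ` I)" if "x \<in> S" for x
  proof -
    have "(\<Sum>i\<in>I. scale (c i x) (e i)) \<in> span (e ` I)"
      by (rule span_sum, rule span_scale, rule span_base, rule imageI)
    moreover have "(\<Sum>i\<in>I. scale (c i x) (e i)) = x" using assms that unfolding frame_def by blast
    ultimately show ?thesis by simp
  qed
qed

lemma trace_on_basis:
  assumes "subspace S" "fin_dim scale S"
  obtains B where "basis_of scale S B" "finite B"
    "\<And>f. trace_on scale S f = (\<Sum>b\<in>B. representation B (f b) b)"
proof (rule that)
  show 1: "basis_of scale S (SOME B. basis_of scale S B)"
    by (rule someI_ex[OF basis_of_exists])
  show "finite (SOME B. basis_of scale S B)"
    using 1 assms basis_of_finite by blast
  show "trace_on scale S f = (\<Sum>b\<in>(SOME B. basis_of scale S B).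
          representation (SOME B. basis_of scale S B) (f b) b)" for f
    unfolding trace_on_def Let_def ..
qed

lemma trace_on_frame:
  assumes S: "subspace S" and fr: "frame scale S I e c"
    and f: "linear_on scale scale S f" "f ` S \<subseteq> S"
  shows "trace_on scale S f = (\<Sum>i\<in>I. c i (f (e i)))"
proof -
  obtain B where "basis_of scale S B" "finite B"
    "trace_on scale S f = (\<Sum>b\<in>B. representation B (f b) b)"
    using trace_on_basis[OF S frame_fin_dim[OF fr]] by metis
  then show ?thesis
    using frame_trace_unique[OF S frame_of_basis[OF S] fr f] by simp
qed

text \<open>The dimension, as an element of the field, is the trace of the identity.\<close>

lemma dim_frame:
  assumes S: "subspace S" and fr: "frame scale S I e c"
  shows "of_nat (dim S) = (\<Sum>i\<in>I. c i (e i))"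
proof -
  obtain B where B: "basis_of scale S B" "finite B"
    using trace_on_basis[OF S frame_fin_dim[OF fr]] by metis
  then have i: "B \<subseteq> S" "independent B" "S \<subseteq> span B" unfolding basis_of_def by auto
  have "of_nat (dim S) = (\<Sum>b\<in>B. representation B b b)"
    using basis_card_eq_dim[OF i(1,3,2)] by (simp add: representation_basis[OF i(2)])
  also have "\<dots> = (\<Sum>i\<in>I. c i (e i))"
    by (rule frame_trace_unique[OF S frame_of_basis[OF S B] fr, of "\<lambda>x. x"])
      (simp_all add: linear_on_def)
  finally show ?thesis .
qed

lemma tensor_iso_fin_dim:
  assumes S: "subspace S" "fin_dim scale S" and T: "subspace T" "fin_dim scale T"
    and ti: "tensor_iso scale S T D b"
  shows "fin_dim scale D"
proof -
  obtain A B where "basis_of scale S A" "finite A" "basis_of scale T B" "finite B"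
    using trace_on_basis[OF S] trace_on_basis[OF T] by metis
  then have "basis_of scale D ((\<lambda>(x, y). b x y) ` (A \<times> B)) \<and> finite ((\<lambda>(x, y). b x y) ` (A \<times> B))"
    using ti unfolding tensor_iso_def by blast
  then show ?thesis unfolding basis_of_def fin_dim_def by blast
qed

text \<open>On the basis of products, the diagonal entries of the induced map are the products of
  diagonal entries of the factors.\<close>

lemma trace_tensor:
  assumes S: "subspace S" "fin_dim scale S" and T: "subspace T" "fin_dim scale T"
    and D: "subspace D"
    and ti: "tensor_iso scale S T D b"
    and f: "f ` S \<subseteq> S" and g: "g ` T \<subseteq> T"
    and h: "linear_on scale scale D h" "h ` D \<subseteq> D"
    and hb: "\<And>x y. x \<in> S \<Longrightarrow> y \<in> T \<Longrightarrow> h (b x y) = b (f x) (g y)"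
  shows "trace_on scale D h = trace_on scale S f * trace_on scale T g"
proof -
  obtain A where A: "basis_of scale S A" "finite A"
      and trA: "trace_on scale S f = (\<Sum>x\<in>A. representation A (f x) x)"
    using trace_on_basis[OF S] by metis
  obtain B where B: "basis_of scale T B" "finite B"
      and trB: "trace_on scale T g = (\<Sum>x\<in>B. representation B (g x) x)"
    using trace_on_basis[OF T] by metis
  let ?b = "\<lambda>(x, y). b x y"
  let ?P = "?b ` (A \<times> B)"
  have inj: "inj_on ?b (A \<times> B)" and P: "basis_of scale D ?P"
    and bil: "bilinear_on scale S T b"
    using ti A(1) B(1) unfolding tensor_iso_def by blast+
  have finP: "finite ?P" using A B by auto
  have indP: "independent ?P" using P unfolding basis_of_def by blast
  have AS: "A \<subseteq> S" "independent A" "S \<subseteq> span A" and BT: "B \<subseteq> T" "independent B" "T \<subseteq> span B"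
    using A B unfolding basis_of_def by auto
  have vs: "vector_space scale" ..
  have entry: "representation ?P (h (b x y)) (b x y) = representation A (f x) x * representation B (g y) y"
    if xy: "x \<in> A" "y \<in> B" for x y
  proof -
    have fx: "f x \<in> S" and gy: "g y \<in> T" using xy f g AS(1) BT(1) by blast+
    let ?r = "\<lambda>p. representation A (f x) (fst p) * representation B (g y) (snd p)"
    have l: "linear_on scale scale S (\<lambda>u. b u (g y))"
      using bil gy unfolding bilinear_on_def linear_on_def by blast
    have r: "linear_on scale scale T (\<lambda>u. b v u)" if "v \<in> S" for v
      using bil that unfolding bilinear_on_def linear_on_def by blast
    have fxe: "(\<Sum>u\<in>A. scale (representation A (f x) u) u) = f x"
      using sum_representation_eq[OF AS(2) subsetD[OF AS(3) fx] A(2)] by simp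
    have gye: "(\<Sum>u\<in>B. scale (representation B (g y) u) u) = g y"
      using sum_representation_eq[OF BT(2) subsetD[OF BT(3) gy] B(2)] by simp
    have "h (b x y) = b (f x) (g y)" using hb xy AS BT by blast
    also have "\<dots> = (\<Sum>u\<in>A. scale (representation A (f x) u) (b u (g y)))"
      using linear_on_sum[OF S(1) l vs A(2), of "\<lambda>u. u" "representation A (f x)"] subsetD[OF AS(1)]
      unfolding fxe by simp
    also have "\<dots> = (\<Sum>u\<in>A. scale (representation A (f x) u)
        (\<Sum>v\<in>B. scale (representation B (g y) v) (b u v)))"
    proof (rule sum.cong[OF refl])
      fix u assume u: "u \<in> A"
      have "b u (g y) = (\<Sum>v\<in>B. scale (representation B (g y) v) (b u v))"
        using linear_on_sum[OF T(1) r vs B(2), of u "\<lambda>u. u" "representation B (g y)"]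
          subsetD[OF AS(1) u] subsetD[OF BT(1)]
        unfolding gye by simp
      then show "scale (representation A (f x) u) (b u (g y)) = scale (representation A (f x) u)
        (\<Sum>v\<in>B. scale (representation B (g y) v) (b u v))" by simp
    qed
    also have "\<dots> = (\<Sum>p\<in>A \<times> B. scale (?r p) (?b p))"
      by (simp add: scale_sum_right sum.cartesian_product case_prod_unfold)
    finally have e: "h (b x y) = (\<Sum>p\<in>A \<times> B. scale (?r p) (?b p))" .
    have "representation ?P (h (b x y)) (b x y)
        = (\<Sum>p\<in>A \<times> B. ?r p * (if ?b p = b x y then 1 else 0))"
    proof -
      have sp: "?b p \<in> span ?P" if "p \<in> A \<times> B" for p
        by (rule span_base[OF imageI[OF that]])
      have "representation ?P (\<Sum>p\<in>A \<times> B. scale (?r p) (?b p)) (b x y)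
          = (\<Sum>p\<in>A \<times> B. representation ?P (scale (?r p) (?b p)) (b x y))"
        by (subst representation_sum[OF indP]) (rule span_scale, rule sp, assumption, rule refl)
      also have "\<dots> = (\<Sum>p\<in>A \<times> B. ?r p * (if ?b p = b x y then 1 else 0))"
      proof (rule sum.cong[OF refl])
        fix p assume p: "p \<in> A \<times> B"
        show "representation ?P (scale (?r p) (?b p)) (b x y) = ?r p * (if ?b p = b x y then 1 else 0)"
          using representation_scale[OF indP sp[OF p]] representation_basis[OF indP imageI[OF p]] by simp
      qed
      finally show ?thesis unfolding e .
    qed
    also have "\<dots> = (\<Sum>p\<in>A \<times> B. if p = (x, y) then ?r p else 0)"
    proof (rule sum.cong[OF refl])
      fix p assume "p \<in> A \<times> B"
      then have "?b p = b x y \<longleftrightarrow> p = (x, y)"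
        using inj_onD[OF inj, of p "(x, y)"] xy by auto
      then show "?r p * (if ?b p = b x y then 1 else 0) = (if p = (x, y) then ?r p else 0)" by simp
    qed
    also have "\<dots> = ?r (x, y)" using A B xy by simp
    finally show ?thesis by simp
  qed
  have "trace_on scale D h = (\<Sum>q\<in>?P. representation ?P (h q) q)"
    by (rule trace_on_frame[OF D frame_of_basis[OF D P finP] h])
  also have "\<dots> = (\<Sum>p\<in>A \<times> B. representation ?P (h (?b p)) (?b p))"
    by (simp add: sum.reindex[OF inj])
  also have "\<dots> = (\<Sum>p\<in>A \<times> B. representation A (f (fst p)) (fst p) * representation B (g (snd p)) (snd p))"
    by (rule sum.cong) (auto simp: entry)
  also have "\<dots> = (\<Sum>x\<in>A. representation A (f x) x) * (\<Sum>y\<in>B. representation B (g y) y)"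
    by (simp add: sum_product sum.cartesian_product case_prod_unfold)
  finally show ?thesis unfolding trA trB .
qed

lemma linear_on_cong:
  assumes "subspace S" "linear_on scale sc' S f" "\<And>x. x \<in> S \<Longrightarrow> g x = f x"
  shows "linear_on scale sc' S g"
  using assms(2,3) subspace_add[OF assms(1)] subspace_scale[OF assms(1)] unfolding linear_on_def by simp

lemma trace_on_cong:
  assumes "\<And>x. x \<in> S \<Longrightarrow> f x = g x"
  shows "trace_on scale S f = trace_on scale S g"
proof -
  have "(SOME B. basis_of scale S B) \<subseteq> S"
    using someI_ex[OF basis_of_exists[of S]] unfolding basis_of_def by blast
  then show ?thesis
    unfolding trace_on_def Let_def using assms by (intro sum.cong) auto
qed

lemma trace_on_zero: "(\<And>x. x \<in> S \<Longrightarrow> f x = 0) \<Longrightarrow> trace_on scale S f = 0"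
  using trace_on_cong[of S f "\<lambda>_. 0"] by (simp add: trace_on_def Let_def representation_zero)

lemma sum_constant_scale': "finite J \<Longrightarrow> (\<Sum>s\<in>J. x) = scale (of_nat (card J)) x"
  by (induction J rule: finite_induct) (simp_all add: scale_left_distrib)

lemma linear_on_sum': "subspace S \<Longrightarrow> linear_on scale scale S f \<Longrightarrow> finite I \<Longrightarrow> (\<And>i. i \<in> I \<Longrightarrow> x i \<in> S) \<Longrightarrow>
    f (\<Sum>i\<in>I. x i) = (\<Sum>i\<in>I. f (x i))"
  using linear_on_sum[of S scale f I x "\<lambda>_. 1"] vector_space_axioms by simp

text \<open>The dimension of the fixed space is the trace of the averaging projector. The space \<open>E\<close> is the sum of
the spaces \<open>T g\<close> by means of \<open>\<Phi>\<close> and \<open>\<Psi>\<close>, and \<open>u\<close> embeds \<open>D\<close> as the space of vectors fixed by all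
\<open>A s\<close>. Averaging the images under \<open>\<Phi>\<close> of bases of the \<open>T g\<close> yields a frame of \<open>D\<close>, and the diagonal
entries of the identity in this frame are those of the averages of the \<open>A s\<close>.\<close>

lemma averaging_dim:
  fixes T :: "'g \<Rightarrow> 'b set" and J :: "'j set"
  assumes I: "finite I" and J: "finite J" and N: "(of_nat (card J) :: 'a) \<noteq> 0"
    and T: "\<And>g. g \<in> I \<Longrightarrow> subspace (T g)" "\<And>g. g \<in> I \<Longrightarrow> fin_dim scale (T g)"
    and E: "subspace E" and D: "subspace D"
    and \<Phi>: "\<And>g. g \<in> I \<Longrightarrow> linear_on scale scale (T g) (\<Phi> g)" "\<And>g x. g \<in> I \<Longrightarrow> x \<in> T g \<Longrightarrow> \<Phi> g x \<in> E"
    and \<Psi>: "\<And>g. g \<in> I \<Longrightarrow> linear_on scale scale E (\<Psi> g)" "\<And>g x. g \<in> I \<Longrightarrow> x \<in> E \<Longrightarrow> \<Psi> g x \<in> T g"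
    and dec: "\<And>x. x \<in> E \<Longrightarrow> (\<Sum>g\<in>I. \<Phi> g (\<Psi> g x)) = x"
    and A: "\<And>s. s \<in> J \<Longrightarrow> linear_on scale scale E (A s)" "\<And>s x. s \<in> J \<Longrightarrow> x \<in> E \<Longrightarrow> A s x \<in> E"
    and inv: "\<And>t x. t \<in> J \<Longrightarrow> x \<in> E \<Longrightarrow> (\<Sum>s\<in>J. A t (A s x)) = (\<Sum>s\<in>J. A s x)"
    and u: "linear_on scale scale D u" "\<And>d. d \<in> D \<Longrightarrow> u d \<in> E" "inj_on u D"
    and fix1: "\<And>d s. d \<in> D \<Longrightarrow> s \<in> J \<Longrightarrow> A s (u d) = u d"
    and fix2: "\<And>x. x \<in> E \<Longrightarrow> (\<And>s. s \<in> J \<Longrightarrow> A s x = x) \<Longrightarrow> x \<in> u ` D"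
  shows "fin_dim scale D \<and>
    of_nat (dim D) = 1 / of_nat (card J) * (\<Sum>s\<in>J. \<Sum>g\<in>I. trace_on scale (T g) (\<lambda>\<xi>. \<Psi> g (A s (\<Phi> g \<xi>))))"
proof -
  have vs: "vector_space scale" ..
  let ?c = "1 / of_nat (card J) :: 'a"
  define pr where "pr x = scale ?c (\<Sum>s\<in>J. A s x)" for x
  have SA: "(\<Sum>s\<in>J. A s x) \<in> E" if "x \<in> E" for x by (rule subspace_sum[OF E]) (rule A(2)[OF _ that])
  have prE: "pr x \<in> E" if "x \<in> E" for x unfolding pr_def by (rule subspace_scale[OF E SA[OF that]])
  have prL: "linear_on scale scale E pr"
    unfolding linear_on_def pr_def
  proof (intro conjI ballI allI)
    show "scale ?c (\<Sum>s\<in>J. A s (x + y)) = scale ?c (\<Sum>s\<in>J. A s x) + scale ?c (\<Sum>s\<in>J. A s y)"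
      if "x \<in> E" "y \<in> E" for x y
      using A(1) that unfolding linear_on_def by (simp add: sum.distrib scale_right_distrib)
    show "scale ?c (\<Sum>s\<in>J. A s (scale a x)) = scale a (scale ?c (\<Sum>s\<in>J. A s x))" if "x \<in> E" for a x
      using A(1) that unfolding linear_on_def by (simp add: scale_sum_right[symmetric] mult.commute)
  qed
  have Apr: "A t (pr x) = pr x" if "x \<in> E" "t \<in> J" for t x
  proof -
    have "A t (pr x) = scale ?c (A t (\<Sum>s\<in>J. A s x))"
      using A(1)[OF that(2)] SA[OF that(1)] unfolding pr_def linear_on_def by blast
    also have "A t (\<Sum>s\<in>J. A s x) = (\<Sum>s\<in>J. A t (A s x))"
      by (rule linear_on_sum'[OF E A(1)[OF that(2)] J]) (rule A(2)[OF _ that(1)])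
    finally show ?thesis using inv[OF that(2,1)] unfolding pr_def by simp
  qed
  have pru: "pr (u d) = u d" if "d \<in> D" for d
    unfolding pr_def using fix1[OF that] sum_constant_scale'[OF J, of "u d"] N by simp
  define w where "w x = inv_into D u (pr x)" for x
  have w: "w x \<in> D" "u (w x) = pr x" if "x \<in> E" for x
  proof -
    have "pr x \<in> u ` D" by (rule fix2[OF prE[OF that]]) (rule Apr[OF that])
    then show "w x \<in> D" "u (w x) = pr x" unfolding w_def by (rule inv_into_into, rule f_inv_into_f)
  qed
  have "\<forall>g\<in>I. \<exists>B. basis_of scale (T g) B \<and> finite B \<and>
      (\<forall>f. trace_on scale (T g) f = (\<Sum>b\<in>B. representation B (f b) b))"
    using trace_on_basis[OF T] by metis
  then obtain Bs where Bs: "\<And>g. g \<in> I \<Longrightarrow> basis_of scale (T g) (Bs g)" "\<And>g. g \<in> I \<Longrightarrow> finite (Bs g)"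
    and tr: "\<And>g f. g \<in> I \<Longrightarrow> trace_on scale (T g) f = (\<Sum>b\<in>Bs g. representation (Bs g) (f b) b)"
    by (auto dest!: bchoice)
  have BT: "b \<in> T g" if "g \<in> I" "b \<in> Bs g" for g b using Bs(1)[OF that(1)] that(2) unfolding basis_of_def by blast
  have fr: "frame scale (T g) (Bs g) (\<lambda>b. b) (\<lambda>b x. representation (Bs g) x b)" if "g \<in> I" for g
    by (rule frame_of_basis[OF T(1)[OF that] Bs(1)[OF that] Bs(2)[OF that]])
  have rl: "linear_on scale (*) (T g) (\<lambda>x. representation (Bs g) x b)" if "g \<in> I" "b \<in> Bs g" for g b
    using fr[OF that(1)] that(2) unfolding frame_def by blast
  have rs: "(\<Sum>b\<in>Bs g. scale (representation (Bs g) x b) b) = x" if "g \<in> I" "x \<in> T g" for g x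
    using fr[OF that(1)] that(2) unfolding frame_def by blast
  let ?I = "Sigma I Bs"
  let ?e = "\<lambda>(g, b). w (\<Phi> g b)"
  let ?r = "\<lambda>(g, b) d. representation (Bs g) (\<Psi> g (u d)) b"
  have \<Phi>B: "\<Phi> g b \<in> E" if "g \<in> I" "b \<in> Bs g" for g b by (rule \<Phi>(2)[OF that(1) BT[OF that]])
  have eD: "w (\<Phi> g b) \<in> D" if "g \<in> I" "b \<in> Bs g" for g b by (rule w(1)[OF \<Phi>B[OF that]])
  have frD: "frame scale D ?I ?e ?r"
    unfolding frame_def
  proof (intro conjI ballI)
    show finI: "finite ?I" using I Bs(2) by simp
    show "?e ` ?I \<subseteq> D" using eD by auto
    show "linear_on scale (*) D (?r k)" if k: "k \<in> ?I" for k
    proof -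
      obtain g b where gb: "k = (g, b)" "g \<in> I" "b \<in> Bs g" using k by blast
      have "linear_on scale scale D (\<lambda>d. \<Psi> g (u d))"
        by (rule linear_on_compose[OF u(1) \<Psi>(1)[OF gb(2)]]) (use u(2) in blast)
      then have "linear_on scale (*) D (\<lambda>d. representation (Bs g) (\<Psi> g (u d)) b)"
        by (rule linear_on_compose[OF _ rl[OF gb(2,3)]]) (use u(2) \<Psi>(2)[OF gb(2)] in blast)
      then show ?thesis using gb(1) by simp
    qed
    fix d assume d: "d \<in> D"
    let ?s = "\<Sum>k\<in>?I. scale (?r k d) (?e k)"
    have sD: "?s \<in> D" by (rule subspace_sum[OF D], rule subspace_scale[OF D]) (use eD in auto)
    have "u ?s = (\<Sum>k\<in>?I. scale (?r k d) (u (?e k)))"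
      by (rule linear_on_sum[OF D u(1) vs finI]) (use eD in auto)
    also have "\<dots> = (\<Sum>k\<in>?I. scale (?r k d) (pr (\<Phi> (fst k) (snd k))))"
      by (rule sum.cong) (use w(2)[OF \<Phi>B] in auto)
    also have "\<dots> = pr (\<Sum>k\<in>?I. scale (?r k d) (\<Phi> (fst k) (snd k)))"
      by (rule linear_on_sum[OF E prL vs finI, symmetric]) (use \<Phi>B in auto)
    also have "(\<Sum>k\<in>?I. scale (?r k d) (\<Phi> (fst k) (snd k)))
        = (\<Sum>g\<in>I. \<Sum>b\<in>Bs g. scale (representation (Bs g) (\<Psi> g (u d)) b) (\<Phi> g b))"
      using I Bs(2) by (subst sum.Sigma) (auto simp: case_prod_unfold)
    also have "\<dots> = (\<Sum>g\<in>I. \<Phi> g (\<Psi> g (u d)))"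
    proof (rule sum.cong[OF refl])
      fix g assume g: "g \<in> I"
      have "(\<Sum>b\<in>Bs g. scale (representation (Bs g) (\<Psi> g (u d)) b) (\<Phi> g b))
          = \<Phi> g (\<Sum>b\<in>Bs g. scale (representation (Bs g) (\<Psi> g (u d)) b) b)"
        by (rule linear_on_sum[OF T(1)[OF g] \<Phi>(1)[OF g] vs Bs(2)[OF g], symmetric]) (rule BT[OF g])
      then show "(\<Sum>b\<in>Bs g. scale (representation (Bs g) (\<Psi> g (u d)) b) (\<Phi> g b)) = \<Phi> g (\<Psi> g (u d))"
        unfolding rs[OF g \<Psi>(2)[OF g u(2)[OF d]]] .
    qed
    also have "\<dots> = u d" by (rule dec[OF u(2)[OF d]])
    finally have "u ?s = u d" using pru[OF d] by simp
    then show "?s = d" using inj_onD[OF u(3) _ sD d] by blast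
  qed
  have "of_nat (dim D) = (\<Sum>k\<in>?I. ?r k (?e k))" by (rule dim_frame[OF D frD])
  also have "\<dots> = (\<Sum>g\<in>I. \<Sum>b\<in>Bs g. representation (Bs g) (\<Psi> g (u (w (\<Phi> g b)))) b)"
    using I Bs(2) by (subst sum.Sigma) (auto simp: case_prod_unfold)
  also have "\<dots> = (\<Sum>g\<in>I. \<Sum>b\<in>Bs g. ?c * (\<Sum>s\<in>J. representation (Bs g) (\<Psi> g (A s (\<Phi> g b))) b))"
  proof (intro sum.cong refl)
    fix g b assume g: "g \<in> I" and b: "b \<in> Bs g"
    note p = \<Phi>B[OF g b]
    have l: "linear_on scale (*) E (\<lambda>x. representation (Bs g) (\<Psi> g x) b)"
      by (rule linear_on_compose[OF \<Psi>(1)[OF g] rl[OF g b]]) (use \<Psi>(2)[OF g] in blast)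
    have v: "vector_space ((*) :: 'a \<Rightarrow> 'a \<Rightarrow> 'a)" by unfold_locales (auto simp: algebra_simps)
    have "representation (Bs g) (\<Psi> g (u (w (\<Phi> g b)))) b = representation (Bs g) (\<Psi> g (pr (\<Phi> g b))) b"
      using w(2)[OF p] by simp
    also have "\<dots> = ?c * representation (Bs g) (\<Psi> g (\<Sum>s\<in>J. A s (\<Phi> g b))) b"
      using l SA[OF p] unfolding pr_def linear_on_def by blast
    also have "representation (Bs g) (\<Psi> g (\<Sum>s\<in>J. A s (\<Phi> g b))) b = (\<Sum>s\<in>J. representation (Bs g) (\<Psi> g (A s (\<Phi> g b))) b)"
      using linear_on_sum[OF E l v J, of "\<lambda>s. A s (\<Phi> g b)" "\<lambda>_. 1"] A(2)[OF _ p] by simp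
    finally show "representation (Bs g) (\<Psi> g (u (w (\<Phi> g b)))) b = ?c * (\<Sum>s\<in>J. representation (Bs g) (\<Psi> g (A s (\<Phi> g b))) b)" .
  qed
  also have "\<dots> = ?c * (\<Sum>g\<in>I. \<Sum>s\<in>J. \<Sum>b\<in>Bs g. representation (Bs g) (\<Psi> g (A s (\<Phi> g b))) b)"
    by (simp only: sum_distrib_left[symmetric] sum.swap[of _ J])
  also have "(\<Sum>g\<in>I. \<Sum>s\<in>J. \<Sum>b\<in>Bs g. representation (Bs g) (\<Psi> g (A s (\<Phi> g b))) b)
      = (\<Sum>g\<in>I. \<Sum>s\<in>J. trace_on scale (T g) (\<lambda>\<xi>. \<Psi> g (A s (\<Phi> g \<xi>))))"
    using tr by (intro sum.cong) simp_all
  also have "\<dots> = (\<Sum>s\<in>J. \<Sum>g\<in>I. trace_on scale (T g) (\<lambda>\<xi>. \<Psi> g (A s (\<Phi> g \<xi>))))" by (rule sum.swap)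
  finally show ?thesis using frame_fin_dim[OF frD] by blast
qed

end

section \<open>A calculus of 2-cells\<close>

type_synonym ('o, 'a) arrow = "'o \<times> 'o \<times> 'a"

text \<open>The spaces of 2-morphisms may overlap, so a 2-morphism does not determine its source and target; a
cell records them. They are recorded as paths, formal composites of 1-morphisms, and not as
1-morphisms: a path can be cancelled from both sides of an equation, so that whiskering preserves
and reflects whether two cells can be composed. Since an undefined composite is \<open>Null\<close>, the laws
\<open>vc_assoc\<close>, \<open>wh_vc\<close> and \<open>wh_wh\<close> then hold for all cells and can be used for rewriting without checking
types.\<close>

datatype ('o, 'a, 'm) cell =
  Null | Cell (sob: 'o) (tob: 'o) (src: "('o, 'a) arrow list") (tgt: "('o, 'a) arrow list") (val: 'm)

text \<open>The argument \<open>V\<close> is the value on the empty path, which carries no object.\<close>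

fun pdom :: "'o \<Rightarrow> ('o, 'a) arrow list \<Rightarrow> 'o" where
  "pdom V [] = V"
| "pdom V ((A, B, F) # p) = pdom A p"

fun pcod :: "'o \<Rightarrow> ('o, 'a) arrow list \<Rightarrow> 'o" where
  "pcod V [] = V"
| "pcod V ((A, B, F) # p) = B"

lemma pdom_append [simp]: "pdom V (p @ q) = pdom (pdom V p) q"
  by (induction V p rule: pdom.induct) auto

lemma pcod_append [simp]: "pcod V (p @ q) = pcod (pcod V q) p"
  by (cases "(V, p)" rule: pcod.cases) auto

context klinear_2category
begin

fun path :: "'o \<Rightarrow> 'o \<Rightarrow> ('o, 'a) arrow list \<Rightarrow> bool" where
  "path V W [] \<longleftrightarrow> V = W"
| "path V W ((A, B, F) # p) \<longleftrightarrow> B = W \<and> F \<in> hom1 C A B \<and> path V A p"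

fun pcomp :: "'o \<Rightarrow> ('o, 'a) arrow list \<Rightarrow> 'a" where
  "pcomp V [] = id1 C V"
| "pcomp V ((A, B, F) # p) = F \<cdot> pcomp V p"

lemma path_pdom: "path V W p \<Longrightarrow> pdom W p = V"
  by (induction V W p rule: path.induct) auto

lemma path_pcod: "path V W p \<Longrightarrow> pcod V p = W"
  by (induction V W p rule: path.induct) auto

lemma path_append [simp]: "path V W (p @ q) \<longleftrightarrow> path (pdom W p) W p \<and> path V (pdom W p) q"
  by (induction V W p rule: path.induct) auto

lemma pcomp_closed: "path V W p \<Longrightarrow> pcomp V p \<in> hom1 C V W"
  by (induction V W p rule: path.induct) (auto intro: id1_closed comp1_closed)

lemma pcomp_append:
  "path X W p \<Longrightarrow> path V X q \<Longrightarrow> pcomp V (p @ q) = pcomp X p \<cdot> pcomp V q"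
proof (induction X W p rule: path.induct)
  case (1 X W)
  then show ?case using comp1_id_left[OF pcomp_closed[OF 1(2)]] by simp
next
  case (2 X W A B F p)
  then show ?case
    using comp1_assoc[OF pcomp_closed[OF 2(3)] pcomp_closed[of X A p], of F B] by simp (metis)
qed

definition ok :: "('o, 'a, 'm) cell \<Rightarrow> bool" where
  "ok x \<longleftrightarrow> x \<noteq> Null \<and> path (sob x) (tob x) (src x) \<and> path (sob x) (tob x) (tgt x) \<and>
     val x \<in> hom2 C (pcomp (sob x) (src x)) (pcomp (sob x) (tgt x))"

text \<open>Types are only needed where identities are cancelled or cells exchanged, and in the passage
between cells and 2-morphisms.\<close>

definition ty :: "('o, 'a, 'm) cell \<Rightarrow> 'o \<Rightarrow> 'o \<Rightarrow> ('o, 'a) arrow list \<Rightarrow> ('o, 'a) arrow list \<Rightarrow> bool" where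
  "ty x V W p q \<longleftrightarrow> ok x \<and> sob x = V \<and> tob x = W \<and> src x = p \<and> tgt x = q"

definition mk_cell :: "'o \<Rightarrow> 'o \<Rightarrow> ('o, 'a) arrow list \<Rightarrow> ('o, 'a) arrow list \<Rightarrow> 'm \<Rightarrow> ('o, 'a, 'm) cell" where
  "mk_cell V W p q \<alpha> = (if ok (Cell V W p q \<alpha>) then Cell V W p q \<alpha> else Null)"

definition vc :: "('o, 'a, 'm) cell \<Rightarrow> ('o, 'a, 'm) cell \<Rightarrow> ('o, 'a, 'm) cell" (infixr \<open>**\<close> 65) where
  "y ** x = (if ok y \<and> ok x \<and> sob x = sob y \<and> tob x = tob y \<and> tgt x = src y
     then Cell (sob x) (tob x) (src x) (tgt y) (val y \<bullet> val x) else Null)"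

definition wh :: "('o, 'a) arrow list \<Rightarrow> ('o, 'a, 'm) cell \<Rightarrow> ('o, 'a) arrow list \<Rightarrow> ('o, 'a, 'm) cell" where
  "wh H x F = (if ok x \<and> path (pdom (sob x) F) (sob x) F \<and> path (tob x) (pcod (tob x) H) H
     then Cell (pdom (sob x) F) (pcod (tob x) H) (H @ src x @ F) (H @ tgt x @ F)
            (pcomp (tob x) H \<triangleright> val x \<triangleleft> pcomp (pdom (sob x) F) F)
     else Null)"

definition id_cell :: "'o \<Rightarrow> 'o \<Rightarrow> ('o, 'a) arrow list \<Rightarrow> ('o, 'a, 'm) cell" where
  "id_cell V W p = mk_cell V W p p (id2 C (pcomp V p))"

lemma ok_Null [simp]: "\<not> ok Null"
  by (simp add: ok_def)

lemma ok_Cell: "ok (Cell V W p q \<alpha>) \<longleftrightarrow>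
    path V W p \<and> path V W q \<and> \<alpha> \<in> hom2 C (pcomp V p) (pcomp V q)"
  by (simp add: ok_def)

lemma okD:
  assumes "ok x"
  shows "path (sob x) (tob x) (src x)" "path (sob x) (tob x) (tgt x)"
    "pcomp (sob x) (src x) \<in> hom1 C (sob x) (tob x)"
    "pcomp (sob x) (tgt x) \<in> hom1 C (sob x) (tob x)"
    "val x \<in> hom2 C (pcomp (sob x) (src x)) (pcomp (sob x) (tgt x))"
  using assms by (simp_all add: ok_def pcomp_closed)

lemma whisker_closed:
  assumes "F \<in> hom1 C V W" "H \<in> hom1 C W X" "H' \<in> hom1 C W X" "K \<in> hom1 C X Y" "\<alpha> \<in> hom2 C H H'"
  shows "K \<triangleright> \<alpha> \<triangleleft> F \<in> hom2 C (K \<cdot> (H \<cdot> F)) (K \<cdot> (H' \<cdot> F))"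
  unfolding lwhisk_def rwhisk_def
  by (rule hcomp_closed hcomp_closed[OF _ _ _ _ id2_closed] id2_closed comp1_closed assms)+

lemma ok_vc [simp]:
  "ok (y ** x) \<longleftrightarrow> ok y \<and> ok x \<and> sob x = sob y \<and> tob x = tob y \<and> tgt x = src y"
proof (cases "ok y \<and> ok x \<and> sob x = sob y \<and> tob x = tob y \<and> tgt x = src y")
  case True
  then have o: "ok x" "ok y" and e: "sob y = sob x" "tob y = tob x" "src y = tgt x" by simp_all
  note dx = okD[OF o(1)] and dy = okD[OF o(2), unfolded e]
  have "val y \<bullet> val x \<in> hom2 C (pcomp (sob x) (src x)) (pcomp (sob x) (tgt y))"
    by (rule vcomp_closed[OF dx(3,4) dy(4) dx(5) dy(5)])
  then have "ok (y ** x)" using o e dx dy by (simp add: vc_def ok_Cell)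
  then show ?thesis using True by simp
next
  case False
  then have "y ** x = Null" unfolding vc_def by (rule if_not_P)
  then show ?thesis using False by (metis ok_Null)
qed

lemma ok_wh [simp]:
  "ok (wh H x F) \<longleftrightarrow> ok x \<and> path (pdom (sob x) F) (sob x) F \<and> path (tob x) (pcod (tob x) H) H"
proof (cases "ok x \<and> path (pdom (sob x) F) (sob x) F \<and> path (tob x) (pcod (tob x) H) H")
  case True
  note d = okD[OF conjunct1[OF True]]
  have F: "path (pdom (sob x) F) (sob x) F" and H: "path (tob x) (pcod (tob x) H) H" using True by auto
  have p: "path (pdom (sob x) F) (pcod (tob x) H) (H @ r @ F)" 
    "pcomp (pdom (sob x) F) (H @ r @ F) = pcomp (tob x) H \<cdot> (pcomp (sob x) r \<cdot> pcomp (pdom (sob x) F) F)"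
    if "path (sob x) (tob x) r" for r
  proof -
    have 1: "path (pdom (sob x) F) (tob x) (r @ F)" using that F by (simp add: path_pdom[OF that])
    show "path (pdom (sob x) F) (pcod (tob x) H) (H @ r @ F)" using H 1 path_append[of _ "pcod (tob x) H" H "r @ F"] path_pdom[OF H] by simp
    show "pcomp (pdom (sob x) F) (H @ r @ F) = pcomp (tob x) H \<cdot> (pcomp (sob x) r \<cdot> pcomp (pdom (sob x) F) F)"
      using pcomp_append[OF H 1] pcomp_append[OF that F] by simp
  qed
  have "ok (wh H x F)"
    using True p[OF d(1)] p[OF d(2)]
      whisker_closed[OF pcomp_closed[OF F] d(3,4) pcomp_closed[OF H] d(5)]
    by (simp add: wh_def ok_Cell)
  then show ?thesis using True by simp
next
  case False
  then have "wh H x F = Null" unfolding wh_def by (rule if_not_P)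
  then show ?thesis using False by (metis ok_Null)
qed

lemma vc_sel:
  assumes "ok (y ** x)"
  shows "sob (y ** x) = sob x" "tob (y ** x) = tob x" "src (y ** x) = src x" "tgt (y ** x) = tgt y"
    "val (y ** x) = val y \<bullet> val x"
  using assms unfolding ok_vc by (simp_all add: vc_def)

lemma wh_sel:
  assumes "ok (wh H x F)"
  shows "sob (wh H x F) = pdom (sob x) F" "tob (wh H x F) = pcod (tob x) H"
    "src (wh H x F) = H @ src x @ F" "tgt (wh H x F) = H @ tgt x @ F"
    "val (wh H x F) = pcomp (tob x) H \<triangleright> val x \<triangleleft> pcomp (pdom (sob x) F) F"
  using assms unfolding ok_wh by (simp_all add: wh_def)

text \<open>Ill-typed terms \<open>Cell V W p q \<alpha>\<close> differ from \<open>Null\<close> but compose like it. The results of all operations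
are clean, and equations between clean cells can be checked on well-typed ones.\<close>

definition clean :: "('o, 'a, 'm) cell \<Rightarrow> bool" where
  "clean x \<longleftrightarrow> x = Null \<or> ok x"

lemma clean_vc [simp]: "clean (y ** x)"
  unfolding clean_def ok_vc by (simp add: vc_def)

lemma clean_wh [simp]: "clean (wh H x F)"
  unfolding clean_def ok_wh by (simp add: wh_def)

lemma clean_mk_cell [simp]: "clean (mk_cell V W p q \<alpha>)"
  unfolding clean_def mk_cell_def by simp

lemma clean_id_cell [simp]: "clean (id_cell V W p)"
  unfolding id_cell_def by simp

lemma ok_clean: "ok x \<Longrightarrow> clean x"
  by (simp add: clean_def)

abbreviation same_data :: "('o, 'a, 'm) cell \<Rightarrow> ('o, 'a, 'm) cell \<Rightarrow> bool" where
  "same_data x y \<equiv> sob x = sob y \<and> tob x = tob y \<and> src x = src y \<and> tgt x = tgt y \<and> val x = val y"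

lemma cell_eqI:
  assumes "clean x" "clean y" "ok x \<longleftrightarrow> ok y"
    and "ok x \<Longrightarrow> ok y \<Longrightarrow> same_data x y"
  shows "x = y"
  using assms unfolding clean_def by (cases x; cases y) auto

lemma vc_assoc: "(z ** y) ** x = z ** (y ** x)"
proof (rule cell_eqI)
  have "ok ((z ** y) ** x) \<longleftrightarrow> ok (z ** y) \<and> ok (y ** x)"
    by (cases "ok (z ** y)") (auto simp: vc_sel)
  moreover have "ok (z ** (y ** x)) \<longleftrightarrow> ok (z ** y) \<and> ok (y ** x)"
    by (cases "ok (y ** x)") (auto simp: vc_sel)
  ultimately show "ok ((z ** y) ** x) \<longleftrightarrow> ok (z ** (y ** x))" by simp
  assume a: "ok ((z ** y) ** x)" and b: "ok (z ** (y ** x))"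
  then have yx: "ok (y ** x)" and zy: "ok (z ** y)" by (simp_all only: ok_vc)
  have o: "ok x" "ok y" "ok z" using yx zy by auto
  note e = yx[unfolded ok_vc] zy[unfolded ok_vc]
  have "val (z ** y) \<bullet> val x = val z \<bullet> val (y ** x)"
    using vcomp_assoc[OF okD(3)[OF o(1)] okD(4)[OF o(1)] _ _ okD(5)[OF o(1)],
        of "pcomp (sob x) (tgt y)" "pcomp (sob x) (tgt z)" "val y" "val z"]
      okD[OF o(2)] okD[OF o(3)] e vc_sel[OF yx] vc_sel[OF zy] by simp
  then show "same_data ((z ** y) ** x) (z ** y ** x)"
    using vc_sel[OF yx] vc_sel[OF zy] vc_sel[OF a] vc_sel[OF b] by simp
qed simp_all

lemma vcomp_id_id: "F \<in> hom1 C V W \<Longrightarrow> id2 C F \<bullet> id2 C F = id2 C F"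
  by (rule vcomp_id_left[OF _ _ id2_closed])

lemma whisker_vcomp:
  assumes F: "F \<in> hom1 C V W" and H: "H \<in> hom1 C W X" "H' \<in> hom1 C W X" "H'' \<in> hom1 C W X"
    and K: "K \<in> hom1 C X Y" and a: "\<alpha> \<in> hom2 C H H'" and b: "\<beta> \<in> hom2 C H' H''"
  shows "K \<triangleright> (\<beta> \<bullet> \<alpha>) \<triangleleft> F = (K \<triangleright> \<beta> \<triangleleft> F) \<bullet> (K \<triangleright> \<alpha> \<triangleleft> F)"
proof -
  have "(\<beta> \<bullet> \<alpha>) \<star> id2 C F = (\<beta> \<star> id2 C F) \<bullet> (\<alpha> \<star> id2 C F)"
    using interchange[OF F F F H id2_closed[OF F] id2_closed[OF F] a b] vcomp_id_id[OF F] by simp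
  then show ?thesis
    unfolding lwhisk_def rwhisk_def
    using interchange[OF comp1_closed[OF F H(1)] comp1_closed[OF F H(2)] comp1_closed[OF F H(3)] K K K
        hcomp_closed[OF F F H(1,2) id2_closed[OF F] a] hcomp_closed[OF F F H(2,3) id2_closed[OF F] b]
        id2_closed[OF K] id2_closed[OF K]] vcomp_id_id[OF K] by simp
qed

lemma whisker_whisker:
  assumes F: "F \<in> hom1 C V0 V" and F': "F' \<in> hom1 C V W" and H: "H \<in> hom1 C W X" "H' \<in> hom1 C W X"
    and K: "K \<in> hom1 C X Y" and K': "K' \<in> hom1 C Y Z" and a: "\<alpha> \<in> hom2 C H H'"
  shows "K' \<triangleright> (K \<triangleright> \<alpha> \<triangleleft> F') \<triangleleft> F = (K' \<cdot> K) \<triangleright> \<alpha> \<triangleleft> (F' \<cdot> F)"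
proof -
  note iF = id2_closed[OF F] and iF' = id2_closed[OF F'] and iK = id2_closed[OF K] and iK' = id2_closed[OF K']
  note aF' = hcomp_closed[OF F' F' H iF' a] and cH = comp1_closed[OF F' H(1)] comp1_closed[OF F' H(2)]
  have "(id2 C K \<star> (\<alpha> \<star> id2 C F')) \<star> id2 C F = id2 C K \<star> ((\<alpha> \<star> id2 C F') \<star> id2 C F)"
    by (rule hcomp_assoc[OF F F cH K K iF aF' iK])
  also have "(\<alpha> \<star> id2 C F') \<star> id2 C F = \<alpha> \<star> (id2 C F' \<star> id2 C F)"
    by (rule hcomp_assoc[OF F F F' F' H iF iF' a])
  finally have 1: "(id2 C K \<star> (\<alpha> \<star> id2 C F')) \<star> id2 C F = id2 C K \<star> (\<alpha> \<star> id2 C (F' \<cdot> F))"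
    using hcomp_id2[OF F F'] by simp
  note FF = comp1_closed[OF F F'] and iFF = id2_closed[OF comp1_closed[OF F F']]
  have "(id2 C K' \<star> id2 C K) \<star> (\<alpha> \<star> id2 C (F' \<cdot> F)) = id2 C K' \<star> (id2 C K \<star> (\<alpha> \<star> id2 C (F' \<cdot> F)))"
    by (rule hcomp_assoc[OF comp1_closed[OF FF H(1)] comp1_closed[OF FF H(2)] K K K' K'
          hcomp_closed[OF FF FF H iFF a] iK iK'])
  then show ?thesis
    unfolding lwhisk_def rwhisk_def using 1 hcomp_id2[OF K K'] by simp
qed

lemma path_end_unique:
  "path A V F \<Longrightarrow> path A' V' F \<Longrightarrow> pdom V F = pdom V' F \<Longrightarrow> V = V'"
  by (cases "(V, F)" rule: pdom.cases) auto

text \<open>If the right-hand side is well-typed, then the types of \<open>x\<close> and \<open>y\<close> match after \<open>H\<close> and \<open>F\<close> have been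
attached, hence also before, by cancellation in lists. This is the point of paths.\<close>

lemma wh_vc: "wh H (y ** x) F = wh H y F ** wh H x F"
proof (rule cell_eqI)
  show iff: "ok (wh H (y ** x) F) \<longleftrightarrow> ok (wh H y F ** wh H x F)"
  proof (cases "ok (y ** x)")
    case True
    note e = True[unfolded ok_vc]
    then have "ok (wh H x F) \<longleftrightarrow> ok (wh H y F)" by simp
    then show ?thesis
      using e by (cases "ok (wh H x F)") (auto simp: vc_sel[OF True] wh_sel)
  next
    case False
    moreover have "\<not> ok (wh H y F ** wh H x F)"
    proof
      assume o: "ok (wh H y F ** wh H x F)"
      then have y: "ok (wh H y F)" and x: "ok (wh H x F)" by (simp_all only: ok_vc)
      note e = o[unfolded ok_vc wh_sel[OF x] wh_sel[OF y]]
      note px = x[unfolded ok_wh] and py = y[unfolded ok_wh]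
      have 1: "tgt x = src y" using e by simp
      have 2: "sob x = sob y" by (rule path_end_unique) (use px py e in blast)+
      have "pdom (pcod (tob x) H) H = tob x" "pdom (pcod (tob y) H) H = tob y"
        using px py path_pdom by blast+
      then have 3: "tob x = tob y" using e by metis
      show False using False 1 2 3 px py by simp
    qed
    ultimately show ?thesis unfolding ok_wh[of H "y ** x"] by blast
  qed
  assume a: "ok (wh H (y ** x) F)" and b: "ok (wh H y F ** wh H x F)"
  have y: "ok (wh H y F)" and x: "ok (wh H x F)" and yx: "ok (y ** x)"
    using a b by (simp_all only: ok_vc ok_wh)
  note px = x[unfolded ok_wh] and e = yx[unfolded ok_vc]
  have ox: "ok x" and oy: "ok y" using e by simp_all
  have "pcomp (tob x) H \<triangleright> (val y \<bullet> val x) \<triangleleft> pcomp (pdom (sob x) F) F =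
    (pcomp (tob x) H \<triangleright> val y \<triangleleft> pcomp (pdom (sob x) F) F) \<bullet> (pcomp (tob x) H \<triangleright> val x \<triangleleft> pcomp (pdom (sob x) F) F)"
    by (rule whisker_vcomp[where V="pdom (sob x) F" and W="sob x" and X="tob x" and Y="pcod (tob x) H"
          and H="pcomp (sob x) (src x)" and H'="pcomp (sob x) (tgt x)" and H''="pcomp (sob x) (tgt y)"])
      (use px okD[OF ox] okD[OF oy] e in \<open>simp_all add: pcomp_closed\<close>)
  then show "same_data (wh H (y ** x) F) (wh H y F ** wh H x F)"
    using e unfolding wh_sel[OF a] vc_sel[OF b] wh_sel[OF x] wh_sel[OF y] vc_sel[OF yx] by simp
qed simp_all

lemma wh_wh: "wh H (wh H' x F') F = wh (H @ H') x (F' @ F)"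
proof (rule cell_eqI)
  have H: "path (pdom W'' H) W'' H \<and> path W (pdom W'' H) H' \<longleftrightarrow>
      path W (pcod W H') H' \<and> path (pcod W H') W'' H" for W W''
    by (metis path_pcod path_pdom)
  show "ok (wh H (wh H' x F') F) \<longleftrightarrow> ok (wh (H @ H') x (F' @ F))"
  proof (cases "ok (wh H' x F')")
    case True
    then show ?thesis unfolding ok_wh[of H] ok_wh[of "H @ H'"] wh_sel[OF True] path_append pcod_append pdom_append H
      by simp
  next
    case False
    then show ?thesis unfolding ok_wh path_append pcod_append pdom_append H
      by blast
  qed
  assume a: "ok (wh H (wh H' x F') F)" and b: "ok (wh (H @ H') x (F' @ F))"
  have i: "ok (wh H' x F')" using a unfolding ok_wh[of H] by blast
  note p = i[unfolded ok_wh] and p' = a[unfolded ok_wh[of H] wh_sel[OF i]]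
  have ox: "ok x" using p by blast
  have c: "pcomp (tob x) (H @ H') = pcomp (pcod (tob x) H') H \<cdot> pcomp (tob x) H'"
    "pcomp (pdom (pdom (sob x) F') F) (F' @ F) = pcomp (pdom (sob x) F') F' \<cdot> pcomp (pdom (pdom (sob x) F') F) F"
    using p p' pcomp_append by blast+
  have "pcomp (pcod (tob x) H') H \<triangleright> (pcomp (tob x) H' \<triangleright> val x \<triangleleft> pcomp (pdom (sob x) F') F') \<triangleleft> pcomp (pdom (pdom (sob x) F') F) F
    = (pcomp (pcod (tob x) H') H \<cdot> pcomp (tob x) H') \<triangleright> val x \<triangleleft> (pcomp (pdom (sob x) F') F' \<cdot> pcomp (pdom (pdom (sob x) F') F) F)"
    by (rule whisker_whisker[where W="sob x" and X="tob x" and H="pcomp (sob x) (src x)" and H'="pcomp (sob x) (tgt x)"])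
      (use p p' okD[OF ox] pcomp_closed in blast)+
  then show "same_data (wh H (wh H' x F') F) (wh (H @ H') x (F' @ F))"
    unfolding wh_sel[OF a] wh_sel[OF b] wh_sel[OF i] using c by simp
qed simp_all

lemma ok_id_Cell [simp]: "ok (Cell V W p p (id2 C (pcomp V p))) \<longleftrightarrow> path V W p"
  by (auto simp: ok_Cell intro: id2_closed[OF pcomp_closed])

lemma ok_id_cell [simp]: "ok (id_cell V W p) \<longleftrightarrow> path V W p"
  by (simp add: id_cell_def mk_cell_def)

lemma id_cell_eq: "path V W p \<Longrightarrow> id_cell V W p = Cell V W p p (id2 C (pcomp V p))"
  using ok_id_cell[of V W p] unfolding id_cell_def mk_cell_def by (metis ok_Null)

lemma wh_nil: "clean x \<Longrightarrow> wh [] x [] = x"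
proof (rule cell_eqI)
  assume "ok x"
  note d = okD[OF this]
  show "same_data (wh [] x []) x"
    using \<open>ok x\<close> hcomp_id_left[OF d(3,4,5)] hcomp_id_right[OF d(3,4,5)]
    by (simp add: wh_sel lwhisk_def rwhisk_def)
qed simp_all

lemma vc_id_cell_left: "ty x V W p q \<Longrightarrow> id_cell V W q ** x = x"
proof (rule cell_eqI)
  assume t: "ty x V W p q"
  then have o: "ok x" and e: "sob x = V" "tob x = W" "tgt x = q" by (simp_all add: ty_def)
  note d = okD[OF o]
  have q: "path V W q" using d(2) e by simp
  show "ok (id_cell V W q ** x) \<longleftrightarrow> ok x" using o e q by (simp add: id_cell_eq)
  assume a: "ok (id_cell V W q ** x)"
  show "same_data (id_cell V W q ** x) x"
    unfolding vc_sel[OF a] using vcomp_id_left[OF d(3,4,5)] e by (simp add: id_cell_eq[OF q])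
qed (simp_all only: clean_vc, simp add: ty_def clean_def)

lemma vc_id_cell_right: "ty x V W p q \<Longrightarrow> x ** id_cell V W p = x"
proof (rule cell_eqI)
  assume t: "ty x V W p q"
  then have o: "ok x" and e: "sob x = V" "tob x = W" "src x = p" by (simp_all add: ty_def)
  note d = okD[OF o]
  have q: "path V W p" using d(1) e by simp
  show "ok (x ** id_cell V W p) \<longleftrightarrow> ok x" using o e q by (simp add: id_cell_eq)
  assume a: "ok (x ** id_cell V W p)"
  show "same_data (x ** id_cell V W p) x"
    unfolding vc_sel[OF a] using vcomp_id_right[OF d(3,4,5)] e by (simp add: id_cell_eq[OF q])
qed (simp_all only: clean_vc, simp add: ty_def clean_def)

lemma whisker_id2:
  assumes F: "F \<in> hom1 C V W" and H: "H \<in> hom1 C W X" and K: "K \<in> hom1 C X Y"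
  shows "K \<triangleright> id2 C H \<triangleleft> F = id2 C (K \<cdot> (H \<cdot> F))"
  unfolding lwhisk_def rwhisk_def using hcomp_id2[OF F H] hcomp_id2[OF comp1_closed[OF F H] K] by simp

lemma wh_id_cell:
  assumes M: "path V W M" and F: "path V' V F" and H: "path W W' H"
  shows "wh H (id_cell V W M) F = id_cell V' W' (H @ M @ F)"
proof -
  have p: "pdom V F = V'" "pcod W H = W'" "pdom W' H = W" "pdom W M = V" using M F H path_pdom path_pcod by blast+
  have o: "ok (wh H (id_cell V W M) F)" using M F H p by (simp add: id_cell_eq)
  have MF: "path V' W (M @ F)" using M F p by simp
  have HMF: "path V' W' (H @ M @ F)" using H MF p path_append[of V' W' H "M @ F"] by simp
  have c: "pcomp V' (H @ M @ F) = pcomp W H \<cdot> (pcomp V M \<cdot> pcomp V' F)"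
    using pcomp_append[OF H MF] pcomp_append[OF M F] by simp
  show ?thesis
  proof (rule cell_eqI)
    show "ok (wh H (id_cell V W M) F) \<longleftrightarrow> ok (id_cell V' W' (H @ M @ F))"
      using o HMF unfolding ok_id_cell by blast
    show "same_data (wh H (id_cell V W M) F) (id_cell V' W' (H @ M @ F))"
      unfolding wh_sel[OF o] unfolding id_cell_eq[OF M] id_cell_eq[OF HMF]
      using whisker_id2[OF pcomp_closed[OF F] pcomp_closed[OF M] pcomp_closed[OF H]] p c by simp
  qed simp_all
qed

lemma ty_wh:
  assumes "ty x V W p q" "path V' V F" "path W W' H"
  shows "ty (wh H x F) V' W' (H @ p @ F) (H @ q @ F)"
proof -
  have o: "ok (wh H x F)" and p: "pdom V F = V'" "pcod W H = W'"
    using assms path_pdom[OF assms(2)] path_pcod[OF assms(3)] by (simp_all add: ty_def)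
  show ?thesis using wh_sel[OF o] o assms(1) p unfolding ty_def by simp
qed

lemma ty_vc: "ty x V W p q \<Longrightarrow> ty y V W q r \<Longrightarrow> ty (y ** x) V W p r"
  using vc_sel[of y x] by (simp add: ty_def)

lemma ty_id_cell: "path V W p \<Longrightarrow> ty (id_cell V W p) V W p p"
  by (simp add: ty_def id_cell_eq)

lemma tyD:
  assumes "ty x V W p q"
  shows "ok x" "sob x = V" "tob x = W" "src x = p" "tgt x = q" "clean x"
    "path V W p" "path V W q" "val x \<in> hom2 C (pcomp V p) (pcomp V q)"
    "pcomp V p \<in> hom1 C V W" "pcomp V q \<in> hom1 C V W"
  using assms okD[of x] by (auto simp: ty_def clean_def)

lemma ty_mk_cell: "path V W p \<Longrightarrow> path V W q \<Longrightarrow> \<alpha> \<in> hom2 C (pcomp V p) (pcomp V q) \<Longrightarrow> ty (mk_cell V W p q \<alpha>) V W p q"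
  by (simp add: ty_def mk_cell_def ok_Cell)

lemma val_mk_cell: "path V W p \<Longrightarrow> path V W q \<Longrightarrow> \<alpha> \<in> hom2 C (pcomp V p) (pcomp V q) \<Longrightarrow> val (mk_cell V W p q \<alpha>) = \<alpha>"
  by (simp add: mk_cell_def ok_Cell)

lemma ty_eqI: "ty x V W p q \<Longrightarrow> ty y V W p q \<Longrightarrow> val x = val y \<Longrightarrow> x = y"
  by (rule cell_eqI) (auto simp: ty_def clean_def)

lemma mk_cell_val: "ty x V W p q \<Longrightarrow> mk_cell V W p q (val x) = x"
  by (cases x) (auto simp: ty_def mk_cell_def)

lemma val_vc: "ty x V W p q \<Longrightarrow> ty y V W q r \<Longrightarrow> val (y ** x) = val y \<bullet> val x"
  using vc_sel(5)[of y x] by (simp add: ty_def)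

lemma val_wh:
  assumes "ty x V W p q" "path V' V F" "path W W' H"
  shows "val (wh H x F) = pcomp W H \<triangleright> val x \<triangleleft> pcomp V' F"
proof -
  have "ok (wh H x F)" using tyD(1)[OF ty_wh[OF assms]] .
  then show ?thesis using wh_sel(5)[of H x F] path_pdom[OF assms(2)] assms(1) by (simp add: ty_def)
qed

lemma val_wh_left:
  assumes "ty x V W p q" "path W W' H"
  shows "val (wh H x []) = pcomp W H \<triangleright> val x"
  using val_wh[OF assms(1) _ assms(2), of V "[]"] hcomp_id_right[OF tyD(10,11,9)[OF assms(1)]]
  by (simp add: rwhisk_def)

lemma val_wh_right:
  assumes "ty x V W p q" "path V' V F"
  shows "val (wh [] x F) = val x \<triangleleft> pcomp V' F"
proof -
  note F = pcomp_closed[OF assms(2)] and t = tyD(10,11,9)[OF assms(1)]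
  note hcomp_id_left[OF comp1_closed[OF F t(1)] comp1_closed[OF F t(2)] hcomp_closed[OF F F t(1,2) id2_closed[OF F] t(3)]]
  then show ?thesis
    using val_wh[OF assms(1,2), of W "[]"] by (simp add: rwhisk_def lwhisk_def)
qed

text \<open>Two cells that act at different places of a path commute. The path \<open>M\<close> separates the places,
  and \<open>H\<close> and \<open>F\<close> are the rest of the path. Whiskering on the left by \<open>M\<close> reduces this to the
  interchange law of adjacent 2-morphisms.\<close>

lemma exchange:
  assumes x: "ty x V W p q" and y: "ty y V0 V1 r s" and M: "path V1 V M"
  shows "wh H x (M @ s @ F) ** wh (H @ p @ M) y F = wh (H @ q @ M) y F ** wh H x (M @ r @ F)"
proof -
  define z where "z = wh M y []"
  have z: "ty z V0 V (M @ r) (M @ s)"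
    unfolding z_def using ty_wh[OF y _ M, of V0 "[]"] by simp
  note dx = tyD[OF x] and dz = tyD[OF z]
  have t1: "ty (wh [] x (M @ s)) V0 W (p @ M @ s) (q @ M @ s)" and t1': "ty (wh [] x (M @ r)) V0 W (p @ M @ r) (q @ M @ r)"
    using ty_wh[OF x dz(8), of W "[]"] ty_wh[OF x dz(7), of W "[]"] by simp_all
  have t2: "ty (wh p z []) V0 W (p @ M @ r) (p @ M @ s)" and t2': "ty (wh q z []) V0 W (q @ M @ r) (q @ M @ s)"
    using ty_wh[OF z _ dx(7), of V0 "[]"] ty_wh[OF z _ dx(8), of V0 "[]"] by simp_all
  have "wh [] x (M @ s) ** wh p z [] = wh q z [] ** wh [] x (M @ r)"
  proof (rule ty_eqI[OF ty_vc[OF t2 t1] ty_vc[OF t1' t2']])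
    note ip = id2_closed[OF dx(10)] and iq = id2_closed[OF dx(11)]
      and ir = id2_closed[OF dz(10)] and js = id2_closed[OF dz(11)]
    have "(val x \<star> id2 C (pcomp V0 (M @ s))) \<bullet> (id2 C (pcomp V p) \<star> val z) = val x \<star> val z"
      using interchange[OF dz(10,11,11) dx(10,10,11) dz(9) js ip dx(9)]
        vcomp_id_left[OF dz(10,11,9)] vcomp_id_right[OF dx(10,11,9)] by simp
    also have "\<dots> = (id2 C (pcomp V q) \<star> val z) \<bullet> (val x \<star> id2 C (pcomp V0 (M @ r)))"
      using interchange[OF dz(10,10,11) dx(10,11,11) ir dz(9) dx(9) iq]
        vcomp_id_right[OF dz(10,11,9)] vcomp_id_left[OF dx(10,11,9)] by simp
    finally show "val (wh [] x (M @ s) ** wh p z []) = val (wh q z [] ** wh [] x (M @ r))"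
      unfolding val_vc[OF t2 t1] val_vc[OF t1' t2'] val_wh_left[OF z dx(7)] val_wh_left[OF z dx(8)]
        val_wh_right[OF x dz(7)] val_wh_right[OF x dz(8)] by (simp add: lwhisk_def rwhisk_def)
  qed
  then have "wh H (wh [] x (M @ s) ** wh p z []) F = wh H (wh q z [] ** wh [] x (M @ r)) F" by simp
  then show ?thesis unfolding wh_vc wh_wh z_def by simp
qed

lemma inverse2_unique:
  assumes F: "F \<in> hom1 C V W" "F' \<in> hom1 C V W" and a: "\<alpha> \<in> hom2 C F F'"
    and b: "inverse2 C F F' \<alpha> \<beta>" "inverse2 C F F' \<alpha> \<gamma>"
  shows "\<beta> = \<gamma>"
proof -
  have h: "\<beta> \<in> hom2 C F' F" "\<gamma> \<in> hom2 C F' F" using b by (simp_all add: inverse2_def)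
  have "\<beta> = \<beta> \<bullet> (\<alpha> \<bullet> \<gamma>)"
    using b vcomp_id_right[OF F(2,1) h(1)] by (simp add: inverse2_def)
  also have "\<dots> = (\<beta> \<bullet> \<alpha>) \<bullet> \<gamma>" using vcomp_assoc[OF F(2,1,2,1) h(2) a h(1)] by simp
  also have "\<dots> = \<gamma>" using b vcomp_id_left[OF F(2,1) h(2)] by (simp add: inverse2_def)
  finally show ?thesis .
qed

lemma inv2_eq:
  assumes "F \<in> hom1 C V W" "F' \<in> hom1 C V W" "\<alpha> \<in> hom2 C F F'" "inverse2 C F F' \<alpha> \<beta>"
  shows "inv2 C F F' \<alpha> = \<beta>"
  unfolding inv2_def using assms inverse2_unique by blast

lemma inverse2_inv2:
  assumes "F \<in> hom1 C V W" "F' \<in> hom1 C V W" "\<alpha> \<in> iso2 C F F'"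
  shows "inverse2 C F F' \<alpha> (inv2 C F F' \<alpha>)"
  using assms inv2_eq unfolding iso2_def by blast

definition inv_pair :: "('o, 'a, 'm) cell \<Rightarrow> ('o, 'a, 'm) cell \<Rightarrow> 'o \<Rightarrow> 'o \<Rightarrow> ('o, 'a) arrow list
    \<Rightarrow> ('o, 'a) arrow list \<Rightarrow> bool" where
  "inv_pair x y V W p q \<longleftrightarrow> ty x V W p q \<and> ty y V W q p \<and> y ** x = id_cell V W p \<and> x ** y = id_cell V W q"

lemma inv_pairD:
  assumes "inv_pair x y V W p q"
  shows "ty x V W p q" "ty y V W q p" "y ** x = id_cell V W p" "x ** y = id_cell V W q"
  using assms by (simp_all add: inv_pair_def)

lemma inv_pair_sym: "inv_pair x y V W p q \<Longrightarrow> inv_pair y x V W q p"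
  by (simp add: inv_pair_def)

lemma inv_pair_wh:
  assumes "inv_pair x y V W p q" "path A V F" "path W B H"
  shows "inv_pair (wh H x F) (wh H y F) A B (H @ p @ F) (H @ q @ F)"
  using assms ty_wh[OF _ assms(2,3)] tyD(7,8)[of x V W p q]
  by (simp add: inv_pair_def wh_vc[symmetric] wh_id_cell)

lemma inv_pair_vc:
  assumes x: "inv_pair x x' V W p q" and y: "inv_pair y y' V W q r"
  shows "inv_pair (y ** x) (x' ** y') V W p r"
proof -
  note dx = inv_pairD[OF x] and dy = inv_pairD[OF y]
  have "(x' ** y') ** (y ** x) = x' ** ((y' ** y) ** x)" by (simp add: vc_assoc)
  also have "\<dots> = id_cell V W p" unfolding dy(3) vc_id_cell_left[OF dx(1)] dx(3) ..
  finally have 1: "(x' ** y') ** (y ** x) = id_cell V W p" .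
  have "(y ** x) ** (x' ** y') = y ** ((x ** x') ** y')" by (simp add: vc_assoc)
  also have "\<dots> = id_cell V W r" unfolding dx(4) vc_id_cell_left[OF dy(2)] dy(4) ..
  finally show ?thesis using 1 ty_vc[OF dx(1) dy(1)] ty_vc[OF dy(2) dx(2)] by (simp add: inv_pair_def)
qed

lemma inv_pair_cancel:
  assumes "inv_pair x y V W p q" "ty c V W r q"
  shows "x ** (y ** c) = c"
  using inv_pairD(4)[OF assms(1)] vc_id_cell_left[OF assms(2)] by (simp add: vc_assoc[symmetric])

lemma inv_pair_val:
  assumes "inv_pair x y V W p q"
  shows "inverse2 C (pcomp V p) (pcomp V q) (val x) (val y)"
    "val x \<in> iso2 C (pcomp V p) (pcomp V q)"
    "inv2 C (pcomp V p) (pcomp V q) (val x) = val y"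
proof -
  note d = inv_pairD[OF assms] and t = tyD[OF inv_pairD(1)[OF assms]] and t' = tyD[OF inv_pairD(2)[OF assms]]
  show 1: "inverse2 C (pcomp V p) (pcomp V q) (val x) (val y)"
    using val_vc[OF d(1,2)] val_vc[OF d(2,1)] d(3,4) t t' by (simp add: inverse2_def id_cell_eq)
  show "val x \<in> iso2 C (pcomp V p) (pcomp V q)" using 1 t unfolding iso2_def by blast
  show "inv2 C (pcomp V p) (pcomp V q) (val x) = val y" using inv2_eq[OF t(10,11,9) 1] .
qed

lemma inv_pair_mk_cell:
  assumes p: "path V W p" "path V W q" and a: "inverse2 C (pcomp V p) (pcomp V q) \<alpha> \<beta>"
    "\<alpha> \<in> hom2 C (pcomp V p) (pcomp V q)"
  shows "inv_pair (mk_cell V W p q \<alpha>) (mk_cell V W q p \<beta>) V W p q"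
proof -
  have b: "\<beta> \<in> hom2 C (pcomp V q) (pcomp V p)" using a by (simp add: inverse2_def)
  note t = ty_mk_cell[OF p a(2)] ty_mk_cell[OF p(2,1) b]
  show ?thesis
    unfolding inv_pair_def
    using t ty_eqI[OF ty_vc[OF t(1,2)] ty_id_cell[OF p(1)]] ty_eqI[OF ty_vc[OF t(2,1)] ty_id_cell[OF p(2)]]
      val_vc[OF t(1,2)] val_vc[OF t(2,1)] val_mk_cell[OF p a(2)] val_mk_cell[OF p(2,1) b] a p
    by (simp add: inverse2_def id_cell_eq)
qed

lemma inv_pair_iso2:
  assumes p: "path V W p" "path V W q" and a: "\<alpha> \<in> iso2 C (pcomp V p) (pcomp V q)"
  shows "inv_pair (mk_cell V W p q \<alpha>) (mk_cell V W q p (inv2 C (pcomp V p) (pcomp V q) \<alpha>)) V W p q"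
  using inv_pair_mk_cell[OF p inverse2_inv2[OF pcomp_closed[OF p(1)] pcomp_closed[OF p(2)] a]] a
  by (simp add: iso2_def)

definition triv_rep :: "'o \<Rightarrow> ('g, 'a, 'm) rep2" where
  "triv_rep W = \<lparr> act = (\<lambda>_. id1 C W), act_mult = (\<lambda>_ _. id2 C (id1 C W)), act_one = id2 C (id1 C W) \<rparr>"

lemma triv_rep_simps [simp]:
  "act (triv_rep W) g = id1 C W" "act_mult (triv_rep W) g h = id2 C (id1 C W)"
  "act_one (triv_rep W) = id2 C (id1 C W)"
  by (simp_all add: triv_rep_def)

lemma id1_id1 [simp]: "id1 C V \<cdot> id1 C V = id1 C V"
  by (rule comp1_id_left[OF id1_closed])

lemma id2_iso: "F \<in> hom1 C V W \<Longrightarrow> inverse2 C F F (id2 C F) (id2 C F)"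
  by (simp add: inverse2_def id2_closed vcomp_id_id)

lemma rwhisk_id1: "F \<in> hom1 C V W \<Longrightarrow> F' \<in> hom1 C V W \<Longrightarrow> \<alpha> \<in> hom2 C F F' \<Longrightarrow> \<alpha> \<triangleleft> id1 C V = \<alpha>"
  unfolding rwhisk_def by (rule hcomp_id_right)

lemma lwhisk_id2: "F \<in> hom1 C V W \<Longrightarrow> H \<in> hom1 C W X \<Longrightarrow> H \<triangleright> id2 C F = id2 C (H \<cdot> F)"
  unfolding lwhisk_def by (rule hcomp_id2)

lemma rwhisk_id2: "F \<in> hom1 C V W \<Longrightarrow> H \<in> hom1 C W X \<Longrightarrow> id2 C H \<triangleleft> F = id2 C (H \<cdot> F)"
  unfolding rwhisk_def by (rule hcomp_id2)

lemma triv_rep_two_representation: "two_representation C G W (triv_rep W)"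
proof
  show "act_mult (triv_rep W) g h \<in> iso2 C (act (triv_rep W) g \<cdot> act (triv_rep W) h) (act (triv_rep W) (g \<otimes>\<^bsub>G\<^esub> h))" for g h
    using id2_iso[OF id1_closed] id2_closed[OF id1_closed] by (auto simp: iso2_def)
  show "act_one (triv_rep W) \<in> iso2 C (act (triv_rep W) \<one>\<^bsub>G\<^esub>) (id1 C W)"
    using id2_iso[OF id1_closed] id2_closed[OF id1_closed] by (auto simp: iso2_def)
qed (simp_all add: id1_closed rwhisk_id2[OF id1_closed id1_closed] lwhisk_id2[OF id1_closed id1_closed])

lemmas tys = ty_def vc_sel wh_sel

end

section \<open>Finite direct sums of 1-morphisms\<close>

context klinear_2category
begin

sublocale vs: vector_space "smul C"
  by (rule vector_space)

lemma hom2_sum: "F \<in> hom1 C V W \<Longrightarrow> F' \<in> hom1 C V W \<Longrightarrow> (\<And>i. i \<in> I \<Longrightarrow> x i \<in> hom2 C F F') \<Longrightarrow>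
    (\<Sum>i\<in>I. x i) \<in> hom2 C F F'"
  by (rule vs.subspace_sum[OF hom2_subspace])

lemma vcomp_linear_right:
  assumes "F \<in> hom1 C V W" "F' \<in> hom1 C V W" "F'' \<in> hom1 C V W" "\<beta> \<in> hom2 C F' F''"
  shows "linear_on (smul C) (smul C) (hom2 C F F') (\<lambda>\<alpha>. \<beta> \<bullet> \<alpha>)"
  using vcomp_bilinear[OF assms(1-3)] assms(4) unfolding bilinear_on_def linear_on_def by simp

lemma vcomp_linear_left:
  assumes "F \<in> hom1 C V W" "F' \<in> hom1 C V W" "F'' \<in> hom1 C V W" "\<alpha> \<in> hom2 C F F'"
  shows "linear_on (smul C) (smul C) (hom2 C F' F'') (\<lambda>\<beta>. \<beta> \<bullet> \<alpha>)"
  using vcomp_bilinear[OF assms(1-3)] assms(4) unfolding bilinear_on_def linear_on_def by simp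

lemma whisker_linear:
  assumes F: "F \<in> hom1 C V W" and H: "H \<in> hom1 C W X" "H' \<in> hom1 C W X" and K: "K \<in> hom1 C X Y"
  shows "linear_on (smul C) (smul C) (hom2 C H H') (\<lambda>\<alpha>. K \<triangleright> \<alpha> \<triangleleft> F)"
proof -
  have 1: "linear_on (smul C) (smul C) (hom2 C H H') (\<lambda>\<alpha>. \<alpha> \<star> id2 C F)"
    using hcomp_bilinear[OF F F H] id2_closed[OF F] unfolding bilinear_on_def linear_on_def by simp
  have 2: "linear_on (smul C) (smul C) (hom2 C (H \<cdot> F) (H' \<cdot> F)) (\<lambda>\<alpha>. id2 C K \<star> \<alpha>)"
    using hcomp_bilinear[OF comp1_closed[OF F H(1)] comp1_closed[OF F H(2)] K K] id2_closed[OF K]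
    unfolding bilinear_on_def linear_on_def by simp
  show ?thesis
    unfolding lwhisk_def rwhisk_def
    by (rule linear_on_compose[OF 1 2]) (auto intro: hcomp_closed[OF F F H] id2_closed[OF F])
qed

lemma linear_on_hom2_sum:
  assumes "linear_on (smul C) (smul C) (hom2 C F F') f" "F \<in> hom1 C V W" "F' \<in> hom1 C V W" "finite I"
    "\<And>i. i \<in> I \<Longrightarrow> x i \<in> hom2 C F F'"
  shows "f (\<Sum>i\<in>I. x i) = (\<Sum>i\<in>I. f (x i))"
  using vs.linear_on_sum[OF hom2_subspace[OF assms(2,3)] assms(1) vector_space assms(4), of x "\<lambda>_. 1"] assms(5)
  by simp

lemma linear_on_hom2_0:
  assumes "linear_on (smul C) (smul C) (hom2 C F F') f" "F \<in> hom1 C V W" "F' \<in> hom1 C V W"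
  shows "f 0 = 0"
  using linear_on_hom2_sum[OF assms, of "{}"] by simp

lemma finite_direct_sum:
  assumes "finite I" "\<And>k. k \<in> I \<Longrightarrow> F k \<in> hom1 C V W"
  shows "\<exists>P\<in>hom1 C V W. \<exists>i p. (\<forall>k\<in>I. i k \<in> hom2 C (F k) P \<and> p k \<in> hom2 C P (F k)) \<and>
     (\<forall>j\<in>I. \<forall>k\<in>I. p j \<bullet> i k = (if j = k then id2 C (F k) else 0)) \<and> (\<Sum>k\<in>I. i k \<bullet> p k) = id2 C P"
  using assms
proof (induction I)
  case empty
  obtain Z where Z: "Z \<in> hom1 C V W" "hom2 C Z Z = {0}" using zero_object[of V W] by blast
  then have "id2 C Z = 0" using id2_closed by blast
  then show ?case using Z(1) by auto
next
  case (insert x I)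
  then obtain P i p where P: "P \<in> hom1 C V W"
    and i: "\<And>k. k \<in> I \<Longrightarrow> i k \<in> hom2 C (F k) P" and p: "\<And>k. k \<in> I \<Longrightarrow> p k \<in> hom2 C P (F k)"
    and pi: "\<And>j k. j \<in> I \<Longrightarrow> k \<in> I \<Longrightarrow> p j \<bullet> i k = (if j = k then id2 C (F k) else 0)"
    and s: "(\<Sum>k\<in>I. i k \<bullet> p k) = id2 C P" by (smt (verit) insertI2)
  have F: "F k \<in> hom1 C V W" if "k \<in> I" for k using insert that by blast
  have Fx: "F x \<in> hom1 C V W" using insert by blast
  obtain S a a' b b' where S: "S \<in> hom1 C V W" and a: "a \<in> hom2 C (F x) S" "a' \<in> hom2 C P S"
    and b: "b \<in> hom2 C S (F x)" "b' \<in> hom2 C S P"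
    and e: "b \<bullet> a = id2 C (F x)" "b' \<bullet> a' = id2 C P" "b \<bullet> a' = 0" "b' \<bullet> a = 0" "(a \<bullet> b) + (a' \<bullet> b') = id2 C S"
    using direct_sum[OF Fx P] by blast
  define i' where "i' k = (if k = x then a else a' \<bullet> i k)" for k
  define p' where "p' k = (if k = x then b else p k \<bullet> b')" for k
  have nx: "k \<noteq> x" if "k \<in> I" for k using that insert by blast
  have I': "i' k \<in> hom2 C (F k) S" "p' k \<in> hom2 C S (F k)" if "k \<in> insert x I" for k
    using that a b nx vcomp_closed[OF F P S i a(2)] vcomp_closed[OF S P F b(2) p]
    by (auto simp: i'_def p'_def)
  have bi: "p j \<bullet> b' \<bullet> (a' \<bullet> i k) = p j \<bullet> i k" if "j \<in> I" "k \<in> I" for j k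
  proof -
    have "p j \<bullet> b' \<bullet> (a' \<bullet> i k) = p j \<bullet> (b' \<bullet> (a' \<bullet> i k))"
      by (rule vcomp_assoc[OF F[OF that(2)] S P F[OF that(1)] vcomp_closed[OF F[OF that(2)] P S i[OF that(2)] a(2)] b(2) p[OF that(1)]])
    also have "b' \<bullet> (a' \<bullet> i k) = (b' \<bullet> a') \<bullet> i k"
      by (rule vcomp_assoc[OF F[OF that(2)] P S P i[OF that(2)] a(2) b(2), symmetric])
    also have "\<dots> = i k" unfolding e by (rule vcomp_id_left[OF F[OF that(2)] P i[OF that(2)]])
    finally show ?thesis .
  qed
  have z1: "b \<bullet> (a' \<bullet> i k) = 0" if "k \<in> I" for k
    using vcomp_assoc[OF F[OF that] P S Fx i[OF that] a(2) b(1)] e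
      linear_on_hom2_0[OF vcomp_linear_left[OF F[OF that] P Fx i[OF that]] P Fx] by simp
  have z2: "p k \<bullet> b' \<bullet> a = 0" if "k \<in> I" for k
    using vcomp_assoc[OF Fx S P F[OF that] a(1) b(2) p[OF that]] e
      linear_on_hom2_0[OF vcomp_linear_right[OF Fx P F[OF that] p[OF that]] Fx P] by simp
  have "(\<Sum>k\<in>I. i' k \<bullet> p' k) = (\<Sum>k\<in>I. a' \<bullet> (i k \<bullet> p k) \<bullet> b')"
  proof (rule sum.cong[OF refl])
    fix k assume k: "k \<in> I"
    have "(a' \<bullet> i k) \<bullet> (p k \<bullet> b') = ((a' \<bullet> i k) \<bullet> p k) \<bullet> b'"
      by (rule vcomp_assoc[OF S P F[OF k] S b(2) p[OF k] vcomp_closed[OF F[OF k] P S i[OF k] a(2)], symmetric])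
    also have "(a' \<bullet> i k) \<bullet> p k = a' \<bullet> (i k \<bullet> p k)"
      by (rule vcomp_assoc[OF P F[OF k] P S p[OF k] i[OF k] a(2)])
    finally show "i' k \<bullet> p' k = a' \<bullet> (i k \<bullet> p k) \<bullet> b'" using nx[OF k] by (simp add: i'_def p'_def)
  qed
  also have "\<dots> = (\<Sum>k\<in>I. a' \<bullet> (i k \<bullet> p k)) \<bullet> b'"
    by (rule linear_on_hom2_sum[OF vcomp_linear_left[OF S P S b(2)] P S insert(1), symmetric])
      (rule vcomp_closed[OF P P S vcomp_closed[OF P F P p i] a(2)])
  also have "(\<Sum>k\<in>I. a' \<bullet> (i k \<bullet> p k)) = a' \<bullet> (\<Sum>k\<in>I. i k \<bullet> p k)"
    by (rule linear_on_hom2_sum[OF vcomp_linear_right[OF P P S a(2)] P P insert(1), symmetric])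
      (rule vcomp_closed[OF P F P p i])
  also have "\<dots> \<bullet> b' = a' \<bullet> b'" unfolding s using vcomp_id_right[OF P S a(2)] by simp
  finally have "(\<Sum>k\<in>insert x I. i' k \<bullet> p' k) = id2 C S"
    using insert(1,2) e(5) by (simp add: i'_def p'_def)
  moreover have "p' j \<bullet> i' k = (if j = k then id2 C (F k) else 0)" if "j \<in> insert x I" "k \<in> insert x I" for j k
    using that e(1) nx z1 z2 bi pi by (auto simp: i'_def p'_def)
  ultimately show ?case using S I' by blast
qed

text \<open>The orthogonality relations are stated for the underlying 2-morphisms because cells cannot be
added and have no zero.\<close>

definition biprod :: "'i set \<Rightarrow> 'o \<Rightarrow> 'o \<Rightarrow> ('i \<Rightarrow> ('o, 'a) arrow) \<Rightarrow> ('o, 'a) arrow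
    \<Rightarrow> ('i \<Rightarrow> ('o, 'a, 'm) cell) \<Rightarrow> ('i \<Rightarrow> ('o, 'a, 'm) cell) \<Rightarrow> bool" where
  "biprod I V W A P i p \<longleftrightarrow> finite I \<and> path V W [P] \<and>
     (\<forall>k\<in>I. ty (i k) V W [A k] [P] \<and> ty (p k) V W [P] [A k]) \<and>
     (\<forall>j\<in>I. \<forall>k\<in>I. val (p j ** i k) = (if j = k then id2 C (pcomp V [A k]) else 0)) \<and>
     (\<Sum>k\<in>I. val (i k ** p k)) = id2 C (pcomp V [P])"

lemma biprod_exists:
  assumes fin: "finite I" and A: "\<And>k. k \<in> I \<Longrightarrow> path V W [A k]"
  shows "\<exists>P i p. biprod I V W A P i p"
proof -
  have F: "pcomp V [A k] \<in> hom1 C V W" if "k \<in> I" for k using pcomp_closed[OF A[OF that]] .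
  obtain P i p where P: "P \<in> hom1 C V W"
    and i: "\<And>k. k \<in> I \<Longrightarrow> i k \<in> hom2 C (pcomp V [A k]) P" and p: "\<And>k. k \<in> I \<Longrightarrow> p k \<in> hom2 C P (pcomp V [A k])"
    and pi: "\<And>j k. j \<in> I \<Longrightarrow> k \<in> I \<Longrightarrow> p j \<bullet> i k = (if j = k then id2 C (pcomp V [A k]) else 0)"
    and s: "(\<Sum>k\<in>I. i k \<bullet> p k) = id2 C P"
    using finite_direct_sum[where F="\<lambda>k. pcomp V [A k]", OF fin F] by blast
  have pP: "path V W [(V, W, P)]" "pcomp V [(V, W, P)] = P" using P comp1_id_right[OF P] by simp_all
  let ?i = "\<lambda>k. mk_cell V W [A k] [(V, W, P)] (i k)" and ?p = "\<lambda>k. mk_cell V W [(V, W, P)] [A k] (p k)"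
  have ti: "ty (?i k) V W [A k] [(V, W, P)]" "val (?i k) = i k" and tp: "ty (?p k) V W [(V, W, P)] [A k]" "val (?p k) = p k"
    if "k \<in> I" for k
    using ty_mk_cell[OF A[OF that] pP(1)] val_mk_cell[OF A[OF that] pP(1)] i[OF that]
      ty_mk_cell[OF pP(1) A[OF that]] val_mk_cell[OF pP(1) A[OF that]] p[OF that] pP(2) by metis+
  have "biprod I V W A (V, W, P) ?i ?p"
    unfolding biprod_def pP(2)
  proof (intro conjI ballI fin pP)
    show "val (?p j ** ?i k) = (if j = k then id2 C (pcomp V [A k]) else 0)" if "j \<in> I" "k \<in> I" for j k
      using val_vc[OF ti(1)[OF that(2)] tp(1)[OF that(1)]] ti(2)[OF that(2)] tp(2)[OF that(1)] pi[OF that] by simp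
    show "(\<Sum>k\<in>I. val (?i k ** ?p k)) = id2 C P"
      unfolding s[symmetric] using val_vc[OF tp(1) ti(1)] ti(2) tp(2) by (intro sum.cong) simp_all
  qed (use ti tp in simp_all)
  then show ?thesis by blast
qed

text \<open>As whiskering is linear, the decomposition of the identity of a direct sum survives it, and
  therefore decomposes any cell with values in a whiskered direct sum, and any cell defined on one.\<close>

lemma biprod_wh_sum:
  assumes b: "biprod I V W A P i p" and F: "path V' V F" and H: "path W W' H"
  shows "id2 C (pcomp V' (H @ [P] @ F)) = (\<Sum>k\<in>I. val (wh H (i k) F ** wh H (p k) F))"
proof -
  have fin: "finite I" and P: "path V W [P]"
    and ti: "\<And>k. k \<in> I \<Longrightarrow> ty (i k) V W [A k] [P]" and tp: "\<And>k. k \<in> I \<Longrightarrow> ty (p k) V W [P] [A k]"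
    and s: "(\<Sum>k\<in>I. val (i k ** p k)) = id2 C (pcomp V [P])"
    using b by (simp_all add: biprod_def)
  note t = ty_vc[OF tp ti]
  have w: "wh H (i k) F ** wh H (p k) F = wh H (i k ** p k) F" for k by (simp add: wh_vc)
  have "(\<Sum>k\<in>I. val (wh H (i k) F ** wh H (p k) F)) = (\<Sum>k\<in>I. pcomp W H \<triangleright> val (i k ** p k) \<triangleleft> pcomp V' F)"
    unfolding w using val_wh[OF t F H] by simp
  also have "\<dots> = pcomp W H \<triangleright> (\<Sum>k\<in>I. val (i k ** p k)) \<triangleleft> pcomp V' F"
    by (rule linear_on_hom2_sum[OF whisker_linear[OF pcomp_closed[OF F] _ _ pcomp_closed[OF H]] _ _ fin, symmetric])
      (use pcomp_closed[OF P] tyD(9)[OF t] in blast)+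
  also have "\<dots> = val (wh H (id_cell V W [P]) F)"
    unfolding s using val_wh[OF ty_id_cell[OF P] F H] by (simp only: id_cell_eq[OF P] cell.sel)
  also have "\<dots> = id2 C (pcomp V' (H @ [P] @ F))"
    unfolding wh_id_cell[OF P F H] using id_cell_eq[OF tyD(7)[OF ty_wh[OF ty_id_cell[OF P] F H]]] by simp
  finally show ?thesis by simp
qed

lemma biprod_into_sum:
  assumes b: "biprod I V W A P i p" and F: "path V' V F" and H: "path W W' H"
    and x: "ty x V' W' r (H @ [P] @ F)"
  shows "val x = (\<Sum>k\<in>I. val (wh H (i k) F ** wh H (p k) F ** x))"
proof -
  have fin: "finite I"
    and ti: "\<And>k. k \<in> I \<Longrightarrow> ty (i k) V W [A k] [P]" and tp: "\<And>k. k \<in> I \<Longrightarrow> ty (p k) V W [P] [A k]"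
    using b by (simp_all add: biprod_def)
  note dx = tyD[OF x] and t = ty_vc[OF ty_wh[OF tp F H] ty_wh[OF ti F H]]
  have "val x = id2 C (pcomp V' (H @ [P] @ F)) \<bullet> val x" using vcomp_id_left[OF dx(10,11,9)] by simp
  also have "\<dots> = (\<Sum>k\<in>I. val (wh H (i k) F ** wh H (p k) F) \<bullet> val x)"
    unfolding biprod_wh_sum[OF b F H]
    by (rule linear_on_hom2_sum[OF vcomp_linear_left[OF dx(10,11,11,9)] dx(11,11) fin tyD(9)[OF t]])
  also have "\<dots> = (\<Sum>k\<in>I. val (wh H (i k) F ** wh H (p k) F ** x))"
    using val_vc[OF x t] by (simp add: vc_assoc)
  finally show ?thesis .
qed

lemma biprod_from_sum:
  assumes b: "biprod I V W A P i p" and F: "path V' V F" and H: "path W W' H"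
    and x: "ty x V' W' (H @ [P] @ F) r"
  shows "val x = (\<Sum>k\<in>I. val (x ** wh H (i k) F ** wh H (p k) F))"
proof -
  have fin: "finite I"
    and ti: "\<And>k. k \<in> I \<Longrightarrow> ty (i k) V W [A k] [P]" and tp: "\<And>k. k \<in> I \<Longrightarrow> ty (p k) V W [P] [A k]"
    using b by (simp_all add: biprod_def)
  note dx = tyD[OF x] and t = ty_vc[OF ty_wh[OF tp F H] ty_wh[OF ti F H]]
  have "val x = val x \<bullet> id2 C (pcomp V' (H @ [P] @ F))" using vcomp_id_right[OF dx(10,11,9)] by simp
  also have "\<dots> = (\<Sum>k\<in>I. val x \<bullet> val (wh H (i k) F ** wh H (p k) F))"
    unfolding biprod_wh_sum[OF b F H]
    by (rule linear_on_hom2_sum[OF vcomp_linear_right[OF dx(10,10,11,9)] dx(10,10) fin tyD(9)[OF t]])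
  also have "\<dots> = (\<Sum>k\<in>I. val (x ** wh H (i k) F ** wh H (p k) F))"
    using val_vc[OF t x] by simp
  finally show ?thesis .
qed

lemma biprod_ext:
  assumes b: "biprod I V W A P i p" and F: "path V' V F" and H: "path W W' H"
    and x: "ty x V' W' (H @ [P] @ F) r" and y: "ty y V' W' (H @ [P] @ F) r"
    and eq: "\<And>k. k \<in> I \<Longrightarrow> x ** wh H (i k) F = y ** wh H (i k) F"
  shows "x = y"
proof (rule ty_eqI[OF x y])
  have "x ** wh H (i k) F ** wh H (p k) F = y ** wh H (i k) F ** wh H (p k) F" if "k \<in> I" for k
    using arg_cong[OF eq[OF that], of "\<lambda>z. z ** wh H (p k) F"] by (simp add: vc_assoc)
  then show "val x = val y"
    unfolding biprod_from_sum[OF b F H x] biprod_from_sum[OF b F H y] by (intro sum.cong) simp_all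
qed

lemma biprod_copair:
  assumes b: "biprod I V W A P i p" and F: "path V' V F" and H: "path W W' H" and r: "path V' W' r"
    and y: "\<And>k. k \<in> I \<Longrightarrow> ty (y k) V' W' (H @ [A k] @ F) r"
  shows "\<exists>x. ty x V' W' (H @ [P] @ F) r \<and> (\<forall>k\<in>I. x ** wh H (i k) F = y k)"
proof -
  have fin: "finite I" and P: "path V W [P]"
    and ti: "\<And>k. k \<in> I \<Longrightarrow> ty (i k) V W [A k] [P]" and tp: "\<And>k. k \<in> I \<Longrightarrow> ty (p k) V W [P] [A k]"
    and pi: "\<And>j k. j \<in> I \<Longrightarrow> k \<in> I \<Longrightarrow> val (p j ** i k) = (if j = k then id2 C (pcomp V [A k]) else 0)"
    using b by (simp_all add: biprod_def)
  note wi = ty_wh[OF ti F H] and wp = ty_wh[OF tp F H]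
  note t = ty_vc[OF wp y]
  have HPF: "path V' W' (H @ [P] @ F)" using tyD(7)[OF ty_wh[OF ty_id_cell[OF P] F H]] .
  let ?v = "\<Sum>k\<in>I. val (y k ** wh H (p k) F)"
  have vm: "?v \<in> hom2 C (pcomp V' (H @ [P] @ F)) (pcomp V' r)"
    by (rule hom2_sum[OF pcomp_closed[OF HPF] pcomp_closed[OF r] tyD(9)[OF t]])
  define x where "x = mk_cell V' W' (H @ [P] @ F) r ?v"
  have x: "ty x V' W' (H @ [P] @ F) r" and vx: "val x = ?v"
    unfolding x_def by (rule ty_mk_cell[OF HPF r vm], rule val_mk_cell[OF HPF r vm])
  have "x ** wh H (i k) F = y k" if k: "k \<in> I" for k
  proof (rule ty_eqI[OF ty_vc[OF wi[OF k] x] y[OF k]])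
    have pjk: "val (y j ** wh H (p j) F ** wh H (i k) F) = (if j = k then val (y k) else 0)" if j: "j \<in> I" for j
    proof (cases "j = k")
      case True
      have "p k ** i k = id_cell V W [A k]"
        by (rule ty_eqI[OF ty_vc[OF ti[OF k] tp[OF k]] ty_id_cell[OF tyD(7)[OF ti[OF k]]]])
          (use pi[OF k k] id_cell_eq[OF tyD(7)[OF ti[OF k]]] in simp)
      then show ?thesis
        using True vc_id_cell_right[OF y[OF k]] wh_id_cell[OF tyD(7)[OF ti[OF k]] F H] by (simp add: wh_vc[symmetric])
    next
      case False
      note tpi = ty_vc[OF ti[OF k] tp[OF j]]
      have "pcomp W H \<triangleright> val (p j ** i k) \<triangleleft> pcomp V' F = 0"
        using pi[OF j k] False
          linear_on_hom2_0[OF whisker_linear[OF pcomp_closed[OF F] _ _ pcomp_closed[OF H]] tyD(10,11)[OF tpi]]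
          tyD(10,11)[OF tpi] by simp
      then have "val (wh H (p j ** i k) F) = 0" using val_wh[OF tpi F H] by simp
      moreover have "val (y j ** wh H (p j ** i k) F) = val (y j) \<bullet> val (wh H (p j ** i k) F)"
        by (rule val_vc[OF ty_wh[OF tpi F H] y[OF j]])
      moreover have "val (y j) \<bullet> 0 = 0"
        using linear_on_hom2_0[OF vcomp_linear_right[OF tyD(10)[OF ty_wh[OF tpi F H]] tyD(10,11,9)[OF y[OF j]]]
            tyD(10,11)[OF ty_wh[OF tpi F H]]] .
      ultimately show ?thesis using False by (simp add: wh_vc)
    qed
    have "val (x ** wh H (i k) F) = ?v \<bullet> val (wh H (i k) F)" using val_vc[OF wi[OF k] x] vx by simp
    also have "\<dots> = (\<Sum>j\<in>I. val (y j ** wh H (p j) F) \<bullet> val (wh H (i k) F))"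
      by (rule linear_on_hom2_sum[OF vcomp_linear_left[OF tyD(10,11)[OF wi[OF k]] pcomp_closed[OF r] tyD(9)[OF wi[OF k]]]
            tyD(11)[OF wi[OF k]] pcomp_closed[OF r] fin tyD(9)[OF t]])
    also have "\<dots> = (\<Sum>j\<in>I. if j = k then val (y k) else 0)"
      using val_vc[OF wi[OF k] t] pjk by (intro sum.cong) (simp_all add: vc_assoc)
    also have "\<dots> = val (y k)" using fin k by simp
    finally show "val (x ** wh H (i k) F) = val (y k)" .
  qed
  then show ?thesis using x by blast
qed

lemma biprod_ortho:
  assumes b: "biprod I V W A P i p" and j: "j \<in> I" and k: "k \<in> I" and F: "path V' V F" and x: "ty x V' W r ([A k] @ F)"
  shows "val (wh [] (p j) F ** wh [] (i k) F ** x) = (if j = k then val x else 0)"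
proof -
  have P: "path V W [P]"
    and ti: "ty (i k) V W [A k] [P]" and tp: "ty (p j) V W [P] [A j]"
    and pi: "val (p j ** i k) = (if j = k then id2 C (pcomp V [A k]) else 0)"
    using b j k by (simp_all add: biprod_def)
  note tpi = ty_vc[OF ti tp]
  note w = ty_wh[OF tpi F, of W "[]", simplified]
  have v: "val (wh [] (p j) F ** wh [] (i k) F ** x) = val (wh [] (p j ** i k) F) \<bullet> val x"
    using val_vc[of x V' W r "A k # F" "wh [] (p j ** i k) F" "A j # F"] w x by (simp add: wh_vc vc_assoc)
  show ?thesis
  proof (cases "j = k")
    case True
    have "p k ** i k = id_cell V W [A k]"
      by (rule ty_eqI) (use tpi ty_id_cell[OF tyD(7)[OF ti]] pi id_cell_eq[OF tyD(7)[OF ti]] True in simp_all)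
    then have "wh [] (p j ** i k) F ** x = x"
      using True vc_id_cell_left[OF x] wh_id_cell[OF tyD(7)[OF ti] F, of W "[]"] by simp
    then show ?thesis using True by (simp add: wh_vc vc_assoc)
  next
    case False
    have "val (wh [] (p j ** i k) F) = 0"
      using val_wh_right[OF tpi F] linear_on_hom2_0[OF whisker_linear[OF pcomp_closed[OF F] _ _ id1_closed] tyD(10,11)[OF tpi]]
        tyD(10,11)[OF tpi] val_wh[OF tpi F, of W "[]"] pi False by simp
    moreover have "0 \<bullet> val x = 0"
      by (rule linear_on_hom2_0[OF vcomp_linear_left[OF tyD(10,11)[OF x] _ tyD(9)[OF x]]])
        (use x w in \<open>auto dest: tyD(10,11)\<close>)
    ultimately show ?thesis using False v by simp
  qed
qed

lemma cell_linear:
  assumes pre: "ty pre A B r (H @ p @ F)" and post: "ty post A B (H @ q @ F) t"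
    and pq: "path V W p" "path V W q" and F: "path A V F" and H: "path W B H"
  shows "linear_on (smul C) (smul C) (hom2 C (pcomp V p) (pcomp V q)) (\<lambda>\<xi>. val (post ** wh H (mk_cell V W p q \<xi>) F ** pre))"
proof -
  let ?S = "hom2 C (pcomp V p) (pcomp V q)"
  have S: "vs.subspace ?S" by (rule hom2_subspace[OF pcomp_closed[OF pq(1)] pcomp_closed[OF pq(2)]])
  note dpre = tyD[OF pre] and dpost = tyD[OF post]
  have w: "ty (wh H (mk_cell V W p q \<xi>) F) A B (H @ p @ F) (H @ q @ F)"
    "val (wh H (mk_cell V W p q \<xi>) F) = pcomp W H \<triangleright> \<xi> \<triangleleft> pcomp A F" if "\<xi> \<in> ?S" for \<xi>
    using ty_wh[OF ty_mk_cell[OF pq that] F H] val_wh[OF ty_mk_cell[OF pq that] F H] val_mk_cell[OF pq that] by simp_all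
  have 1: "linear_on (smul C) (smul C) ?S (\<lambda>\<xi>. pcomp W H \<triangleright> \<xi> \<triangleleft> pcomp A F)"
    by (rule whisker_linear[OF pcomp_closed[OF F] pcomp_closed[OF pq(1)] pcomp_closed[OF pq(2)] pcomp_closed[OF H]])
  have wm: "pcomp W H \<triangleright> \<xi> \<triangleleft> pcomp A F \<in> hom2 C (pcomp A (H @ p @ F)) (pcomp A (H @ q @ F))" if "\<xi> \<in> ?S" for \<xi>
    using tyD(9)[OF w(1)[OF that]] w(2)[OF that] by simp
  have 2: "linear_on (smul C) (smul C) ?S (\<lambda>\<xi>. (pcomp W H \<triangleright> \<xi> \<triangleleft> pcomp A F) \<bullet> val pre)"
    by (rule linear_on_compose[OF 1 vcomp_linear_left[OF dpre(10,11) dpost(10) dpre(9)]]) (use wm in blast)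
  have "linear_on (smul C) (smul C) ?S (\<lambda>\<xi>. val post \<bullet> ((pcomp W H \<triangleright> \<xi> \<triangleleft> pcomp A F) \<bullet> val pre))"
    by (rule linear_on_compose[OF 2 vcomp_linear_right[OF dpre(10) dpost(10,11,9)]])
      (use vcomp_closed[OF dpre(10,11) dpost(10) dpre(9) wm] in blast)
  then show ?thesis
  proof (rule vs.linear_on_cong[OF S])
    fix \<xi> assume x: "\<xi> \<in> ?S"
    show "val (post ** wh H (mk_cell V W p q \<xi>) F ** pre) = val post \<bullet> ((pcomp W H \<triangleright> \<xi> \<triangleleft> pcomp A F) \<bullet> val pre)"
      using val_vc[OF ty_vc[OF pre w(1)[OF x]] post] val_vc[OF pre w(1)[OF x]] w(2)[OF x] by simp
  qed
qed

end

section \<open>Actions of a 2-representation on 1-morphisms\<close>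

text \<open>From here on, \<open>phi g h\<close> and \<open>phi1\<close> are the structure isomorphisms of the 2-representation, and primes
denote inverses.\<close>

locale rep_cells = klinear_2category C + two_representation C G V R + G?: group G
  for C :: "('k::field, 'o, 'a, 'm::ab_group_add, 'z) two_cat_scheme" (structure)
    and G :: "('g, 'y) monoid_scheme" and V :: 'o and R :: "('g, 'a, 'm) rep2"
begin

definition rho :: "'g \<Rightarrow> ('o, 'a) arrow" where "rho g = (V, V, act R g)"

definition phi :: "'g \<Rightarrow> 'g \<Rightarrow> ('o, 'a, 'm) cell" where
  "phi g h = mk_cell V V [rho g, rho h] [rho (g \<otimes>\<^bsub>G\<^esub> h)] (act_mult R g h)"

definition phi' :: "'g \<Rightarrow> 'g \<Rightarrow> ('o, 'a, 'm) cell" where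
  "phi' g h = mk_cell V V [rho (g \<otimes>\<^bsub>G\<^esub> h)] [rho g, rho h]
     (inv2 C (act R g \<cdot> act R h) (act R (g \<otimes>\<^bsub>G\<^esub> h)) (act_mult R g h))"

definition phi1 :: "('o, 'a, 'm) cell" where
  "phi1 = mk_cell V V [rho \<one>\<^bsub>G\<^esub>] [] (act_one R)"

definition phi1' :: "('o, 'a, 'm) cell" where
  "phi1' = mk_cell V V [] [rho \<one>\<^bsub>G\<^esub>] (inv2 C (act R \<one>\<^bsub>G\<^esub>) (id1 C V) (act_one R))"

lemma path_rho [simp]: "g \<in> carrier G \<Longrightarrow> path A B (rho g # p) \<longleftrightarrow> B = V \<and> path A V p"
  by (auto simp: rho_def act_closed)

lemma pdom_rho [simp]: "pdom B (rho g # p) = pdom V p" and pcod_rho [simp]: "pcod B (rho g # p) = V"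
  by (simp_all add: rho_def)

lemma pcomp_rho [simp]: "pcomp A (rho g # p) = act R g \<cdot> pcomp A p"
  by (simp add: rho_def)

lemma act_id1 [simp]: "g \<in> carrier G \<Longrightarrow> act R g \<cdot> id1 C V = act R g"
  by (rule comp1_id_right[OF act_closed])

lemma phi_inv:
  assumes "g \<in> carrier G" "h \<in> carrier G"
  shows "inv_pair (phi g h) (phi' g h) V V [rho g, rho h] [rho (g \<otimes>\<^bsub>G\<^esub> h)]"
  using inv_pair_iso2[of V V "[rho g, rho h]" "[rho (g \<otimes>\<^bsub>G\<^esub> h)]" "act_mult R g h"] act_mult_iso[OF assms] assms
  by (simp add: phi_def phi'_def)

lemma phi1_inv: "inv_pair phi1 phi1' V V [rho \<one>\<^bsub>G\<^esub>] []"
  using inv_pair_iso2[of V V "[rho \<one>\<^bsub>G\<^esub>]" "[]" "act_one R"] act_one_iso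
  by (simp add: phi1_def phi1'_def)

lemmas phi_ty = inv_pairD(1)[OF phi_inv] and phi'_ty = inv_pairD(2)[OF phi_inv]
  and phi1_ty = inv_pairD(1)[OF phi1_inv] and phi1'_ty = inv_pairD(2)[OF phi1_inv]

lemmas gen_ty [simp] = tyD(1-6)[OF phi_ty] tyD(1-6)[OF phi'_ty] tyD(1-6)[OF phi1_ty] tyD(1-6)[OF phi1'_ty]

lemma val_phi [simp]: "g \<in> carrier G \<Longrightarrow> h \<in> carrier G \<Longrightarrow> val (phi g h) = act_mult R g h"
  using act_mult_iso[of g h] by (simp add: phi_def val_mk_cell iso2_def)

lemma val_phi1 [simp]: "val phi1 = act_one R"
  using act_one_iso by (simp add: phi1_def val_mk_cell iso2_def)

lemma val_phi1' [simp]: "val phi1' = inv2 C (act R \<one>\<^bsub>G\<^esub>) (id1 C V) (act_one R)"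
  using inv_pair_val(3)[OF phi1_inv] by simp

lemma val_phi' [simp]: "g \<in> carrier G \<Longrightarrow> h \<in> carrier G \<Longrightarrow>
    val (phi' g h) = inv2 C (act R g \<cdot> act R h) (act R (g \<otimes>\<^bsub>G\<^esub> h)) (act_mult R g h)"
  using inv_pair_val(3)[OF phi_inv[of g h]] by simp

lemma phi_assoc:
  assumes [simp]: "g \<in> carrier G" "h \<in> carrier G" "l \<in> carrier G"
  shows "phi (g \<otimes>\<^bsub>G\<^esub> h) l ** wh [] (phi g h) [rho l] = phi g (h \<otimes>\<^bsub>G\<^esub> l) ** wh [rho g] (phi h l) []"
proof -
  have 1: "ty (wh [] (phi g h) [rho l]) V V [rho g, rho h, rho l] [rho (g \<otimes>\<^bsub>G\<^esub> h), rho l]"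
    using ty_wh[OF phi_ty[of g h], of V "[rho l]" V "[]"] by simp
  have 2: "ty (wh [rho g] (phi h l) []) V V [rho g, rho h, rho l] [rho g, rho (h \<otimes>\<^bsub>G\<^esub> l)]"
    using ty_wh[OF phi_ty[of h l], of V "[]" V "[rho g]"] by simp
  have 3: "ty (phi (g \<otimes>\<^bsub>G\<^esub> h) l) V V [rho (g \<otimes>\<^bsub>G\<^esub> h), rho l] [rho (g \<otimes>\<^bsub>G\<^esub> h \<otimes>\<^bsub>G\<^esub> l)]"
    "ty (phi g (h \<otimes>\<^bsub>G\<^esub> l)) V V [rho g, rho (h \<otimes>\<^bsub>G\<^esub> l)] [rho (g \<otimes>\<^bsub>G\<^esub> h \<otimes>\<^bsub>G\<^esub> l)]"
    using phi_ty[of "g \<otimes>\<^bsub>G\<^esub> h" l] phi_ty[of g "h \<otimes>\<^bsub>G\<^esub> l"] by (simp_all add: m_assoc)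
  have v: "val (wh [] (phi g h) [rho l]) = act_mult R g h \<triangleleft> act R l" "val (wh [rho g] (phi h l) []) = act R g \<triangleright> act_mult R h l"
    using val_wh_right[OF phi_ty[of g h], of V "[rho l]"] val_wh_left[OF phi_ty[of h l], of V "[rho g]"] by simp_all
  show ?thesis
    by (rule ty_eqI[OF ty_vc[OF 1 3(1)] ty_vc[OF 2 3(2)]])
      (use act_mult_assoc[of g h l] in \<open>simp add: val_vc[OF 1 3(1)] val_vc[OF 2 3(2)] v\<close>)
qed

lemma phi_one_left: "g \<in> carrier G \<Longrightarrow> phi \<one>\<^bsub>G\<^esub> g = wh [] phi1 [rho g]"
  using ty_wh[OF phi1_ty, of V "[rho g]" V "[]"] phi_ty[of "\<one>\<^bsub>G\<^esub>" g] val_wh_right[OF phi1_ty, of V "[rho g]"] act_one_left[of g]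
  by (intro ty_eqI) simp_all

lemma phi_one_right: "g \<in> carrier G \<Longrightarrow> phi g \<one>\<^bsub>G\<^esub> = wh [rho g] phi1 []"
  using ty_wh[OF phi1_ty, of V "[]" V "[rho g]"] phi_ty[of g "\<one>\<^bsub>G\<^esub>"] val_wh_left[OF phi1_ty, of V "[rho g]"] act_one_right[of g]
  by (intro ty_eqI) simp_all

text \<open>An action of the 2-representation on the composite \<open>f\<close>. The inverses \<open>e\<close> are part of the data, being
needed as trivializations; \<open>action_of_triv\<close> recovers the axioms from those of a trivialization.\<close>

definition action :: "'o \<Rightarrow> ('o, 'a) arrow list \<Rightarrow> ('g \<Rightarrow> ('o, 'a, 'm) cell) \<Rightarrow> ('g \<Rightarrow> ('o, 'a, 'm) cell) \<Rightarrow> bool" where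
  "action W f m e \<longleftrightarrow> path W V f \<and>
     (\<forall>g\<in>carrier G. inv_pair (m g) (e g) W V (rho g # f) f) \<and>
     (\<forall>g\<in>carrier G. \<forall>h\<in>carrier G. m (g \<otimes>\<^bsub>G\<^esub> h) ** wh [] (phi g h) f = m g ** wh [rho g] (m h) []) \<and>
     m \<one>\<^bsub>G\<^esub> = wh [] phi1 f"

lemma actionD:
  assumes "action W f m e"
  shows "path W V f" "g \<in> carrier G \<Longrightarrow> inv_pair (m g) (e g) W V (rho g # f) f"
    "g \<in> carrier G \<Longrightarrow> h \<in> carrier G \<Longrightarrow> m (g \<otimes>\<^bsub>G\<^esub> h) ** wh [] (phi g h) f = m g ** wh [rho g] (m h) []"
    "m \<one>\<^bsub>G\<^esub> = wh [] phi1 f"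
    "g \<in> carrier G \<Longrightarrow> ty (m g) W V (rho g # f) f"
    "g \<in> carrier G \<Longrightarrow> ty (e g) W V f (rho g # f)"
  using assms by (auto simp: action_def inv_pair_def)

lemma action_wh:
  assumes a: "action W f m e" and h: "path W' W k"
  shows "action W' (f @ k) (\<lambda>g. wh [] (m g) k) (\<lambda>g. wh [] (e g) k)"
  unfolding action_def
proof (intro conjI ballI)
  note d = actionD[OF a]
  show "path W' V (f @ k)" using d(1) h path_pdom[OF d(1)] by simp
  show "inv_pair (wh [] (m g) k) (wh [] (e g) k) W' V (rho g # f @ k) (f @ k)" if "g \<in> carrier G" for g
    using inv_pair_wh[OF d(2)[OF that] h, of V "[]"] by simp
  show "wh [] (m (g \<otimes>\<^bsub>G\<^esub> h)) k ** wh [] (phi g h) (f @ k) = wh [] (m g) k ** wh [rho g] (wh [] (m h) k) []"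
    if "g \<in> carrier G" "h \<in> carrier G" for g h
    using arg_cong[OF d(3)[OF that], of "\<lambda>x. wh [] x k"] by (simp add: wh_vc wh_wh)
  show "wh [] (m \<one>\<^bsub>G\<^esub>) k = wh [] phi1 (f @ k)" using d(4) by (simp add: wh_wh)
qed

lemma action_triv:
  assumes a: "action W f m e" and g [simp]: "g \<in> carrier G" and h [simp]: "h \<in> carrier G"
  shows "wh [] (phi g h) f ** wh [rho g] (e h) [] ** e g = e (g \<otimes>\<^bsub>G\<^esub> h)"
proof -
  note d = actionD[OF a]
  have gh [simp]: "g \<otimes>\<^bsub>G\<^esub> h \<in> carrier G" by simp
  note [simp] = d(1) tyD(1-5)[OF d(5)] tyD(1-5)[OF d(6)] path_pdom[OF d(1)]
  have t: "ty (wh [] (phi g h) f ** wh [rho g] (e h) [] ** e g) W V f (rho (g \<otimes>\<^bsub>G\<^esub> h) # f)"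
    by (simp add: tys)
  have "wh [] (phi g h) f ** wh [rho g] (e h) [] ** e g
      = e (g \<otimes>\<^bsub>G\<^esub> h) ** (m (g \<otimes>\<^bsub>G\<^esub> h) ** wh [] (phi g h) f) ** wh [rho g] (e h) [] ** e g"
    using inv_pair_cancel[OF inv_pair_sym[OF d(2)[OF gh]] t] by (simp add: vc_assoc)
  also have "\<dots> = e (g \<otimes>\<^bsub>G\<^esub> h) ** m g ** wh [rho g] (m h) [] ** wh [rho g] (e h) [] ** e g"
    unfolding d(3)[OF g h] by (simp add: vc_assoc)
  also have "\<dots> = e (g \<otimes>\<^bsub>G\<^esub> h) ** m g ** e g"
    using inv_pair_cancel[OF inv_pair_wh[OF d(2)[OF h], of W "[]" V "[rho g]"], of "e g"] d(6)[OF g] by simp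
  also have "\<dots> = e (g \<otimes>\<^bsub>G\<^esub> h)"
    using inv_pairD(4)[OF d(2)[OF g]] vc_id_cell_right[OF d(6)[OF gh]] by simp
  finally show ?thesis .
qed

text \<open>A trivialization has a multiplicativity axiom but no unit axiom; invertibility makes up for it.\<close>

lemma action_of_triv:
  assumes f: "path W V f" and inv: "\<And>g. g \<in> carrier G \<Longrightarrow> inv_pair (m g) (e g) W V (rho g # f) f"
    and mult: "\<And>g h. g \<in> carrier G \<Longrightarrow> h \<in> carrier G \<Longrightarrow>
       wh [] (phi g h) f ** wh [rho g] (e h) [] ** e g = e (g \<otimes>\<^bsub>G\<^esub> h)"
  shows "action W f m e"
  unfolding action_def
proof (intro conjI ballI f inv)
  note mt = inv_pairD(1)[OF inv] and et = inv_pairD(2)[OF inv]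
  note [simp] = f tyD(1-5)[OF mt] tyD(1-5)[OF et] path_pdom[OF f]
  fix g h assume g [simp]: "g \<in> carrier G" and h [simp]: "h \<in> carrier G"
  have gh [simp]: "g \<otimes>\<^bsub>G\<^esub> h \<in> carrier G" by simp
  let ?M = "m (g \<otimes>\<^bsub>G\<^esub> h)" and ?P = "wh [] (phi g h) f"
  have ip: "inv_pair (m g ** wh [rho g] (m h) []) (wh [rho g] (e h) [] ** e g) W V (rho g # rho h # f) f"
    using inv_pair_vc[OF inv_pair_wh[OF inv[OF h], of W "[]" V "[rho g]"], of "m g" "e g"] inv[OF g] by simp
  have t: "ty (?M ** ?P) W V (rho g # rho h # f) f" by (simp add: tys)
  have "?M ** ?P = (?M ** ?P) ** (wh [rho g] (e h) [] ** e g) ** (m g ** wh [rho g] (m h) [])"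
    using inv_pairD(3)[OF ip] vc_id_cell_right[OF t] by simp
  also have "\<dots> = (?M ** (?P ** wh [rho g] (e h) [] ** e g)) ** (m g ** wh [rho g] (m h) [])"
    by (simp add: vc_assoc)
  also have "\<dots> = m g ** wh [rho g] (m h) []"
    unfolding mult[OF g h] inv_pairD(4)[OF inv[OF gh]] using vc_id_cell_left[OF inv_pairD(1)[OF ip]] by simp
  finally show "?M ** ?P = m g ** wh [rho g] (m h) []" .
next
  note mt = inv_pairD(1)[OF inv] and et = inv_pairD(2)[OF inv]
  note [simp] = f tyD(1-5)[OF mt] tyD(1-5)[OF et] path_pdom[OF f]
  let ?o = "\<one>\<^bsub>G\<^esub>"
  have o [simp]: "?o \<in> carrier G" by simp
  have mto: "ty (m ?o) W V (rho ?o # f) f" and eto: "ty (e ?o) W V f (rho ?o # f)" using mt et by simp_all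
  have uf: "ty (wh [] phi1 f) W V (rho ?o # f) f" using ty_wh[OF phi1_ty f, of V "[]"] by simp
  \<comment> \<open>Cancelling \<open>e 1\<close> in the multiplicativity at \<open>(1, 1)\<close> leaves that \<open>e 1\<close> is right inverse to
    the unit, after both have been whiskered on one side; the exchange law moves the whiskering.\<close>
  have t: "ty (wh [rho ?o] phi1 f ** wh [rho ?o] (e ?o) []) W V (rho ?o # f) (rho ?o # f)" by (simp add: tys)
  have "wh [rho ?o] phi1 f ** wh [rho ?o] (e ?o) [] = (wh [rho ?o] phi1 f ** wh [rho ?o] (e ?o) []) ** e ?o ** m ?o"
    using inv_pairD(3)[OF inv[OF o]] vc_id_cell_right[OF t] by simp
  also have "\<dots> = (wh [] (phi ?o ?o) f ** wh [rho ?o] (e ?o) [] ** e ?o) ** m ?o"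
    using phi_one_right[OF o] by (simp add: vc_assoc wh_wh)
  also have "\<dots> = id_cell W V (rho ?o # f)"
    using mult[OF o o] inv_pairD(3)[OF inv[OF o]] by simp
  finally have 1: "wh [rho ?o] phi1 f ** wh [rho ?o] (e ?o) [] = id_cell W V (rho ?o # f)" .
  have r: "wh [rho ?o] phi1 f = wh [] phi1 (rho ?o # f)"
    using arg_cong[OF phi_one_right[OF o], of "\<lambda>x. wh [] x f"] arg_cong[OF phi_one_left[OF o], of "\<lambda>x. wh [] x f"]
    by (simp add: wh_wh)
  have x: "wh [] phi1 (rho ?o # f) ** wh [rho ?o] (e ?o) [] = e ?o ** wh [] phi1 f"
    using exchange[OF phi1_ty eto, of "[]" "[]" "[]"] wh_nil[of "e ?o"] eto by (simp add: ok_clean)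
  have "wh [] phi1 f = m ?o ** e ?o ** wh [] phi1 f"
    using inv_pair_cancel[OF inv[OF o] uf] by simp
  also have "\<dots> = m ?o ** id_cell W V (rho ?o # f)"
    using 1 unfolding r x by simp
  also have "\<dots> = m ?o" by (rule vc_id_cell_right[OF mto])
  finally show "m ?o = wh [] phi1 f" by simp
qed

text \<open>For the trivial 2-representation on \<open>W\<close>, the axioms of a flip are those of an action, and the
  inverse of an action is a trivialization compatible with it: both sides of the compatibility
  reduce by multiplicativity to the inverse at \<open>s g\<close>.\<close>

lemma action_flip:
  assumes a: "action W f m e"
  shows "is_flip C G W (triv_rep W) V R (pcomp W f) (\<lambda>g. val (m g))"
proof -
  note d = actionD[OF a]
  have F: "pcomp W f \<in> hom1 C W V" using pcomp_closed[OF d(1)] .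
  have Fi: "pcomp W f \<cdot> id1 C W = pcomp W f" by (rule comp1_id_right[OF F])
  have Fid: "pcomp W f \<triangleright> id2 C (id1 C W) = id2 C (pcomp W f)"
    using lwhisk_id2[OF id1_closed F] Fi by simp
  note [simp] = d(1) tyD(1-5)[OF d(5)] path_pdom[OF d(1)]
  show ?thesis
    unfolding is_flip_def triv_rep_simps Fi Fid
  proof (intro conjI ballI F)
    show "val (m g) \<in> iso2 C (act R g \<cdot> pcomp W f) (pcomp W f)" if "g \<in> carrier G" for g
      using inv_pair_val(2)[OF d(2)[OF that]] by simp
    show "val (m (g \<otimes>\<^bsub>G\<^esub> h)) \<bullet> (act_mult R g h \<triangleleft> pcomp W f)
        = id2 C (pcomp W f) \<bullet> (val (m g) \<triangleleft> id1 C W) \<bullet> (act R g \<triangleright> val (m h))"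
      if g [simp]: "g \<in> carrier G" and h [simp]: "h \<in> carrier G" for g h
    proof -
      note t = tyD(10,11,9)[OF d(5)[OF g]]
      have 1: "val (m g) \<triangleleft> id1 C W = val (m g)" by (rule rwhisk_id1[OF t])
      have 2: "id2 C (pcomp W f) \<bullet> val (m g) = val (m g)" by (rule vcomp_id_left[OF t])
      have w: "val (wh [] (phi g h) f) = act_mult R g h \<triangleleft> pcomp W f"
        "val (wh [rho g] (m h) []) = act R g \<triangleright> val (m h)"
        using val_wh_right[OF phi_ty[OF g h] d(1)] val_wh_left[OF d(5)[OF h], of V "[rho g]"] by simp_all
      have "val (m (g \<otimes>\<^bsub>G\<^esub> h) ** wh [] (phi g h) f) = val (m g ** wh [rho g] (m h) [])"
        unfolding d(3)[OF g h] ..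
      then show ?thesis unfolding 1 2 by (simp add: vc_sel wh_sel(1-4) w)
    qed
    have "inv2 C (pcomp W f) (pcomp W f) (id2 C (pcomp W f)) = id2 C (pcomp W f)"
      using inv2_eq[OF F F id2_closed[OF F] id2_iso[OF F]] .
    then show "val (m \<one>\<^bsub>G\<^esub>) = inv2 C (pcomp W f) (pcomp W f) (id2 C (pcomp W f)) \<bullet> (act_one R \<triangleleft> pcomp W f)"
      using vcomp_id_left[OF tyD(10,11,9)[OF d(5)[of "\<one>\<^bsub>G\<^esub>"]]] val_wh_right[OF phi1_ty d(1)] by (simp add: d(4))
  qed
qed

lemma action_trivialization:
  assumes a: "action W f m e"
  shows "is_trivialization C G W (triv_rep W) V R (pcomp W f) (\<lambda>g. val (m g)) (\<lambda>g. val (e g))"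
proof -
  note d = actionD[OF a]
  have F: "pcomp W f \<in> hom1 C W V" using pcomp_closed[OF d(1)] .
  have Fi: "pcomp W f \<cdot> id1 C W = pcomp W f" by (rule comp1_id_right[OF F])
  note [simp] = d(1) tyD(1-5)[OF d(6)] path_pdom[OF d(1)]
  have m: "(act_mult R g h \<triangleleft> pcomp W f) \<bullet> (act R g \<triangleright> val (e h)) \<bullet> val (e g) = val (e (g \<otimes>\<^bsub>G\<^esub> h))"
    if g [simp]: "g \<in> carrier G" and h [simp]: "h \<in> carrier G" for g h
  proof -
    have w: "val (wh [] (phi g h) f) = act_mult R g h \<triangleleft> pcomp W f"
      "val (wh [rho g] (e h) []) = act R g \<triangleright> val (e h)"
      using val_wh_right[OF phi_ty[OF g h] d(1)] val_wh_left[OF d(6)[OF h], of V "[rho g]"] by simp_all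
    have "val ((wh [] (phi g h) f ** wh [rho g] (e h) []) ** e g) = val (e (g \<otimes>\<^bsub>G\<^esub> h))"
      using action_triv[OF a g h] by (simp only: vc_assoc)
    then show ?thesis by (simp add: vc_sel wh_sel(1-4) w)
  qed
  have i: "inv2 C (act R s \<cdot> pcomp W f) (pcomp W f) (val (m s)) = val (e s)" if "s \<in> carrier G" for s
    using inv_pair_val(3)[OF d(2)[OF that]] by simp
  have c: "val (e t) \<triangleleft> id1 C W = val (e t)" if "t \<in> carrier G" for t
    by (rule rwhisk_id1[OF tyD(10,11,9)[OF d(6)[OF that]]])
  have t: "s \<otimes>\<^bsub>G\<^esub> g \<otimes>\<^bsub>G\<^esub> inv\<^bsub>G\<^esub> s \<otimes>\<^bsub>G\<^esub> s = s \<otimes>\<^bsub>G\<^esub> g" if "s \<in> carrier G" "g \<in> carrier G" for s g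
    using that by (simp add: m_assoc)
  show ?thesis
    unfolding is_trivialization_def triv_rep_simps Fi Let_def
    using inv_pair_val(2)[OF inv_pair_sym[OF d(2)]] by (simp add: m i c t)
qed

lemma trivialization_action:
  assumes f: "path W V f" and inv: "\<And>g. g \<in> carrier G \<Longrightarrow> inv_pair (m g) (e g) W V (rho g # f) f"
    and tr: "is_trivialization C G W Q V R (pcomp W f) \<tau> \<epsilon>" and v: "\<And>g. g \<in> carrier G \<Longrightarrow> val (e g) = \<epsilon> g"
  shows "action W f m e"
proof (rule action_of_triv[OF f inv])
  note et = inv_pairD(2)[OF inv]
  note [simp] = f tyD(1-5)[OF et] path_pdom[OF f]
  fix g h assume g [simp]: "g \<in> carrier G" and h [simp]: "h \<in> carrier G"
  have w: "val (wh [] (phi g h) f) = act_mult R g h \<triangleleft> pcomp W f"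
    "val (wh [rho g] (e h) []) = act R g \<triangleright> val (e h)"
    using val_wh_right[OF phi_ty[OF g h] f] val_wh_left[OF et[OF h], of V "[rho g]"] by simp_all
  have "(act_mult R g h \<triangleleft> pcomp W f) \<bullet> (act R g \<triangleright> val (e h)) \<bullet> val (e g) = val (e (g \<otimes>\<^bsub>G\<^esub> h))"
    using tr unfolding is_trivialization_def by (simp add: Let_def v)
  then have v: "val ((wh [] (phi g h) f ** wh [rho g] (e h) []) ** e g) = val (e (g \<otimes>\<^bsub>G\<^esub> h))"
    by (simp add: vc_sel wh_sel(1-4) w)
  show "wh [] (phi g h) f ** wh [rho g] (e h) [] ** e g = e (g \<otimes>\<^bsub>G\<^esub> h)"
  proof (rule ty_eqI)
    show "ty (wh [] (phi g h) f ** wh [rho g] (e h) [] ** e g) W V f (rho (g \<otimes>\<^bsub>G\<^esub> h) # f)" by (simp add: tys)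
    show "ty (e (g \<otimes>\<^bsub>G\<^esub> h)) W V f (rho (g \<otimes>\<^bsub>G\<^esub> h) # f)" by (rule et) simp
  qed (use v in \<open>simp only: vc_assoc\<close>)
qed

definition equivariant :: "('o, 'a, 'm) cell \<Rightarrow> ('g \<Rightarrow> ('o, 'a, 'm) cell) \<Rightarrow> ('g \<Rightarrow> ('o, 'a, 'm) cell) \<Rightarrow> bool" where
  "equivariant b m m' \<longleftrightarrow> (\<forall>g\<in>carrier G. b ** m g = m' g ** wh [rho g] b [])"

lemma equivariant_inverse:
  assumes m: "action W f m e" and m': "action W f' m' e'" and b: "ty b W V f f'"
  shows "equivariant b m m' \<longleftrightarrow> (\<forall>g\<in>carrier G. e' g ** b = wh [rho g] b [] ** e g)"
  unfolding equivariant_def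
proof (rule ball_cong[OF refl])
  fix g assume g: "g \<in> carrier G"
  note i = actionD(2)[OF m g] and i' = actionD(2)[OF m' g]
  note d = inv_pairD[OF i] and d' = inv_pairD[OF i']
  have wb: "ty (wh [rho g] b []) W V (rho g # f) (rho g # f')"
    using ty_wh[OF b, of W "[]" V "[rho g]"] g by simp
  show "b ** m g = m' g ** wh [rho g] b [] \<longleftrightarrow> e' g ** b = wh [rho g] b [] ** e g"
  proof
    assume a: "b ** m g = m' g ** wh [rho g] b []"
    have "e' g ** b = e' g ** (b ** m g) ** e g"
      using d(4) vc_id_cell_right[OF b] by (simp add: vc_assoc)
    also have "\<dots> = wh [rho g] b [] ** e g"
      unfolding a using inv_pair_cancel[OF inv_pair_sym[OF i'] ty_vc[OF d(2) wb]] by (simp add: vc_assoc)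
    finally show "e' g ** b = wh [rho g] b [] ** e g" .
  next
    assume a: "e' g ** b = wh [rho g] b [] ** e g"
    have "b ** m g = m' g ** (e' g ** b) ** m g"
      using inv_pair_cancel[OF i' ty_vc[OF d(1) b]] by (simp add: vc_assoc)
    also have "\<dots> = m' g ** wh [rho g] b []"
      unfolding a using d(3) vc_id_cell_right[OF wb] by (simp add: vc_assoc)
    finally show "b ** m g = m' g ** wh [rho g] b []" .
  qed
qed

lemma commutes_flips_iff:
  assumes m: "action W f m e" and m': "action W f' m' e'" and b: "ty b W V f f'"
    and v: "\<And>g. g \<in> carrier G \<Longrightarrow> \<tau> g = val (m g)" "\<And>g. g \<in> carrier G \<Longrightarrow> \<tau>' g = val (m' g)"
  shows "commutes_flips C G (triv_rep W) R \<tau> \<tau>' (val b) \<longleftrightarrow> equivariant b m m'"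
  unfolding commutes_flips_def equivariant_def
proof (rule ball_cong[OF refl])
  fix g assume g: "g \<in> carrier G"
  note d = inv_pairD[OF actionD(2)[OF m g]] and d' = inv_pairD[OF actionD(2)[OF m' g]]
  have wb: "ty (wh [rho g] b []) W V (rho g # f) (rho g # f')"
    using ty_wh[OF b, of W "[]" V "[rho g]"] g by simp
  have w: "val (wh [rho g] b []) = act R g \<triangleright> val b"
    using val_wh_left[OF b, of V "[rho g]"] g by simp
  have r: "val b \<triangleleft> id1 C W = val b" by (rule rwhisk_id1[OF tyD(10,11,9)[OF b]])
  have "b ** m g = m' g ** wh [rho g] b [] \<longleftrightarrow> val (b ** m g) = val (m' g ** wh [rho g] b [])"
    using ty_eqI[OF ty_vc[OF d(1) b] ty_vc[OF wb d'(1)]] by auto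
  then show "\<tau>' g \<bullet> (act R g \<triangleright> val b) = (val b \<triangleleft> act (triv_rep W) g) \<bullet> \<tau> g \<longleftrightarrow> b ** m g = m' g ** wh [rho g] b []"
    using val_vc[OF d(1) b] val_vc[OF wb d'(1)] v g w r by auto
qed

lemma commutes_triv_iff:
  assumes m: "action W f m e" and m': "action W f' m' e'" and b: "ty b W V f f'"
    and v: "\<And>g. g \<in> carrier G \<Longrightarrow> \<epsilon> g = val (e g)" "\<And>g. g \<in> carrier G \<Longrightarrow> \<epsilon>' g = val (e' g)"
  shows "commutes_triv C G R \<epsilon> \<epsilon>' (val b) \<longleftrightarrow> equivariant b m m'"
  unfolding commutes_triv_def equivariant_inverse[OF m m' b]
proof (rule ball_cong[OF refl])
  fix g assume g: "g \<in> carrier G"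
  note d = inv_pairD[OF actionD(2)[OF m g]] and d' = inv_pairD[OF actionD(2)[OF m' g]]
  have wb: "ty (wh [rho g] b []) W V (rho g # f) (rho g # f')"
    using ty_wh[OF b, of W "[]" V "[rho g]"] g by simp
  have w: "val (wh [rho g] b []) = act R g \<triangleright> val b"
    using val_wh_left[OF b, of V "[rho g]"] g by simp
  have "e' g ** b = wh [rho g] b [] ** e g \<longleftrightarrow> val (e' g ** b) = val (wh [rho g] b [] ** e g)"
    using ty_eqI[OF ty_vc[OF b d'(2)] ty_vc[OF d(2) wb]] by auto
  then show "\<epsilon>' g \<bullet> val b = (act R g \<triangleright> val b) \<bullet> \<epsilon> g \<longleftrightarrow> e' g ** b = wh [rho g] b [] ** e g"
    using val_vc[OF b d'(2)] val_vc[OF d(2) wb] v g w by auto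
qed

end

section \<open>The regular action and the conjugation maps\<close>

context rep_cells
begin

text \<open>The element \<open>s\<close> acts on the direct sum of all \<open>rho h\<close> by mapping \<open>s\<close> composed with the summand of \<open>h\<close>
to the summand of \<open>s h\<close>. All axioms can be checked on summands, where they become those of the
2-representation, and left translation by \<open>s\<close> being bijective gives the inverse.\<close>

lemma regular_action:
  assumes b: "biprod (carrier G) V V rho P i p"
  shows "\<exists>m e. action V [P] m e \<and>
     (\<forall>s\<in>carrier G. \<forall>h\<in>carrier G. m s ** wh [rho s] (i h) [] = i (s \<otimes>\<^bsub>G\<^esub> h) ** phi s h)"
proof -
  have P: "path V V [P]" and ti: "\<And>k. k \<in> carrier G \<Longrightarrow> ty (i k) V V [rho k] [P]"
    using b by (simp_all add: biprod_def)
  have pP [simp]: "path A V [P] \<longleftrightarrow> A = V" "pdom V [P] = V" "pcod V [P] = V" for A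
    using P path_pdom[OF P] path_pcod[OF P] path_pdom[of A V "[P]"] by auto
  have [simp]: "wh [] (i k) [] = i k" if "k \<in> carrier G" for k using wh_nil[OF tyD(6)[OF ti[OF that]]] .
  have "\<exists>x. ty x V V ([rho s] @ [P] @ []) [P] \<and> (\<forall>h\<in>carrier G. x ** wh [rho s] (i h) [] = i (s \<otimes>\<^bsub>G\<^esub> h) ** phi s h)"
    if "s \<in> carrier G" for s
    by (rule biprod_copair[OF b]) (use that ty_vc[OF phi_ty[OF that] ti] in simp_all)
  then obtain m where mt: "\<And>s. s \<in> carrier G \<Longrightarrow> ty (m s) V V [rho s, P] [P]"
    and m: "\<And>s h. s \<in> carrier G \<Longrightarrow> h \<in> carrier G \<Longrightarrow> m s ** wh [rho s] (i h) [] = i (s \<otimes>\<^bsub>G\<^esub> h) ** phi s h"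
    by simp metis
  have c: "s \<otimes>\<^bsub>G\<^esub> (inv\<^bsub>G\<^esub> s \<otimes>\<^bsub>G\<^esub> k) = k" "inv\<^bsub>G\<^esub> s \<otimes>\<^bsub>G\<^esub> (s \<otimes>\<^bsub>G\<^esub> k) = k"
    if "s \<in> carrier G" "k \<in> carrier G" for s k
    using that by (simp_all add: m_assoc[symmetric])
  have wi: "ty (wh [rho s] (i h) []) V V [rho s, rho h] [rho s, P]" if "s \<in> carrier G" "h \<in> carrier G" for s h
    using ty_wh[OF ti[OF that(2)], of V "[]" V "[rho s]"] that by simp
  have "\<exists>x. ty x V V ([] @ [P] @ []) [rho s, P] \<and>
      (\<forall>k\<in>carrier G. x ** wh [] (i k) [] = wh [rho s] (i (inv\<^bsub>G\<^esub> s \<otimes>\<^bsub>G\<^esub> k)) [] ** phi' s (inv\<^bsub>G\<^esub> s \<otimes>\<^bsub>G\<^esub> k))"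
    if s: "s \<in> carrier G" for s
  proof (rule biprod_copair[OF b])
    fix k assume k: "k \<in> carrier G"
    show "ty (wh [rho s] (i (inv\<^bsub>G\<^esub> s \<otimes>\<^bsub>G\<^esub> k)) [] ** phi' s (inv\<^bsub>G\<^esub> s \<otimes>\<^bsub>G\<^esub> k)) V V ([] @ [rho k] @ []) [rho s, P]"
      using ty_vc[OF phi'_ty wi, of s "inv\<^bsub>G\<^esub> s \<otimes>\<^bsub>G\<^esub> k"] s k by (simp add: c)
  qed (use s in simp_all)
  then obtain e where et: "\<And>s. s \<in> carrier G \<Longrightarrow> ty (e s) V V [P] [rho s, P]"
    and e: "\<And>s k. s \<in> carrier G \<Longrightarrow> k \<in> carrier G \<Longrightarrow>
        e s ** i k = wh [rho s] (i (inv\<^bsub>G\<^esub> s \<otimes>\<^bsub>G\<^esub> k)) [] ** phi' s (inv\<^bsub>G\<^esub> s \<otimes>\<^bsub>G\<^esub> k)"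
    by simp metis
  have me: "m s ** e s = id_cell V V [P]" if s: "s \<in> carrier G" for s
  proof (rule biprod_ext[OF b, of V "[]" V "[]"])
    fix k assume k: "k \<in> carrier G"
    have sk: "inv\<^bsub>G\<^esub> s \<otimes>\<^bsub>G\<^esub> k \<in> carrier G" using s k by simp
    have "(m s ** e s) ** i k = (m s ** wh [rho s] (i (inv\<^bsub>G\<^esub> s \<otimes>\<^bsub>G\<^esub> k)) []) ** phi' s (inv\<^bsub>G\<^esub> s \<otimes>\<^bsub>G\<^esub> k)"
      using e[OF s k] by (simp add: vc_assoc)
    also have "\<dots> = i k ** phi s (inv\<^bsub>G\<^esub> s \<otimes>\<^bsub>G\<^esub> k) ** phi' s (inv\<^bsub>G\<^esub> s \<otimes>\<^bsub>G\<^esub> k)"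
      unfolding m[OF s sk] using c s k by (simp add: vc_assoc)
    also have "\<dots> = id_cell V V [P] ** i k"
      using inv_pairD(4)[OF phi_inv[OF s sk]] vc_id_cell_right[OF ti[OF k]] vc_id_cell_left[OF ti[OF k]] c s k by simp
    finally show "(m s ** e s) ** wh [] (i k) [] = id_cell V V [P] ** wh [] (i k) []" using k by simp
  qed (use ty_vc[OF et mt] ty_id_cell[OF P] s in simp_all)
  have em: "e s ** m s = id_cell V V [rho s, P]" if s: "s \<in> carrier G" for s
  proof (rule biprod_ext[OF b, of V "[]" V "[rho s]"])
    fix k assume k: "k \<in> carrier G"
    have sk: "s \<otimes>\<^bsub>G\<^esub> k \<in> carrier G" using s k by simp
    have "(e s ** m s) ** wh [rho s] (i k) [] = (e s ** i (s \<otimes>\<^bsub>G\<^esub> k)) ** phi s k"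
      using m[OF s k] by (simp add: vc_assoc)
    also have "\<dots> = wh [rho s] (i k) [] ** phi' s k ** phi s k"
      unfolding e[OF s sk] using c s k by (simp add: vc_assoc)
    also have "\<dots> = id_cell V V [rho s, P] ** wh [rho s] (i k) []"
      using inv_pairD(3)[OF phi_inv[OF s k]] vc_id_cell_right[OF wi[OF s k]] vc_id_cell_left[OF wi[OF s k]] by simp
    finally show "(e s ** m s) ** wh [rho s] (i k) [] = id_cell V V [rho s, P] ** wh [rho s] (i k) []" .
  qed (use ty_vc[OF mt et] ty_id_cell[of V V "[rho s, P]"] s in simp_all)
  have mult: "m (s \<otimes>\<^bsub>G\<^esub> t) ** wh [] (phi s t) [P] = m s ** wh [rho s] (m t) []"
    if s: "s \<in> carrier G" and t: "t \<in> carrier G" for s t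
  proof (rule biprod_ext[OF b, of V "[]" V "[rho s, rho t]"])
    have st: "s \<otimes>\<^bsub>G\<^esub> t \<in> carrier G" using s t by simp
    show "ty (m (s \<otimes>\<^bsub>G\<^esub> t) ** wh [] (phi s t) [P]) V V ([rho s, rho t] @ [P] @ []) [P]"
      using ty_vc[OF ty_wh[OF phi_ty[OF s t], of V "[P]" V "[]"], of "m (s \<otimes>\<^bsub>G\<^esub> t)" "[P]"] mt[OF st] by simp
    show "ty (m s ** wh [rho s] (m t) []) V V ([rho s, rho t] @ [P] @ []) [P]"
      using ty_vc[OF ty_wh[OF mt[OF t], of V "[]" V "[rho s]"], of "m s" "[P]"] mt[OF s] s by simp
    fix h assume h: "h \<in> carrier G"
    have th: "t \<otimes>\<^bsub>G\<^esub> h \<in> carrier G" using t h by simp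
    have "(m (s \<otimes>\<^bsub>G\<^esub> t) ** wh [] (phi s t) [P]) ** wh [rho s, rho t] (i h) []
        = (m (s \<otimes>\<^bsub>G\<^esub> t) ** wh [rho (s \<otimes>\<^bsub>G\<^esub> t)] (i h) []) ** wh [] (phi s t) [rho h]"
      using exchange[OF phi_ty[OF s t] ti[OF h], of "[]" "[]" "[]"] by (simp add: vc_assoc)
    also have "\<dots> = i (s \<otimes>\<^bsub>G\<^esub> t \<otimes>\<^bsub>G\<^esub> h) ** phi s (t \<otimes>\<^bsub>G\<^esub> h) ** wh [rho s] (phi t h) []"
      unfolding m[OF st h] using phi_assoc[OF s t h] by (simp add: vc_assoc)
    also have "\<dots> = (m s ** wh [rho s] (i (t \<otimes>\<^bsub>G\<^esub> h)) []) ** wh [rho s] (phi t h) []"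
      unfolding m[OF s th] using s t h by (simp add: m_assoc vc_assoc)
    also have "\<dots> = (m s ** wh [rho s] (m t) []) ** wh [rho s, rho t] (i h) []"
      using arg_cong[OF m[OF t h], of "\<lambda>x. m s ** wh [rho s] x []"] by (simp add: wh_vc wh_wh vc_assoc)
    finally show "(m (s \<otimes>\<^bsub>G\<^esub> t) ** wh [] (phi s t) [P]) ** wh [rho s, rho t] (i h) []
        = (m s ** wh [rho s] (m t) []) ** wh [rho s, rho t] (i h) []" .
  qed (use s t in simp_all)
  have one: "m \<one>\<^bsub>G\<^esub> = wh [] phi1 [P]"
  proof (rule biprod_ext[OF b, of V "[]" V "[rho \<one>\<^bsub>G\<^esub>]"])
    show "ty (wh [] phi1 [P]) V V ([rho \<one>\<^bsub>G\<^esub>] @ [P] @ []) [P]"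
      using ty_wh[OF phi1_ty, of V "[P]" V "[]"] by simp
    fix h assume h: "h \<in> carrier G"
    have "wh [] phi1 [P] ** wh [rho \<one>\<^bsub>G\<^esub>] (i h) [] = i h ** wh [] phi1 [rho h]"
      using exchange[OF phi1_ty ti[OF h], of "[]" "[]" "[]"] h by simp
    then show "m \<one>\<^bsub>G\<^esub> ** wh [rho \<one>\<^bsub>G\<^esub>] (i h) [] = wh [] phi1 [P] ** wh [rho \<one>\<^bsub>G\<^esub>] (i h) []"
      using m[OF one_closed h] phi_one_left[OF h] h by simp
  qed (use mt in simp_all)
  have "action V [P] m e"
    unfolding action_def using mt et em me mult one P by (simp add: inv_pair_def)
  then show ?thesis using m by blast
qed

text \<open>The map \<open>\<psi>\<^sub>s\<close> in terms of cells; see \<open>val_conj_cell\<close>.\<close>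

definition conj_cell :: "'g \<Rightarrow> 'g \<Rightarrow> ('o, 'a, 'm) cell \<Rightarrow> ('o, 'a, 'm) cell" where
  "conj_cell s g x = phi (s \<otimes>\<^bsub>G\<^esub> g) (inv\<^bsub>G\<^esub> s) ** wh [] (phi s g) [rho (inv\<^bsub>G\<^esub> s)] **
     wh [rho s] x [rho (inv\<^bsub>G\<^esub> s)] ** phi' s (inv\<^bsub>G\<^esub> s) ** phi1'"

lemma val_conj_cell:
  assumes s: "s \<in> carrier G" and g: "g \<in> carrier G" and x: "ty x V V [] [rho g]"
  shows "val (conj_cell s g x) = conj_map C G V R s g (val x)"
proof -
  note [simp] = s g tyD(1-5)[OF x]
  let ?s = "inv\<^bsub>G\<^esub> s"
  have s': "?s \<in> carrier G" by simp
  have 1: "val (wh [] (phi s g) [rho ?s]) = act_mult R s g \<triangleleft> act R ?s"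
    using val_wh_right[OF phi_ty[OF s g], of V "[rho ?s]"] by simp
  have 2: "val (wh [rho s] x [rho ?s]) = act R s \<triangleright> val x \<triangleleft> act R ?s"
    using val_wh[OF x, of V "[rho ?s]" V "[rho s]"] by simp
  have "conj_cell s g x = (((phi (s \<otimes>\<^bsub>G\<^esub> g) ?s ** wh [] (phi s g) [rho ?s]) ** wh [rho s] x [rho ?s]) ** phi' s ?s) ** phi1'"
    unfolding conj_cell_def by (simp add: vc_assoc)
  then show ?thesis
    unfolding conj_map_def Let_def by (simp add: vc_sel wh_sel(1-4) 1 2)
qed

lemma conj_cell_ty:
  assumes s: "s \<in> carrier G" and g: "g \<in> carrier G" and x: "ty x V V [] [rho g]"
  shows "ty (conj_cell s g x) V V [] [rho (s \<otimes>\<^bsub>G\<^esub> g \<otimes>\<^bsub>G\<^esub> inv\<^bsub>G\<^esub> s)]"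
proof -
  note [simp] = s g tyD(1-5)[OF x]
  show ?thesis unfolding conj_cell_def by (simp add: tys)
qed

lemma cat_trace_rho: "g \<in> carrier G \<Longrightarrow> cat_trace C V (act R g) = hom2 C (pcomp V []) (pcomp V [rho g])"
  by (simp add: cat_trace_def)

lemma cat_trace_subspace: "g \<in> carrier G \<Longrightarrow> vs.subspace (cat_trace C V (act R g))"
  unfolding cat_trace_def by (rule hom2_subspace[OF id1_closed act_closed])

definition trace_cell :: "'g \<Rightarrow> 'm \<Rightarrow> ('o, 'a, 'm) cell" where
  "trace_cell g \<xi> = mk_cell V V [] [rho g] \<xi>"

lemma trace_cell:
  assumes "g \<in> carrier G" "\<xi> \<in> cat_trace C V (act R g)"
  shows "ty (trace_cell g \<xi>) V V [] [rho g]" "val (trace_cell g \<xi>) = \<xi>"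
  using assms ty_mk_cell[of V V "[]" "[rho g]" \<xi>] val_mk_cell[of V V "[]" "[rho g]" \<xi>] by (simp_all add: cat_trace_rho trace_cell_def)

lemma conj_map_linear:
  assumes s: "s \<in> carrier G" and g: "g \<in> carrier G"
  shows "linear_on (smul C) (smul C) (cat_trace C V (act R g)) (conj_map C G V R s g)"
    and "\<xi> \<in> cat_trace C V (act R g) \<Longrightarrow>
      conj_map C G V R s g \<xi> \<in> cat_trace C V (act R (s \<otimes>\<^bsub>G\<^esub> g \<otimes>\<^bsub>G\<^esub> inv\<^bsub>G\<^esub> s))"
proof -
  note [simp] = s g
  let ?s = "inv\<^bsub>G\<^esub> s"
  have pre: "ty (phi' s ?s ** phi1') V V [] ([rho s] @ [] @ [rho ?s])"
    and post: "ty (phi (s \<otimes>\<^bsub>G\<^esub> g) ?s ** wh [] (phi s g) [rho ?s]) V V ([rho s] @ [rho g] @ [rho ?s]) [rho (s \<otimes>\<^bsub>G\<^esub> g \<otimes>\<^bsub>G\<^esub> ?s)]"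
    by (simp_all add: tys)
  show "linear_on (smul C) (smul C) (cat_trace C V (act R g)) (conj_map C G V R s g)"
  proof (rule vs.linear_on_cong[OF cat_trace_subspace[OF g]])
    show "linear_on (smul C) (smul C) (cat_trace C V (act R g)) (\<lambda>\<xi>. val ((phi (s \<otimes>\<^bsub>G\<^esub> g) ?s ** wh [] (phi s g) [rho ?s])
        ** wh [rho s] (mk_cell V V [] [rho g] \<xi>) [rho ?s] ** phi' s ?s ** phi1'))"
      unfolding cat_trace_rho[OF g] by (rule cell_linear[OF pre post]) simp_all
    show "conj_map C G V R s g \<xi> = val ((phi (s \<otimes>\<^bsub>G\<^esub> g) ?s ** wh [] (phi s g) [rho ?s])
        ** wh [rho s] (mk_cell V V [] [rho g] \<xi>) [rho ?s] ** phi' s ?s ** phi1')" if "\<xi> \<in> cat_trace C V (act R g)" for \<xi>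
      using val_conj_cell[OF s g trace_cell(1)[OF g that]] trace_cell(2)[OF g that] by (simp add: conj_cell_def vc_assoc trace_cell_def)
  qed
  show "conj_map C G V R s g \<xi> \<in> cat_trace C V (act R (s \<otimes>\<^bsub>G\<^esub> g \<otimes>\<^bsub>G\<^esub> ?s))" if "\<xi> \<in> cat_trace C V (act R g)"
    using val_conj_cell[OF s g trace_cell(1)[OF g that]] trace_cell(2)[OF g that] tyD(9)[OF conj_cell_ty[OF s g trace_cell(1)[OF g that]]]
    by (simp add: cat_trace_rho)
qed

text \<open>This characterizes the conjugation without inverses, so that it can be verified for a tensor
  product without inverting the structure isomorphisms of the pseudofunctor.\<close>

lemma conj_cell_iff:
  assumes s: "s \<in> carrier G" and g: "g \<in> carrier G" and x: "ty x V V [] [rho g]"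
    and y: "ty y V V [] [rho t]"
  shows "y = conj_cell s g x \<longleftrightarrow> y ** phi1 ** phi s (inv\<^bsub>G\<^esub> s) =
     phi (s \<otimes>\<^bsub>G\<^esub> g) (inv\<^bsub>G\<^esub> s) ** wh [] (phi s g) [rho (inv\<^bsub>G\<^esub> s)] ** wh [rho s] x [rho (inv\<^bsub>G\<^esub> s)]"
proof
  let ?s = "inv\<^bsub>G\<^esub> s"
  note [simp] = s g tyD(1-5)[OF x]
  have s': "?s \<in> carrier G" by simp
  have u: "inv_pair (phi1 ** phi s ?s) (phi' s ?s ** phi1') V V [rho s, rho ?s] []"
    using inv_pair_vc[OF phi_inv[OF s s'], of phi1 phi1' "[]"] phi1_inv by simp
  have t: "ty (phi (s \<otimes>\<^bsub>G\<^esub> g) ?s ** wh [] (phi s g) [rho ?s] ** wh [rho s] x [rho ?s]) V V [rho s, rho ?s] [rho (s \<otimes>\<^bsub>G\<^esub> g \<otimes>\<^bsub>G\<^esub> ?s)]"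
    by (simp add: tys)
  show "y ** phi1 ** phi s ?s = phi (s \<otimes>\<^bsub>G\<^esub> g) ?s ** wh [] (phi s g) [rho ?s] ** wh [rho s] x [rho ?s]" if "y = conj_cell s g x"
  proof -
    have "y ** phi1 ** phi s ?s = (phi (s \<otimes>\<^bsub>G\<^esub> g) ?s ** wh [] (phi s g) [rho ?s] ** wh [rho s] x [rho ?s]) ** ((phi' s ?s ** phi1') ** (phi1 ** phi s ?s))"
      unfolding that conj_cell_def by (simp add: vc_assoc)
    then show ?thesis unfolding inv_pairD(3)[OF u] vc_id_cell_right[OF t] .
  qed
  assume a: "y ** phi1 ** phi s ?s = phi (s \<otimes>\<^bsub>G\<^esub> g) ?s ** wh [] (phi s g) [rho ?s] ** wh [rho s] x [rho ?s]"
  have "y = y ** ((phi1 ** phi s ?s) ** (phi' s ?s ** phi1'))" unfolding inv_pairD(4)[OF u] vc_id_cell_right[OF y] ..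
  also have "\<dots> = (y ** phi1 ** phi s ?s) ** (phi' s ?s ** phi1')" by (simp add: vc_assoc)
  finally show "y = conj_cell s g x" unfolding a conj_cell_def by (simp add: vc_assoc)
qed

end

section \<open>Equivalences of categories\<close>

text \<open>These are stated separately because a record of type \<open>cat\<close> need not satisfy them.\<close>

definition cat_laws :: "('x, 'm) cat \<Rightarrow> bool" where
  "cat_laws A \<longleftrightarrow>
     (\<forall>X\<in>objs A. \<forall>Y\<in>objs A. \<forall>Z\<in>objs A. \<forall>f\<in>mors A X Y. \<forall>g\<in>mors A Y Z. cmp A g f \<in> mors A X Z) \<and>
     (\<forall>X\<in>objs A. \<forall>Y\<in>objs A. \<forall>Z\<in>objs A. \<forall>T\<in>objs A. \<forall>f\<in>mors A X Y. \<forall>g\<in>mors A Y Z. \<forall>h\<in>mors A Z T.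
        cmp A (cmp A h g) f = cmp A h (cmp A g f)) \<and>
     (\<forall>X\<in>objs A. \<forall>Y\<in>objs A. \<forall>f\<in>mors A X Y. cmp A (ids A Y) f = f \<and> cmp A f (ids A X) = f)"

lemma cat_lawsD:
  assumes "cat_laws A" "X \<in> objs A" "Y \<in> objs A" "f \<in> mors A X Y"
  shows "Z \<in> objs A \<Longrightarrow> g \<in> mors A Y Z \<Longrightarrow> cmp A g f \<in> mors A X Z"
    "Z \<in> objs A \<Longrightarrow> T \<in> objs A \<Longrightarrow> g \<in> mors A Y Z \<Longrightarrow> h \<in> mors A Z T \<Longrightarrow>
       cmp A (cmp A h g) f = cmp A h (cmp A g f)"
    "cmp A (ids A Y) f = f" "cmp A f (ids A X) = f"
  using assms unfolding cat_laws_def by blast+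

text \<open>That an equivalence is full and faithful is the usual diagram chase. The categories \<open>A\<close> and
  \<open>B\<close> are only required to be embedded in categories \<open>A'\<close> and \<open>B'\<close> with the same objects and composition but possibly more morphisms; for
  1-morphisms and 2-morphisms this spares the check that equivariance is preserved under
  composition.\<close>

lemma equivalence_full:
  assumes eq: "is_equivalence A B Fo Fm"
    and A: "cat_laws A'" "objs A' = objs A" "cmp A' = cmp A" "ids A' = ids A"
      "\<And>X Y. X \<in> objs A \<Longrightarrow> Y \<in> objs A \<Longrightarrow> mors A X Y \<subseteq> mors A' X Y"
    and B: "cat_laws B'" "objs B' = objs B" "cmp B' = cmp B" "ids B' = ids B"
      "\<And>X Y. X \<in> objs B \<Longrightarrow> Y \<in> objs B \<Longrightarrow> mors B X Y \<subseteq> mors B' X Y"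
    and X: "X \<in> objs A" and Y: "Y \<in> objs A" and XY: "mors A X Y = mors A' X Y"
    and b: "b \<in> mors B (Fo X) (Fo Y)"
  shows "\<exists>f\<in>mors A X Y. Fm X Y f = b"
proof -
  obtain Ho Hm \<eta> \<theta> where F: "is_functor A B Fo Fm" and H: "is_functor B A Ho Hm" and
    \<eta>: "natural_iso A A (\<lambda>X. X) (\<lambda>X Y f. f) (\<lambda>X. Ho (Fo X)) (\<lambda>X Y f. Hm (Fo X) (Fo Y) (Fm X Y f)) \<eta>" and
    \<theta>: "natural_iso B B (\<lambda>X. Fo (Ho X)) (\<lambda>X Y f. Fm (Ho X) (Ho Y) (Hm X Y f)) (\<lambda>X. X) (\<lambda>X Y f. f) \<theta>"
    using eq unfolding is_equivalence_def by blast
  have FX: "Fo X \<in> objs B" "Fo Y \<in> objs B" using F X Y unfolding is_functor_def by blast+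
  have HX: "Ho (Fo X) \<in> objs A" "Ho (Fo Y) \<in> objs A" using H FX unfolding is_functor_def by blast+
  have FHX: "Fo (Ho (Fo X)) \<in> objs B" "Fo (Ho (Fo Y)) \<in> objs B" using F HX unfolding is_functor_def by blast+
  obtain e where ex: "\<eta> X \<in> mors A X (Ho (Fo X))" "e \<in> mors A (Ho (Fo X)) X" "cmp A (\<eta> X) e = ids A (Ho (Fo X))"
    using \<eta> X unfolding natural_iso_def by blast
  obtain e' where ey: "\<eta> Y \<in> mors A Y (Ho (Fo Y))" "e' \<in> mors A (Ho (Fo Y)) Y" "cmp A (\<eta> Y) e' = ids A (Ho (Fo Y))"
    using \<eta> Y unfolding natural_iso_def by blast
  obtain t where tx: "\<theta> (Fo X) \<in> mors B (Fo (Ho (Fo X))) (Fo X)" "t \<in> mors B (Fo X) (Fo (Ho (Fo X)))"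
      "cmp B (\<theta> (Fo X)) t = ids B (Fo X)"
    using \<theta> FX unfolding natural_iso_def by blast
  have Hb: "Hm (Fo X) (Fo Y) b \<in> mors A (Ho (Fo X)) (Ho (Fo Y))"
    using H FX b unfolding is_functor_def by blast
  note lA = cat_lawsD[OF A(1), unfolded A(2-4)]
  note lB = cat_lawsD[OF B(1), unfolded B(2-4)]
  note iA = subsetD[OF A(5)] and iB = subsetD[OF B(5)]
  note hb = iA[OF HX Hb] and hex = iA[OF X HX(1) ex(1)] and hey = iA[OF Y HX(2) ey(1)]
    and he = iA[OF HX(1) X ex(2)] and he' = iA[OF HX(2) Y ey(2)]
  define k where "k = cmp A (Hm (Fo X) (Fo Y) b) (\<eta> X)"
  have k: "k \<in> mors A' X (Ho (Fo Y))" unfolding k_def by (rule lA(1)[OF X HX(1) hex HX(2) hb])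
  define f where "f = cmp A e' k"
  have f: "f \<in> mors A X Y" unfolding f_def XY by (rule lA(1)[OF X HX(2) k Y he'])
  have Ff: "Fm X Y f \<in> mors B (Fo X) (Fo Y)" using F X Y f unfolding is_functor_def by blast
  have HFf: "Hm (Fo X) (Fo Y) (Fm X Y f) \<in> mors A (Ho (Fo X)) (Ho (Fo Y))"
    using H FX Ff unfolding is_functor_def by blast
  have "cmp A (\<eta> Y) f = cmp A (cmp A (\<eta> Y) e') k"
    unfolding f_def by (rule lA(2)[OF X HX(2) k Y HX(2) he' hey, symmetric])
  also have "\<dots> = k" unfolding ey(3) by (rule lA(3)[OF X HX(2) k])
  finally have 1: "cmp A (Hm (Fo X) (Fo Y) (Fm X Y f)) (\<eta> X) = cmp A (Hm (Fo X) (Fo Y) b) (\<eta> X)"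
    using \<eta> X Y f unfolding natural_iso_def k_def by simp
  have "Hm (Fo X) (Fo Y) c = cmp A (cmp A (Hm (Fo X) (Fo Y) c) (\<eta> X)) e"
    if "c \<in> mors B (Fo X) (Fo Y)" for c
  proof -
    have "Hm (Fo X) (Fo Y) c \<in> mors A (Ho (Fo X)) (Ho (Fo Y))"
      using H FX that unfolding is_functor_def by blast
    then have hc: "Hm (Fo X) (Fo Y) c \<in> mors A' (Ho (Fo X)) (Ho (Fo Y))" by (rule iA[OF HX])
    show ?thesis
      using lA(2)[OF HX(1) X he HX(1) HX(2) hex hc] lA(4)[OF HX hc] ex(3) by simp
  qed
  then have 2: "Hm (Fo X) (Fo Y) (Fm X Y f) = Hm (Fo X) (Fo Y) b"
    using 1 Ff b by metis
  have "c = cmp B (cmp B (\<theta> (Fo Y)) (Fm (Ho (Fo X)) (Ho (Fo Y)) (Hm (Fo X) (Fo Y) c))) t"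
    if "c \<in> mors B (Fo X) (Fo Y)" for c
  proof -
    have "cmp B (\<theta> (Fo Y)) (Fm (Ho (Fo X)) (Ho (Fo Y)) (Hm (Fo X) (Fo Y) c)) = cmp B c (\<theta> (Fo X))"
      using \<theta> FX that unfolding natural_iso_def by blast
    moreover have "cmp B (cmp B c (\<theta> (Fo X))) t = cmp B c (cmp B (\<theta> (Fo X)) t)"
      by (rule lB(2)[OF FX(1) FHX(1) iB[OF FX(1) FHX(1) tx(2)] FX iB[OF FHX(1) FX(1) tx(1)] iB[OF FX that]])
    ultimately show ?thesis using tx(3) lB(4)[OF FX iB[OF FX that]] by simp
  qed
  then have "Fm X Y f = b" using 2 Ff b by metis
  then show ?thesis using f by blast
qed

lemma equivalence_faithful:
  assumes eq: "is_equivalence A B Fo Fm"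
    and A: "cat_laws A'" "objs A' = objs A" "cmp A' = cmp A" "ids A' = ids A"
      "\<And>X Y. X \<in> objs A \<Longrightarrow> Y \<in> objs A \<Longrightarrow> mors A X Y \<subseteq> mors A' X Y"
    and X: "X \<in> objs A" and Y: "Y \<in> objs A"
    and f: "f \<in> mors A X Y" and g: "g \<in> mors A X Y" and fg: "Fm X Y f = Fm X Y g"
  shows "f = g"
proof -
  obtain Ho Hm \<eta> where F: "is_functor A B Fo Fm" and H: "is_functor B A Ho Hm" and
    \<eta>: "natural_iso A A (\<lambda>X. X) (\<lambda>X Y f. f) (\<lambda>X. Ho (Fo X)) (\<lambda>X Y f. Hm (Fo X) (Fo Y) (Fm X Y f)) \<eta>"
    using eq unfolding is_equivalence_def by blast
  have HY: "Ho (Fo Y) \<in> objs A" using H F Y unfolding is_functor_def by blast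
  obtain e' where ey: "\<eta> Y \<in> mors A Y (Ho (Fo Y))" "e' \<in> mors A (Ho (Fo Y)) Y" "cmp A e' (\<eta> Y) = ids A Y"
    using \<eta> Y unfolding natural_iso_def by blast
  note lA = cat_lawsD[OF A(1), unfolded A(2-4)]
  note iA = subsetD[OF A(5)]
  have "c = cmp A e' (cmp A (Hm (Fo X) (Fo Y) (Fm X Y c)) (\<eta> X))" if c: "c \<in> mors A X Y" for c
  proof -
    have "cmp A (\<eta> Y) c = cmp A (Hm (Fo X) (Fo Y) (Fm X Y c)) (\<eta> X)"
      using \<eta> X Y c unfolding natural_iso_def by blast
    moreover have "cmp A (cmp A e' (\<eta> Y)) c = cmp A e' (cmp A (\<eta> Y) c)"
      by (rule lA(2)[OF X Y iA[OF X Y c] HY Y iA[OF Y HY ey(1)] iA[OF HY Y ey(2)]])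
    ultimately show ?thesis using ey(3) lA(3)[OF X Y iA[OF X Y c]] by simp
  qed
  then show ?thesis using f g fg by metis
qed

lemma equivalence_dense:
  assumes eq: "is_equivalence A B Fo Fm" and Y: "Y \<in> objs B"
  shows "\<exists>X\<in>objs A. \<exists>t\<in>mors B (Fo X) Y. \<exists>t'\<in>mors B Y (Fo X). cmp B t' t = ids B (Fo X) \<and> cmp B t t' = ids B Y"
proof -
  obtain Ho Hm \<theta> where H: "is_functor B A Ho Hm" and
    \<theta>: "natural_iso B B (\<lambda>X. Fo (Ho X)) (\<lambda>X Y f. Fm (Ho X) (Ho Y) (Hm X Y f)) (\<lambda>X. X) (\<lambda>X Y f. f) \<theta>"
    using eq unfolding is_equivalence_def by blast
  have "Ho Y \<in> objs A" using H Y unfolding is_functor_def by blast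
  then show ?thesis using \<theta> Y unfolding natural_iso_def by blast
qed

context klinear_2category
begin

lemma cat_laws_hom2:
  assumes "\<And>X. X \<in> Ob \<Longrightarrow> u X \<in> hom1 C V W"
  shows "cat_laws \<lparr> objs = Ob, mors = \<lambda>X Y. hom2 C (u X) (u Y), ids = \<lambda>X. id2 C (u X), cmp = vcomp C \<rparr>"
  unfolding cat_laws_def cat.simps
proof (intro conjI ballI)
  show "g \<bullet> f \<in> hom2 C (u X) (u Z)"
    if "X \<in> Ob" "Y \<in> Ob" "Z \<in> Ob" "f \<in> hom2 C (u X) (u Y)" "g \<in> hom2 C (u Y) (u Z)" for X Y Z f g
    by (rule vcomp_closed[OF assms[OF that(1)] assms[OF that(2)] assms[OF that(3)] that(4,5)])
  show "(h \<bullet> g) \<bullet> f = h \<bullet> (g \<bullet> f)"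
    if "X \<in> Ob" "Y \<in> Ob" "Z \<in> Ob" "T \<in> Ob" "f \<in> hom2 C (u X) (u Y)" "g \<in> hom2 C (u Y) (u Z)"
      "h \<in> hom2 C (u Z) (u T)" for X Y Z T f g h
    by (rule vcomp_assoc[OF assms[OF that(1)] assms[OF that(2)] assms[OF that(3)] assms[OF that(4)] that(5-7)])
  show "id2 C (u Y) \<bullet> f = f" "f \<bullet> id2 C (u X) = f"
    if "X \<in> Ob" "Y \<in> Ob" "f \<in> hom2 C (u X) (u Y)" for X Y f
    by (rule vcomp_id_left[OF assms[OF that(1)] assms[OF that(2)] that(3)],
        rule vcomp_id_right[OF assms[OF that(1)] assms[OF that(2)] that(3)])
qed

end

section \<open>The universal property of invariants\<close>

locale invariant_cells = rep_cells C G V R + S: rep_cells C G X S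
  for C :: "('k::field, 'o, 'a, 'm::ab_group_add, 'z) two_cat_scheme" (structure)
    and G :: "('g, 'y) monoid_scheme" and V :: 'o and R :: "('g, 'a, 'm) rep2"
    and X :: 'o and S :: "('g, 'a, 'm) rep2" +
  fixes \<epsilon> \<tau> :: "'g \<Rightarrow> 'm" and U :: 'a
  assumes inv: "is_invariants C G V R X S \<epsilon> U \<tau>"
begin

lemma invD:
  shows eps_trivialization: "is_trivialization C G X S X S (id1 C X) (\<lambda>g. id2 C (act S g)) \<epsilon>"
    and U_flip: "is_flip C G X S V R U \<tau>"
    and equiv: "is_equivalence (Hom_G C G W (triv_rep W) X S) (Hom_G_triv C G W (triv_rep W) V R)
          (post_comp C S \<epsilon> R U \<tau>) (\<lambda>_ _ \<alpha>. U \<triangleright> \<alpha>)"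
  using inv triv_rep_two_representation unfolding is_invariants_def by blast+

definition ua :: "('o, 'a) arrow" where "ua = (X, V, U)"

lemma U_closed: "U \<in> hom1 C X V"
  using U_flip by (simp add: is_flip_def)

lemma path_ua [simp]: "path A B (ua # p) \<longleftrightarrow> B = V \<and> path A X p"
  using U_closed by (auto simp: ua_def)

lemma pdom_ua [simp]: "pdom B (ua # p) = pdom X p" and pcod_ua [simp]: "pcod B (ua # p) = V"
  and pcomp_ua [simp]: "pcomp A (ua # p) = U \<cdot> pcomp A p"
  by (simp_all add: ua_def)

lemma U_id1 [simp]: "U \<cdot> id1 C X = U"
  by (rule comp1_id_right[OF U_closed])

definition eps :: "'g \<Rightarrow> ('o, 'a, 'm) cell" where
  "eps g = mk_cell X X [] [S.rho g] (\<epsilon> g)"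

definition eps' :: "'g \<Rightarrow> ('o, 'a, 'm) cell" where
  "eps' g = mk_cell X X [S.rho g] [] (inv2 C (id1 C X) (act S g) (\<epsilon> g))"

definition flip :: "'g \<Rightarrow> ('o, 'a, 'm) cell" where
  "flip g = mk_cell X V [rho g, ua] [ua, S.rho g] (\<tau> g)"

definition flip' :: "'g \<Rightarrow> ('o, 'a, 'm) cell" where
  "flip' g = mk_cell X V [ua, S.rho g] [rho g, ua] (inv2 C (act R g \<cdot> U) (U \<cdot> act S g) (\<tau> g))"

text \<open>The trivialization that \<open>post_comp\<close> puts on \<open>U\<close>, taken as the image of the identity of \<open>X\<close>, is
  \<open>triv_U\<close>; its inverse \<open>act_U\<close> is the action of \<open>R\<close> on \<open>U\<close>.\<close>

definition act_U :: "'g \<Rightarrow> ('o, 'a, 'm) cell" where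
  "act_U g = wh [ua] (eps' g) [] ** flip g"

definition triv_U :: "'g \<Rightarrow> ('o, 'a, 'm) cell" where
  "triv_U g = flip' g ** wh [ua] (eps g) []"

lemma eps_inv: "g \<in> carrier G \<Longrightarrow> inv_pair (eps g) (eps' g) X X [] [S.rho g]"
  using inv_pair_iso2[of X X "[]" "[S.rho g]" "\<epsilon> g"] eps_trivialization S.act_id1[of g] unfolding is_trivialization_def
  by (simp add: eps_def eps'_def)

lemma val_eps: "g \<in> carrier G \<Longrightarrow> val (eps g) = \<epsilon> g"
  using val_mk_cell[of X X "[]" "[S.rho g]" "\<epsilon> g"] eps_trivialization S.act_id1[of g] unfolding is_trivialization_def
  by (simp add: eps_def iso2_def)

lemma flip_inv: "g \<in> carrier G \<Longrightarrow> inv_pair (flip g) (flip' g) X V [rho g, ua] [ua, S.rho g]"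
  using inv_pair_iso2[of X V "[rho g, ua]" "[ua, S.rho g]" "\<tau> g"] U_flip unfolding is_flip_def
  by (simp add: flip_def flip'_def)

lemma val_flip: "g \<in> carrier G \<Longrightarrow> val (flip g) = \<tau> g"
  using val_mk_cell[of X V "[rho g, ua]" "[ua, S.rho g]" "\<tau> g"] U_flip unfolding is_flip_def
  by (simp add: flip_def iso2_def)

lemma val_flip': "g \<in> carrier G \<Longrightarrow> val (flip' g) = inv2 C (act R g \<cdot> U) (U \<cdot> act S g) (\<tau> g)"
  using inv_pair_val(3)[OF flip_inv[of g]] by (simp add: val_flip)

lemma act_U_inv: "g \<in> carrier G \<Longrightarrow> inv_pair (act_U g) (triv_U g) X V [rho g, ua] [ua]"
  using inv_pair_vc[OF flip_inv, of g "wh [ua] (eps' g) []" "wh [ua] (eps g) []" "[ua]"]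
    inv_pair_wh[OF inv_pair_sym[OF eps_inv], of g X "[]" V "[ua]"]
  by (simp add: act_U_def triv_U_def)

lemma eps'_action: "S.action X [] eps' eps"
  by (rule S.trivialization_action[where \<tau>="\<lambda>g. id2 C (act S g)", OF _ _ _ val_eps])
    (use eps_trivialization inv_pair_sym[OF eps_inv] in simp_all)

lemma eps'_action_wh: "path W X f \<Longrightarrow> S.action W f (\<lambda>g. wh [] (eps' g) f) (\<lambda>g. wh [] (eps g) f)"
  using S.action_wh[OF eps'_action] by simp

text \<open>The canonical flips of a 1-morphism to \<open>X\<close> from an object with the trivial 2-representation. They come
from the trivialization of the identity of \<open>X\<close>.\<close>

definition canonical :: "'o \<Rightarrow> ('o, 'a) arrow list \<Rightarrow> 'a \<times> ('g \<Rightarrow> 'm)" where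
  "canonical W f = (pcomp W f, \<lambda>g. val (wh [] (eps' g) f))"

lemma canonical: "path W X f \<Longrightarrow> canonical W f \<in> objs (Hom_G C G W (triv_rep W) X S)"
  using S.action_flip[OF eps'_action_wh] by (simp add: Hom_G_def canonical_def)

lemma post_comp_triv:
  assumes "path W X f" "g \<in> carrier G"
  shows "(inv2 C (act R g \<cdot> U) (U \<cdot> act S g) (\<tau> g) \<triangleleft> pcomp W f) \<bullet> (U \<triangleright> \<epsilon> g \<triangleleft> pcomp W f) = val (wh [] (triv_U g) f)"
proof -
  note [simp] = assms(1) tyD(1-5)[OF inv_pairD(1)[OF eps_inv]] tyD(1-5)[OF inv_pairD(2)[OF flip_inv]] path_pdom[OF assms(1)]
  have "val (wh [] (flip' g) f) = inv2 C (act R g \<cdot> U) (U \<cdot> act S g) (\<tau> g) \<triangleleft> pcomp W f"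
    using val_wh_right[OF inv_pairD(2)[OF flip_inv] assms(1)] assms(2) val_flip' by simp
  moreover have "val (wh [ua] (eps g) f) = U \<triangleright> \<epsilon> g \<triangleleft> pcomp W f"
    using val_wh[OF inv_pairD(1)[OF eps_inv] assms(1), of g V "[ua]"] assms(2) val_eps by simp
  ultimately show ?thesis
    using assms(2) by (simp add: triv_U_def wh_vc wh_wh vc_sel wh_sel(1-4))
qed

lemma post_comp_flip:
  assumes "path W X f" "g \<in> carrier G"
  shows "(U \<triangleright> val (wh [] (eps' g) f)) \<bullet> (\<tau> g \<triangleleft> pcomp W f) = val (wh [] (act_U g) f)"
proof -
  note [simp] = assms(1) tyD(1-5)[OF inv_pairD(2)[OF eps_inv]] tyD(1-5)[OF inv_pairD(1)[OF flip_inv]] path_pdom[OF assms(1)]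
  have "val (wh [] (flip g) f) = \<tau> g \<triangleleft> pcomp W f"
    using val_wh_right[OF inv_pairD(1)[OF flip_inv] assms(1)] assms(2) val_flip by simp
  moreover have "val (wh [ua] (wh [] (eps' g) f) []) = U \<triangleright> val (wh [] (eps' g) f)"
    using val_wh_left[OF S.actionD(5)[OF eps'_action_wh[OF assms(1)]], of g V "[ua]"] assms(2) by simp
  ultimately show ?thesis
    using assms(2) by (simp add: act_U_def wh_vc wh_wh vc_sel wh_sel(1-4))
qed

text \<open>The identity of \<open>X\<close> with its canonical flips is an equivariant 1-morphism, so the functor of the
universal property maps it to a trivialized one.\<close>

lemma act_U_action: "action X [ua] act_U triv_U"
proof -
  have "post_comp C S \<epsilon> R U \<tau> (canonical X []) \<in> objs (Hom_G_triv C G X (triv_rep X) V R)"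
    using equiv[of X] canonical[of X "[]"] unfolding is_equivalence_def is_functor_def by simp
  then obtain \<tau>' where "is_trivialization C G X (triv_rep X) V R (U \<cdot> id1 C X) \<tau>'
      (\<lambda>g. (inv2 C (act R g \<cdot> U) (U \<cdot> act S g) (\<tau> g) \<triangleleft> id1 C X) \<bullet> (U \<triangleright> \<epsilon> g \<triangleleft> id1 C X))"
    by (auto simp: post_comp_def canonical_def Hom_G_triv_def)
  moreover have "is_trivialization C G X (triv_rep X) V R F \<tau>' e \<Longrightarrow> (\<And>g. g \<in> carrier G \<Longrightarrow> e g = e' g) \<Longrightarrow>
    is_trivialization C G X (triv_rep X) V R F \<tau>' e'" for F e e'
    unfolding is_trivialization_def by (simp add: Let_def)
  moreover have "(inv2 C (act R g \<cdot> U) (U \<cdot> act S g) (\<tau> g) \<triangleleft> id1 C X) \<bullet> (U \<triangleright> \<epsilon> g \<triangleleft> id1 C X) = val (triv_U g)"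
    if "g \<in> carrier G" for g
    using post_comp_triv[of X "[]" g] that wh_nil[OF tyD(6)[OF inv_pairD(2)[OF act_U_inv[OF that]]]] by simp
  ultimately have "is_trivialization C G X (triv_rep X) V R (pcomp X [ua]) \<tau>' (\<lambda>g. val (triv_U g))"
    by simp
  then show ?thesis by (rule trivialization_action[OF _ _ _ refl, rotated 2]) (simp_all add: act_U_inv)
qed

lemma act_U_action_wh: "path W X f \<Longrightarrow> action W (ua # f) (\<lambda>g. wh [] (act_U g) f) (\<lambda>g. wh [] (triv_U g) f)"
  using action_wh[OF act_U_action] by simp

text \<open>The canonical flips only involve the part of the path at \<open>X\<close> that \<open>b\<close> does not touch.\<close>

lemma natural_equivariant:
  assumes b: "ty b W X f f'"
  shows "S.equivariant b (\<lambda>g. wh [] (eps' g) f) (\<lambda>g. wh [] (eps' g) f')"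
  unfolding S.equivariant_def
proof
  fix g assume "g \<in> carrier G"
  then show "b ** wh [] (eps' g) f = wh [] (eps' g) f' ** wh [S.rho g] b []"
    using exchange[OF inv_pairD(2)[OF eps_inv] b, of g "[]" "[]" "[]"] wh_nil[OF tyD(6)[OF b]] by simp
qed

text \<open>The same objects with all 2-morphisms between them, as needed for \<open>equivalence_full\<close>.\<close>

definition all_cat :: "'o \<Rightarrow> ('a \<times> ('g \<Rightarrow> 'm), 'm) cat" where
  "all_cat W = \<lparr> objs = objs (Hom_G C G W (triv_rep W) X S), mors = \<lambda>X Y. hom2 C (fst X) (fst Y),
     ids = \<lambda>X. id2 C (fst X), cmp = vcomp C \<rparr>"

definition all_cat_triv :: "'o \<Rightarrow> ('a \<times> ('g \<Rightarrow> 'm) \<times> ('g \<Rightarrow> 'm), 'm) cat" where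
  "all_cat_triv W = \<lparr> objs = objs (Hom_G_triv C G W (triv_rep W) V R), mors = \<lambda>X Y. hom2 C (fst X) (fst Y),
     ids = \<lambda>X. id2 C (fst X), cmp = vcomp C \<rparr>"

lemma all_cat:
  shows "cat_laws (all_cat W)" "objs (all_cat W) = objs (Hom_G C G W (triv_rep W) X S)"
    "cmp (all_cat W) = cmp (Hom_G C G W (triv_rep W) X S)" "ids (all_cat W) = ids (Hom_G C G W (triv_rep W) X S)"
    "mors (Hom_G C G W (triv_rep W) X S) Y Z \<subseteq> mors (all_cat W) Y Z"
  unfolding all_cat_def
  by (rule cat_laws_hom2[where V=W and W=X]) (auto simp: Hom_G_def is_flip_def split: prod.splits)

lemma all_cat_triv:
  shows "cat_laws (all_cat_triv W)" "objs (all_cat_triv W) = objs (Hom_G_triv C G W (triv_rep W) V R)"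
    "cmp (all_cat_triv W) = cmp (Hom_G_triv C G W (triv_rep W) V R)" "ids (all_cat_triv W) = ids (Hom_G_triv C G W (triv_rep W) V R)"
    "mors (Hom_G_triv C G W (triv_rep W) V R) Y Z \<subseteq> mors (all_cat_triv W) Y Z"
  unfolding all_cat_triv_def
  by (rule cat_laws_hom2[where V=W and W=V]) (auto simp: Hom_G_triv_def is_flip_def split: prod.splits)

lemma canonical_mors:
  assumes f: "path W X f" "path W X f'"
  shows "mors (Hom_G C G W (triv_rep W) X S) (canonical W f) (canonical W f') = hom2 C (pcomp W f) (pcomp W f')"
proof -
  have "commutes_flips C G (triv_rep W) S (\<lambda>g. val (wh [] (eps' g) f)) (\<lambda>g. val (wh [] (eps' g) f')) \<alpha>"
    if "\<alpha> \<in> hom2 C (pcomp W f) (pcomp W f')" for \<alpha>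
  proof -
    have t: "ty (mk_cell W X f f' \<alpha>) W X f f'" and v: "val (mk_cell W X f f' \<alpha>) = \<alpha>"
      using ty_mk_cell[OF f that] val_mk_cell[OF f that] by auto
    show ?thesis
      using S.commutes_flips_iff[OF eps'_action_wh[OF f(1)] eps'_action_wh[OF f(2)] t refl refl]
        natural_equivariant[OF t] v by simp
  qed
  then show ?thesis by (auto simp: Hom_G_def canonical_def)
qed

text \<open>Over a test object with the trivial 2-representation, every 1-morphism to \<open>X\<close> is canonically
  equivariant and so is every 2-morphism between such. Full faithfulness therefore identifies the
  2-morphisms \<open>F \<Rightarrow> F'\<close> with the equivariant 2-morphisms \<open>U F \<Rightarrow> U F'\<close>.\<close>

lemma lift_equivariant:
  assumes f: "path W X f" "path W X f'" and b: "ty b W V (ua # f) (ua # f')"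
    and eq: "equivariant b (\<lambda>g. wh [] (act_U g) f) (\<lambda>g. wh [] (act_U g) f')"
  shows "\<exists>c. ty c W X f f' \<and> b = wh [ua] c []"
proof -
  note a = act_U_action_wh[OF f(1)] act_U_action_wh[OF f(2)]
  have p: "post_comp C S \<epsilon> R U \<tau> (canonical W k) = (U \<cdot> pcomp W k,
      \<lambda>g. (U \<triangleright> val (wh [] (eps' g) k)) \<bullet> (\<tau> g \<triangleleft> pcomp W k),
      \<lambda>g. (inv2 C (act R g \<cdot> U) (U \<cdot> act S g) (\<tau> g) \<triangleleft> pcomp W k) \<bullet> (U \<triangleright> \<epsilon> g \<triangleleft> pcomp W k))" for k
    by (simp add: post_comp_def canonical_def)
  have "val b \<in> mors (Hom_G_triv C G W (triv_rep W) V R) (post_comp C S \<epsilon> R U \<tau> (canonical W f)) (post_comp C S \<epsilon> R U \<tau> (canonical W f'))"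
    unfolding p
    using commutes_flips_iff[OF a b post_comp_flip[OF f(1)] post_comp_flip[OF f(2)]]
      commutes_triv_iff[OF a b post_comp_triv[OF f(1)] post_comp_triv[OF f(2)]] eq tyD(9)[OF b]
    by (simp add: Hom_G_triv_def)
  then obtain \<alpha> where \<alpha>: "\<alpha> \<in> hom2 C (pcomp W f) (pcomp W f')" "U \<triangleright> \<alpha> = val b"
    using equivalence_full[OF equiv[of W] all_cat all_cat_triv canonical[OF f(1)] canonical[OF f(2)], of "val b"] canonical_mors[OF f]
    by (auto simp: all_cat_def canonical_def)
  have t: "ty (mk_cell W X f f' \<alpha>) W X f f'" and v: "val (mk_cell W X f f' \<alpha>) = \<alpha>"
    using ty_mk_cell[OF f \<alpha>(1)] val_mk_cell[OF f \<alpha>(1)] by auto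
  have "b = wh [ua] (mk_cell W X f f' \<alpha>) []"
    by (rule ty_eqI[OF b]) (use ty_wh[OF t, of W "[]" V "[ua]"] val_wh_left[OF t, of V "[ua]"] v \<alpha>(2) in simp_all)
  then show ?thesis using t by blast
qed

lemma U_faithful:
  assumes f: "path W X f" "path W X f'" and c: "c \<in> hom2 C (pcomp W f) (pcomp W f')" "d \<in> hom2 C (pcomp W f) (pcomp W f')"
    and eq: "U \<triangleright> c = U \<triangleright> d"
  shows "c = d"
  by (rule equivalence_faithful[OF equiv[of W] all_cat canonical[OF f(1)] canonical[OF f(2)]])
    (use c eq canonical_mors[OF f] in auto)

text \<open>An action on a 1-morphism makes it a trivialized 1-morphism over the trivial
  2-representation, to which essential surjectivity applies.\<close>

lemma action_factors:
  assumes a: "action W f m e"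
  shows "\<exists>l th th'. path W X [l] \<and> inv_pair th th' W V [ua, l] f \<and> equivariant th (\<lambda>g. wh [] (act_U g) [l]) m"
proof -
  note d = actionD[OF a]
  let ?B = "Hom_G_triv C G W (triv_rep W) V R"
  let ?Y = "(pcomp W f, \<lambda>g. val (m g), \<lambda>g. val (e g))"
  have "?Y \<in> objs ?B"
    using action_flip[OF a] action_trivialization[OF a] by (simp add: Hom_G_triv_def)
  then obtain Z t t' where Z: "Z \<in> objs (Hom_G C G W (triv_rep W) X S)"
    and t: "t \<in> mors ?B (post_comp C S \<epsilon> R U \<tau> Z) ?Y" and t': "t' \<in> mors ?B ?Y (post_comp C S \<epsilon> R U \<tau> Z)"
    and i: "cmp ?B t' t = ids ?B (post_comp C S \<epsilon> R U \<tau> Z)" "cmp ?B t t' = ids ?B ?Y"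
    using equivalence_dense[OF equiv[of W]] by blast
  obtain L \<sigma> where ZL: "Z = (L, \<sigma>)" by (cases Z)
  have L: "L \<in> hom1 C W X" using Z ZL by (simp add: Hom_G_def is_flip_def)
  let ?l = "(W, X, L)"
  have pl: "path W X [?l]" "pcomp W [?l] = L" "path W V [ua, ?l]" "pcomp W [ua, ?l] = U \<cdot> L"
    using L comp1_id_right[OF L] by simp_all
  have th: "t \<in> hom2 C (U \<cdot> L) (pcomp W f)" "inverse2 C (U \<cdot> L) (pcomp W f) t t'"
    using t t' i ZL by (simp_all add: Hom_G_triv_def post_comp_def inverse2_def)
  define T where "T = mk_cell W V [ua, ?l] f t"
  have T: "inv_pair T (mk_cell W V f [ua, ?l] t') W V [ua, ?l] f"
    unfolding T_def by (rule inv_pair_mk_cell[OF pl(3) d(1)]) (use th pl in simp_all)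
  have vT: "val T = t" unfolding T_def by (rule val_mk_cell[OF pl(3) d(1)]) (use th pl in simp)
  have "commutes_triv C G R
      (\<lambda>g. (inv2 C (act R g \<cdot> U) (U \<cdot> act S g) (\<tau> g) \<triangleleft> pcomp W [?l]) \<bullet> (U \<triangleright> \<epsilon> g \<triangleleft> pcomp W [?l]))
      (\<lambda>g. val (e g)) (val T)"
    using t unfolding ZL vT pl(2) by (simp add: Hom_G_triv_def post_comp_def)
  then have "equivariant T (\<lambda>g. wh [] (act_U g) [?l]) m"
    using commutes_triv_iff[OF act_U_action_wh[OF pl(1)] a inv_pairD(1)[OF T] post_comp_triv[OF pl(1)] refl] by blast
  then show ?thesis using T pl(1) by blast
qed

end

section \<open>Endomorphisms of the universal 1-morphism\<close>

context invariant_cells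
begin

lemmas act_U_ty = inv_pairD(1)[OF act_U_inv] and triv_U_ty = inv_pairD(2)[OF act_U_inv]

lemma act_U_mult: "g \<in> carrier G \<Longrightarrow> h \<in> carrier G \<Longrightarrow>
    act_U (g \<otimes>\<^bsub>G\<^esub> h) ** wh [] (phi g h) [ua] = act_U g ** wh [rho g] (act_U h) []"
  and act_U_one: "act_U \<one>\<^bsub>G\<^esub> = wh [] phi1 [ua]"
  using actionD(3,4)[OF act_U_action] by auto

lemmas [simp] = tyD(1-6)[OF act_U_ty] tyD(1-6)[OF triv_U_ty]

lemma wh_nil_act_U [simp]: "g \<in> carrier G \<Longrightarrow> wh [] (act_U g) [] = act_U g"
  by (rule wh_nil) simp

definition Phi :: "'g \<Rightarrow> ('o, 'a, 'm) cell \<Rightarrow> ('o, 'a, 'm) cell" where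
  "Phi g x = act_U g ** wh [] x [ua]"

definition Act :: "'g \<Rightarrow> ('o, 'a, 'm) cell \<Rightarrow> ('o, 'a, 'm) cell" where
  "Act s b = act_U s ** wh [rho s] b [] ** triv_U s"

lemma Phi_ty: "g \<in> carrier G \<Longrightarrow> ty x V V [] [rho g] \<Longrightarrow> ty (Phi g x) X V [ua] [ua]"
  unfolding Phi_def using ty_vc[OF ty_wh[of x V V "[]" "[rho g]" X "[ua]" V "[]"] ] act_U_ty by fastforce

lemma Act_ty: "s \<in> carrier G \<Longrightarrow> ty b X V [ua] [ua] \<Longrightarrow> ty (Act s b) X V [ua] [ua]"
  unfolding Act_def
  by (rule ty_vc[OF ty_vc[OF triv_U_ty _] act_U_ty])
    (use ty_wh[of b X V "[ua]" "[ua]" X "[]" V "[rho s]"] in simp_all)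

lemma triv_U_mult: "s \<in> carrier G \<Longrightarrow> t \<in> carrier G \<Longrightarrow>
    wh [] (phi s t) [ua] ** wh [rho s] (triv_U t) [] ** triv_U s = triv_U (s \<otimes>\<^bsub>G\<^esub> t)"
  using action_triv[OF act_U_action] by simp

lemma Act_Act:
  assumes s: "s \<in> carrier G" and t: "t \<in> carrier G" and b: "ty b X V [ua] [ua]"
  shows "Act s (Act t b) = Act (s \<otimes>\<^bsub>G\<^esub> t) b"
proof -
  have "Act s (Act t b) = (act_U s ** wh [rho s] (act_U t) []) ** wh [rho s, rho t] b [] ** wh [rho s] (triv_U t) [] ** triv_U s"
    unfolding Act_def by (simp add: wh_vc wh_wh vc_assoc)
  also have "\<dots> = act_U (s \<otimes>\<^bsub>G\<^esub> t) ** (wh [] (phi s t) [ua] ** wh [rho s, rho t] b []) ** wh [rho s] (triv_U t) [] ** triv_U s"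
    unfolding act_U_mult[OF s t, symmetric] by (simp add: vc_assoc)
  also have "wh [] (phi s t) [ua] ** wh [rho s, rho t] b [] = wh [rho (s \<otimes>\<^bsub>G\<^esub> t)] b [] ** wh [] (phi s t) [ua]"
    using exchange[OF phi_ty[OF s t] b, of "[]" "[]" "[]"] by simp
  finally show ?thesis unfolding Act_def triv_U_mult[OF s t, symmetric] by (simp add: vc_assoc)
qed

lemma Act_fixed:
  assumes s: "s \<in> carrier G" and b: "ty b X V [ua] [ua]"
  shows "Act s b = b \<longleftrightarrow> b ** act_U s = act_U s ** wh [rho s] b []"
proof
  have w: "ty (act_U s ** wh [rho s] b []) X V [rho s, ua] [ua]"
    using ty_vc[OF ty_wh[OF b, of X "[]" V "[rho s]"], of "act_U s" "[ua]"] s act_U_ty[OF s] by simp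
  assume "Act s b = b"
  then have "b ** act_U s = (act_U s ** wh [rho s] b []) ** triv_U s ** act_U s"
    unfolding Act_def by (metis vc_assoc)
  then show "b ** act_U s = act_U s ** wh [rho s] b []"
    using inv_pairD(3)[OF act_U_inv[OF s]] vc_id_cell_right[OF w] by simp
next
  assume "b ** act_U s = act_U s ** wh [rho s] b []"
  then have "Act s b = b ** act_U s ** triv_U s" unfolding Act_def by (metis vc_assoc)
  then show "Act s b = b" using inv_pairD(4)[OF act_U_inv[OF s]] vc_id_cell_right[OF b] by simp
qed

text \<open>As \<open>act_U s\<close> after \<open>s (act_U s\<inverse>)\<close> is the action of the neutral element, the inverse of \<open>act_U s\<close> is
given by the action of \<open>s\<inverse>\<close>.\<close>

lemma triv_U_as_inverse_element:
  assumes s: "s \<in> carrier G"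
  shows "wh [rho s] (act_U (inv\<^bsub>G\<^esub> s)) [] ** wh [] (phi' s (inv\<^bsub>G\<^esub> s)) [ua] ** wh [] phi1' [ua] = triv_U s"
proof -
  let ?s = "inv\<^bsub>G\<^esub> s"
  have s' [simp]: "?s \<in> carrier G" using s by simp
  note [simp] = s
  have t: "ty (wh [rho s] (act_U ?s) [] ** wh [] (phi' s ?s) [ua] ** wh [] phi1' [ua]) X V [ua] [rho s, ua]"
    by (simp add: tys)
  have pu: "ty (wh [] phi1' [ua]) X V [ua] [rho \<one>\<^bsub>G\<^esub>, ua]" using ty_wh[OF phi1'_ty, of X "[ua]" V "[]"] by simp
  have "wh [rho s] (act_U ?s) [] ** wh [] (phi' s ?s) [ua] ** wh [] phi1' [ua]
      = triv_U s ** (act_U s ** wh [rho s] (act_U ?s) []) ** wh [] (phi' s ?s) [ua] ** wh [] phi1' [ua]"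
    using inv_pair_cancel[OF inv_pair_sym[OF act_U_inv[OF s]] t] by (simp add: vc_assoc)
  also have "\<dots> = triv_U s ** act_U \<one>\<^bsub>G\<^esub> ** (wh [] (phi s ?s) [ua] ** wh [] (phi' s ?s) [ua] ** wh [] phi1' [ua])"
    unfolding act_U_mult[OF s s', symmetric] by (simp add: vc_assoc)
  also have "wh [] (phi s ?s) [ua] ** wh [] (phi' s ?s) [ua] ** wh [] phi1' [ua] = wh [] phi1' [ua]"
    using inv_pair_cancel[OF inv_pair_wh[OF phi_inv[OF s s'], of X "[ua]" V "[]"], of "wh [] phi1' [ua]"] pu by simp
  also have "act_U \<one>\<^bsub>G\<^esub> ** wh [] phi1' [ua] = id_cell X V [ua]"
    unfolding act_U_one using inv_pairD(4)[OF inv_pair_wh[OF phi1_inv, of X "[ua]" V "[]"]] by simp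
  finally show ?thesis using vc_id_cell_right[OF triv_U_ty[OF s]] by simp
qed

text \<open>In the conjugated trace element, the outer factor \<open>s\<inverse>\<close> is absorbed by \<open>act_U\<close>. The exchange law
slides the cell \<open>act_U s\<inverse>\<close> down past the multiplication and past \<open>x\<close>, where it becomes the inverse of
\<open>act_U s\<close>.\<close>

lemma Act_Phi:
  assumes s: "s \<in> carrier G" and g: "g \<in> carrier G" and x: "ty x V V [] [rho g]"
  shows "Act s (Phi g x) = Phi (s \<otimes>\<^bsub>G\<^esub> g \<otimes>\<^bsub>G\<^esub> inv\<^bsub>G\<^esub> s) (conj_cell s g x)"
proof -
  let ?s = "inv\<^bsub>G\<^esub> s"
  note [simp] = s g
  have s': "?s \<in> carrier G" and sg: "s \<otimes>\<^bsub>G\<^esub> g \<in> carrier G" by simp_all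
  have "Phi (s \<otimes>\<^bsub>G\<^esub> g \<otimes>\<^bsub>G\<^esub> ?s) (conj_cell s g x)
     = (act_U (s \<otimes>\<^bsub>G\<^esub> g \<otimes>\<^bsub>G\<^esub> ?s) ** wh [] (phi (s \<otimes>\<^bsub>G\<^esub> g) ?s) [ua]) ** wh [] (phi s g) [rho ?s, ua]
        ** wh [rho s] x [rho ?s, ua] ** wh [] (phi' s ?s) [ua] ** wh [] phi1' [ua]"
    unfolding Phi_def conj_cell_def by (simp add: wh_vc wh_wh vc_assoc)
  also have "\<dots> = act_U (s \<otimes>\<^bsub>G\<^esub> g) ** (wh [rho (s \<otimes>\<^bsub>G\<^esub> g)] (act_U ?s) [] ** wh [] (phi s g) [rho ?s, ua])
        ** wh [rho s] x [rho ?s, ua] ** wh [] (phi' s ?s) [ua] ** wh [] phi1' [ua]"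
    unfolding act_U_mult[OF sg s'] by (simp add: vc_assoc)
  also have "wh [rho (s \<otimes>\<^bsub>G\<^esub> g)] (act_U ?s) [] ** wh [] (phi s g) [rho ?s, ua]
      = wh [] (phi s g) [ua] ** wh [rho s, rho g] (act_U ?s) []"
    using exchange[OF phi_ty[OF s g] act_U_ty[OF s'], of "[]" "[]" "[]"] by simp
  also have "act_U (s \<otimes>\<^bsub>G\<^esub> g) ** (wh [] (phi s g) [ua] ** wh [rho s, rho g] (act_U ?s) [])
        ** wh [rho s] x [rho ?s, ua] ** wh [] (phi' s ?s) [ua] ** wh [] phi1' [ua]
      = (act_U (s \<otimes>\<^bsub>G\<^esub> g) ** wh [] (phi s g) [ua]) ** (wh [rho s, rho g] (act_U ?s) [] ** wh [rho s] x [rho ?s, ua])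
        ** wh [] (phi' s ?s) [ua] ** wh [] phi1' [ua]"
    by (simp add: vc_assoc)
  also have "wh [rho s, rho g] (act_U ?s) [] ** wh [rho s] x [rho ?s, ua] = wh [rho s] x [ua] ** wh [rho s] (act_U ?s) []"
    using exchange[OF x act_U_ty[OF s'], of "[]" "[rho s]" "[]"] by simp
  also have "(act_U (s \<otimes>\<^bsub>G\<^esub> g) ** wh [] (phi s g) [ua]) ** (wh [rho s] x [ua] ** wh [rho s] (act_U ?s) [])
        ** wh [] (phi' s ?s) [ua] ** wh [] phi1' [ua]
      = (act_U s ** wh [rho s] (act_U g) []) ** wh [rho s] x [ua] ** triv_U s"
    unfolding act_U_mult[OF s g] using triv_U_as_inverse_element[OF s] by (simp add: vc_assoc)
  also have "\<dots> = Act s (Phi g x)"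
    unfolding Act_def Phi_def by (simp add: wh_vc wh_wh vc_assoc)
  finally show ?thesis by simp
qed

text \<open>The family of the maps \<open>Phi g\<close> is inverse to the family of the maps sending \<open>b\<close> to the composite of \<open>post g\<close>,
\<open>b l\<close> and \<open>pre\<close>. Here \<open>pre\<close> is the unit of the adjunction between \<open>l\<close> and \<open>U\<close>, and \<open>post g\<close> identifies
\<open>U l\<close> with the direct sum of all \<open>rho g\<close> and projects to a summand. One direction is a triangle
identity, by which \<open>b\<close> can be pulled out of its composite with the counit. The other one holds because
the identification of \<open>U l\<close> with the direct sum is equivariant for the regular action, by which \<open>g\<close>
maps the summand of the neutral element to that of \<open>g\<close>.\<close>

lemma trace_decomposition:
  assumes fin: "finite (carrier G)"
  obtains l pre post where "path V X [l]" "ty pre V V [] [ua, l]"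
    "\<And>g. g \<in> carrier G \<Longrightarrow> ty (post g) V V [ua, l] [rho g]"
    "\<And>b. ty b X V [ua] [ua] \<Longrightarrow> val b = (\<Sum>g\<in>carrier G. val (Phi g (post g ** wh [] b [l] ** pre)))"
    "\<And>g h x. g \<in> carrier G \<Longrightarrow> h \<in> carrier G \<Longrightarrow> ty x V V [] [rho g] \<Longrightarrow>
       val (post h ** wh [] (Phi g x) [l] ** pre) = (if h = g then val x else 0)"
proof -
  let ?o = "\<one>\<^bsub>G\<^esub>"
  obtain P i p where bi: "biprod (carrier G) V V rho P i p"
    using biprod_exists[of "carrier G" V V rho] fin by auto
  have P: "path V V [P]" and ti: "\<And>k. k \<in> carrier G \<Longrightarrow> ty (i k) V V [rho k] [P]"
    and tp: "\<And>k. k \<in> carrier G \<Longrightarrow> ty (p k) V V [P] [rho k]"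
    using bi by (simp_all add: biprod_def)
  have pP [simp]: "path A V (P # q) \<longleftrightarrow> path A V q" "pdom V (P # q) = pdom V q" "pcod V [P] = V" for A q
    using P path_pdom[OF P] path_pcod[OF P] path_append[of A V "[P]" q] pdom_append[of V "[P]" q] by auto
  note [simp] = tyD(1-6)[OF ti] tyD(1-6)[OF tp]
  obtain m e where m: "action V [P] m e"
    and mi: "\<And>s h. s \<in> carrier G \<Longrightarrow> h \<in> carrier G \<Longrightarrow> m s ** wh [rho s] (i h) [] = i (s \<otimes>\<^bsub>G\<^esub> h) ** phi s h"
    using regular_action[OF bi] by auto
  obtain l th th' where l: "path V X [l]" and th: "inv_pair th th' V V [ua, l] [P]"
    and eq: "equivariant th (\<lambda>g. wh [] (act_U g) [l]) m"
    using action_factors[OF m] by blast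
  have pl [simp]: "path A X (l # q) \<longleftrightarrow> path A V q" "pdom X (l # q) = pdom V q" "pcod V [l] = X" for A q
    using l path_pdom[OF l] path_pcod[OF l] path_append[of A X "[l]" q] pdom_append[of X "[l]" q] by auto
  note tht = inv_pairD(1)[OF th] and tht' = inv_pairD(2)[OF th]
  have th_eq: "th ** wh [] (act_U g) [l] = m g ** wh [rho g] th []" if "g \<in> carrier G" for g
    using eq that by (simp add: equivariant_def)
  note [simp] = tyD(1-6)[OF tht] tyD(1-6)[OF tht'] tyD(1-6)[OF actionD(5)[OF m]]
  \<comment> \<open>The 1-morphism \<open>l\<close> is left adjoint to \<open>U\<close>: the unit is \<open>th'\<close> composed with \<open>eta\<close>, and the
    counit is the lift \<open>c\<close> of the cell assembled from the actions \<open>act_U g\<close>.\<close>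
  define eta where "eta = i ?o ** phi1'"
  have eta: "ty eta V V [] [P]" unfolding eta_def using ty_vc[OF phi1'_ty ti] by simp
  obtain a where ta: "ty a X V [P, ua] [ua]" and a: "\<And>g. g \<in> carrier G \<Longrightarrow> a ** wh [] (i g) [ua] = act_U g"
    using biprod_copair[OF bi, of X "[ua]" V "[]" "[ua]" act_U] act_U_ty by auto
  note [simp] = tyD(1-6)[OF ta]
  have am: "a ** wh [] (m s) [ua] = act_U s ** wh [rho s] a []" if s: "s \<in> carrier G" for s
  proof (rule biprod_ext[OF bi, of X "[ua]" V "[rho s]"])
    show "ty (a ** wh [] (m s) [ua]) X V ([rho s] @ [P] @ [ua]) [ua]" "ty (act_U s ** wh [rho s] a []) X V ([rho s] @ [P] @ [ua]) [ua]"
      using s by (simp_all add: tys)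
    fix h assume h: "h \<in> carrier G"
    have "(a ** wh [] (m s) [ua]) ** wh [rho s] (i h) [ua] = a ** wh [] (m s ** wh [rho s] (i h) []) [ua]"
      by (simp add: wh_vc wh_wh vc_assoc)
    also have "\<dots> = (a ** wh [] (i (s \<otimes>\<^bsub>G\<^esub> h)) [ua]) ** wh [] (phi s h) [ua]"
      unfolding mi[OF s h] by (simp add: wh_vc wh_wh vc_assoc)
    also have "\<dots> = act_U s ** wh [rho s] (act_U h) []" using a s h act_U_mult by simp
    also have "\<dots> = (act_U s ** wh [rho s] a []) ** wh [rho s] (i h) [ua]"
      using arg_cong[OF a[OF h], of "\<lambda>x. act_U s ** wh [rho s] x []"] by (simp add: wh_vc wh_wh vc_assoc)
    finally show "(a ** wh [] (m s) [ua]) ** wh [rho s] (i h) [ua] = (act_U s ** wh [rho s] a []) ** wh [rho s] (i h) [ua]" .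
  qed (use s in simp_all)
  define b where "b = a ** wh [] th [ua]"
  have tb: "ty b X V [ua, l, ua] [ua]"
    unfolding b_def using ty_vc[OF ty_wh[OF tht, of X "[ua]" V "[]"], of a "[ua]"] ta by simp
  have "b ** wh [] (act_U g) [l, ua] = act_U g ** wh [rho g] b []" if g: "g \<in> carrier G" for g
  proof -
    have "b ** wh [] (act_U g) [l, ua] = a ** wh [] (th ** wh [] (act_U g) [l]) [ua]"
      unfolding b_def by (simp add: wh_vc wh_wh vc_assoc)
    also have "\<dots> = (a ** wh [] (m g) [ua]) ** wh [rho g] th [ua]"
      unfolding th_eq[OF g] by (simp add: wh_vc wh_wh vc_assoc)
    also have "\<dots> = act_U g ** wh [rho g] b []"
      unfolding am[OF g] b_def by (simp add: wh_vc wh_wh vc_assoc)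
    finally show ?thesis .
  qed
  then have "equivariant b (\<lambda>g. wh [] (act_U g) [l, ua]) (\<lambda>g. wh [] (act_U g) [])"
    by (simp add: equivariant_def)
  then obtain c where c: "ty c X X [l, ua] []" and bc: "b = wh [ua] c []"
    using lift_equivariant[of X "[l, ua]" "[]" b] tb by auto
  define pre where "pre = th' ** eta"
  have pre: "ty pre V V [] [ua, l]" unfolding pre_def by (rule ty_vc[OF eta tht'])
  define post where "post g = p g ** th" for g
  have post: "ty (post g) V V [ua, l] [rho g]" if "g \<in> carrier G" for g
    unfolding post_def by (rule ty_vc[OF tht tp[OF that]])
  have thpre: "th ** pre = eta"
    unfolding pre_def using inv_pair_cancel[OF th eta] by simp
  have split: "val z = (\<Sum>g\<in>carrier G. val (Phi g (post g ** wh [] z [l] ** pre)))" if z: "ty z X V [ua] [ua]" for z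
  proof -
    let ?x = "th ** wh [] z [l] ** pre"
    have wz: "ty (wh [] z [l]) V V [ua, l] [ua, l]" using ty_wh[OF z, of V "[l]" V "[]"] by simp
    have x: "ty ?x V V [] [P]" by (rule ty_vc[OF ty_vc[OF pre wz] tht, unfolded vc_assoc])
    have wx: "ty (wh [] ?x [ua]) X V [ua] [P, ua]" using ty_wh[OF x, of X "[ua]" V "[]"] by simp
    have "a ** wh [] ?x [ua] = (wh [ua] c [] ** wh [] z [l, ua]) ** wh [] pre [ua]"
      using bc unfolding b_def by (simp add: wh_vc wh_wh vc_assoc[symmetric])
    also have "wh [ua] c [] ** wh [] z [l, ua] = z ** wh [ua] c []"
      using exchange[OF z c, of "[]" "[]" "[]"] wh_nil[OF tyD(6)[OF z]] by simp
    also have "(z ** wh [ua] c []) ** wh [] pre [ua] = z ** a ** wh [] (th ** pre) [ua]"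
      by (simp add: bc[symmetric] b_def wh_vc vc_assoc)
    also have "\<dots> = z ** (a ** wh [] (i ?o) [ua]) ** wh [] phi1' [ua]"
      unfolding thpre eta_def by (simp add: wh_vc vc_assoc)
    also have "(a ** wh [] (i ?o) [ua]) ** wh [] phi1' [ua] = id_cell X V [ua]"
      unfolding a[OF one_closed] act_U_one using inv_pairD(4)[OF inv_pair_wh[OF phi1_inv, of X "[ua]" V "[]"]] by simp
    also have "z ** \<dots> = z" by (rule vc_id_cell_right[OF z])
    finally have az: "a ** wh [] ?x [ua] = z" .
    have t: "ty (wh [] (i g) [ua] ** wh [] (p g) [ua] ** wh [] ?x [ua]) X V [ua] [P, ua]" if "g \<in> carrier G" for g
      by (rule ty_vc[OF ty_vc[OF wx]])
        (use ty_wh[OF tp[OF that], of X "[ua]" V "[]"] ty_wh[OF ti[OF that], of X "[ua]" V "[]"] in simp_all)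
    have "val z = val a \<bullet> val (wh [] ?x [ua])" using val_vc[OF wx ta] az by simp
    also have "\<dots> = val a \<bullet> (\<Sum>g\<in>carrier G. val (wh [] (i g) [ua] ** wh [] (p g) [ua] ** wh [] ?x [ua]))"
      using biprod_into_sum[OF bi, of X "[ua]" V "[]" "wh [] ?x [ua]" "[ua]"] wx by simp
    also have "\<dots> = (\<Sum>g\<in>carrier G. val a \<bullet> val (wh [] (i g) [ua] ** wh [] (p g) [ua] ** wh [] ?x [ua]))"
      by (rule linear_on_hom2_sum[OF vcomp_linear_right[OF tyD(10)[OF wx] tyD(10,11,9)[OF ta]] tyD(10,11)[OF wx] fin])
        (use tyD(9)[OF t] in simp)
    also have "\<dots> = (\<Sum>g\<in>carrier G. val (Phi g (post g ** wh [] z [l] ** pre)))"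
    proof (rule sum.cong[OF refl])
      fix g assume g: "g \<in> carrier G"
      have "val a \<bullet> val (wh [] (i g) [ua] ** wh [] (p g) [ua] ** wh [] ?x [ua])
          = val ((a ** wh [] (i g) [ua]) ** wh [] (p g) [ua] ** wh [] ?x [ua])"
        using val_vc[OF t[OF g] ta] by (simp add: vc_assoc)
      then show "val a \<bullet> val (wh [] (i g) [ua] ** wh [] (p g) [ua] ** wh [] ?x [ua])
          = val (Phi g (post g ** wh [] z [l] ** pre))"
        unfolding a[OF g] Phi_def post_def by (simp add: wh_vc wh_wh vc_assoc)
    qed
    finally show ?thesis .
  qed
  have ortho: "val (post h ** wh [] (Phi g x) [l] ** pre) = (if h = g then val x else 0)"
    if g: "g \<in> carrier G" and h: "h \<in> carrier G" and x: "ty x V V [] [rho g]" for g h x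
  proof -
    have nx: "wh [] x [] = x" by (rule wh_nil[OF tyD(6)[OF x]])
    have "th ** wh [] (Phi g x) [l] ** pre = (th ** wh [] (act_U g) [l]) ** wh [] x [ua, l] ** pre"
      unfolding Phi_def by (simp add: wh_vc wh_wh vc_assoc)
    also have "\<dots> = m g ** (wh [rho g] th [] ** wh [] x [ua, l]) ** pre"
      unfolding th_eq[OF g] by (simp add: vc_assoc)
    also have "wh [rho g] th [] ** wh [] x [ua, l] = wh [] x [P] ** th"
      using exchange[OF x tht, of "[]" "[]" "[]"] wh_nil[OF tyD(6)[OF tht]] by simp
    also have "m g ** (wh [] x [P] ** th) ** pre = m g ** wh [] x [P] ** eta"
      using thpre by (simp add: vc_assoc)
    also have "wh [] x [P] ** eta = wh [rho g] eta [] ** x"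
      using exchange[OF x eta, of "[]" "[]" "[]"] wh_nil[OF tyD(6)[OF eta]] nx by simp
    also have "m g ** wh [rho g] eta [] ** x = (m g ** wh [rho g] (i ?o) []) ** wh [rho g] phi1' [] ** x"
      unfolding eta_def by (simp add: wh_vc vc_assoc)
    also have "\<dots> = i g ** wh [rho g] phi1 [] ** wh [rho g] phi1' [] ** x"
      unfolding mi[OF g one_closed] using phi_one_right[OF g] g by (simp add: vc_assoc)
    also have "wh [rho g] phi1 [] ** wh [rho g] phi1' [] ** x = x"
      using inv_pair_cancel[OF inv_pair_wh[OF phi1_inv, of V "[]" V "[rho g]"], of x "[]"] x g by simp
    finally have "post h ** wh [] (Phi g x) [l] ** pre = p h ** i g ** x"
      unfolding post_def by (simp add: vc_assoc)
    then show ?thesis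
      using biprod_ortho[OF bi h g, of V "[]" x "[]"] x wh_nil[OF tyD(6)[OF ti[OF g]]] wh_nil[OF tyD(6)[OF tp[OF h]]] by simp
  qed
  show thesis by (rule that[OF l pre post split ortho])
qed

end

section \<open>The dimension of the invariants\<close>

context invariant_cells
begin

lemma lift_fixed:
  assumes b: "ty b X V [ua] [ua]" and fx: "\<And>s. s \<in> carrier G \<Longrightarrow> Act s b = b"
  shows "\<exists>c. ty c X X [] [] \<and> b = wh [ua] c []"
  using lift_equivariant[of X "[]" "[]" b] b fx Act_fixed[OF _ b] by (simp add: equivariant_def)

lemma Act_lifted:
  assumes c: "ty c X X [] []" and s: "s \<in> carrier G"
  shows "Act s (wh [ua] c []) = wh [ua] c []"
proof -
  have "ty (wh [ua] c []) X V [ua] [ua]" using ty_wh[OF c, of X "[]" V "[ua]"] by simp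
  then show ?thesis
    using Act_fixed[OF s] exchange[OF act_U_ty[OF s] c, of "[]" "[]" "[]"] s by (simp add: wh_wh)
qed

text \<open>The traces of conjugation by \<open>s\<close> on the summands of \<open>2Hom(U, U)\<close> vanish unless \<open>g\<close> commutes with \<open>s\<close>,
because otherwise the summand of \<open>g\<close> is mapped to a different one.\<close>

theorem dim_invariants:
  assumes fin: "finite (carrier G)" and card: "(of_nat (card (carrier G)) :: 'k) \<noteq> 0"
    and fd: "\<And>g. g \<in> carrier G \<Longrightarrow> fin_dim (smul C) (cat_trace C V (act R g))"
  shows "fin_dim (smul C) (cat_dim C X) \<and>
         of_nat (vs.dim (cat_dim C X)) = 1 / of_nat (card (carrier G)) *
           (\<Sum>(g, h) \<in> {(g, h). g \<in> carrier G \<and> h \<in> carrier G \<and> g \<otimes>\<^bsub>G\<^esub> h = h \<otimes>\<^bsub>G\<^esub> g}. two_character C G V R g h)"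
proof -
  obtain l pre post where l: "path V X [l]" and pre: "ty pre V V [] [ua, l]"
    and post: "\<And>g. g \<in> carrier G \<Longrightarrow> ty (post g) V V [ua, l] [rho g]"
    and split: "\<And>b. ty b X V [ua] [ua] \<Longrightarrow> val b = (\<Sum>g\<in>carrier G. val (Phi g (post g ** wh [] b [l] ** pre)))"
    and ortho: "\<And>g h x. g \<in> carrier G \<Longrightarrow> h \<in> carrier G \<Longrightarrow> ty x V V [] [rho g] \<Longrightarrow>
       val (post h ** wh [] (Phi g x) [l] ** pre) = (if h = g then val x else 0)"
    using trace_decomposition[OF fin] by blast
  let ?T = "\<lambda>g. cat_trace C V (act R g)"
  let ?E = "hom2 C U U"
  let ?D = "cat_dim C X"
  define uc where "uc \<beta> = mk_cell X V [ua] [ua] \<beta>" for \<beta>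
  have uc: "ty (uc \<beta>) X V [ua] [ua]" "val (uc \<beta>) = \<beta>" if "\<beta> \<in> ?E" for \<beta>
    unfolding uc_def using that ty_mk_cell[of X V "[ua]" "[ua]" \<beta>] val_mk_cell[of X V "[ua]" "[ua]" \<beta>] by simp_all
  have Eval: "val b \<in> ?E" "uc (val b) = b" if "ty b X V [ua] [ua]" for b
    using tyD(9)[OF that] mk_cell_val[OF that] by (simp_all add: uc_def)
  have Tval: "val x \<in> ?T g" "trace_cell g (val x) = x" if "ty x V V [] [rho g]" "g \<in> carrier G" for x g
    using tyD(9)[OF that(1)] mk_cell_val[OF that(1)] that(2) by (simp_all add: cat_trace_rho trace_cell_def)
  define Ph where "Ph g \<xi> = val (Phi g (trace_cell g \<xi>))" for g \<xi>
  define Ps where "Ps g \<beta> = val (post g ** wh [] (uc \<beta>) [l] ** pre)" for g \<beta>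
  define Ac where "Ac s \<beta> = val (Act s (uc \<beta>))" for s \<beta>
  have Esub: "vs.subspace ?E" by (rule hom2_subspace[OF U_closed U_closed])
  have post_ty: "ty (post g ** wh [] b [l] ** pre) V V [] [rho g]" if "ty b X V [ua] [ua]" "g \<in> carrier G" for b g
    using ty_vc[OF ty_vc[OF pre _] post[OF that(2)], of "wh [] b [l]"] ty_wh[OF that(1) l, of V "[]"] by (simp add: vc_assoc)
  have main: "fin_dim (smul C) ?D \<and> of_nat (vs.dim ?D) = 1 / of_nat (card (carrier G)) *
     (\<Sum>s\<in>carrier G. \<Sum>g\<in>carrier G. trace_on (smul C) (?T g) (\<lambda>\<xi>. Ps g (Ac s (Ph g \<xi>))))"
  proof (rule vs.averaging_dim[OF fin fin card cat_trace_subspace fd Esub,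
        where u="\<lambda>c. U \<triangleright> c" and \<Phi>=Ph and \<Psi>=Ps and A=Ac])
    show "vs.subspace ?D" unfolding cat_dim_def cat_trace_def by (rule hom2_subspace[OF id1_closed id1_closed])
    fix g assume g: "g \<in> carrier G"
    show "Ph g \<xi> \<in> ?E" if "\<xi> \<in> ?T g" for \<xi>
      unfolding Ph_def by (rule Eval[OF Phi_ty[OF g trace_cell(1)[OF g that]]])
    show "linear_on (smul C) (smul C) (?T g) (Ph g)"
    proof (rule vs.linear_on_cong[OF cat_trace_subspace[OF g]])
      show "linear_on (smul C) (smul C) (?T g) (\<lambda>\<xi>. val (act_U g ** wh [] (mk_cell V V [] [rho g] \<xi>) [ua] ** id_cell X V [ua]))"
        unfolding cat_trace_rho[OF g]
        by (rule cell_linear[of _ X V "[ua]"]) (use ty_id_cell[of X V "[ua]"] act_U_ty[OF g] g in simp_all)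
      show "Ph g \<xi> = val (act_U g ** wh [] (mk_cell V V [] [rho g] \<xi>) [ua] ** id_cell X V [ua])" if "\<xi> \<in> ?T g" for \<xi>
        using vc_id_cell_right[OF ty_wh[OF trace_cell(1)[OF g that], of X "[ua]" V "[]"]] by (simp add: Ph_def Phi_def trace_cell_def)
    qed
    show "Ps g \<beta> \<in> ?T g" if "\<beta> \<in> ?E" for \<beta>
      unfolding Ps_def by (rule Tval(1)[OF post_ty[OF uc(1)[OF that] g] g])
    show "linear_on (smul C) (smul C) ?E (Ps g)"
      using cell_linear[of pre V V "[]" "[]" "[ua]" "[l]" "post g" "[ua]" "[rho g]" X V] pre post[OF g] l
      by (simp add: Ps_def[abs_def] uc_def)
  next
    fix \<beta> assume b: "\<beta> \<in> ?E"
    have "(\<Sum>g\<in>carrier G. Ph g (Ps g \<beta>)) = (\<Sum>g\<in>carrier G. val (Phi g (post g ** wh [] (uc \<beta>) [l] ** pre)))"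
      unfolding Ph_def Ps_def using Tval(2)[OF post_ty[OF uc(1)[OF b]]] by (intro sum.cong) simp_all
    then show "(\<Sum>g\<in>carrier G. Ph g (Ps g \<beta>)) = \<beta>" using split[OF uc(1)[OF b]] uc(2)[OF b] by simp
  next
    fix s assume s: "s \<in> carrier G"
    show "linear_on (smul C) (smul C) ?E (Ac s)"
      using cell_linear[of "triv_U s" X V "[ua]" "[rho s]" "[ua]" "[]" "act_U s" "[ua]" "[ua]" X V] act_U_ty[OF s] triv_U_ty[OF s] s
      by (simp add: Ac_def[abs_def] Act_def uc_def)
    show "Ac s \<beta> \<in> ?E" if "\<beta> \<in> ?E" for \<beta>
      unfolding Ac_def by (rule Eval(1)[OF Act_ty[OF s uc(1)[OF that]]])
  next
    fix t \<beta> assume t: "t \<in> carrier G" and b: "\<beta> \<in> ?E"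
    have "(\<Sum>s\<in>carrier G. Ac t (Ac s \<beta>)) = (\<Sum>s\<in>carrier G. Ac (t \<otimes>\<^bsub>G\<^esub> s) \<beta>)"
      unfolding Ac_def using Eval(2)[OF Act_ty[OF _ uc(1)[OF b]]] Act_Act[OF t _ uc(1)[OF b]] by (intro sum.cong) simp_all
    also have "\<dots> = (\<Sum>s\<in>carrier G. Ac s \<beta>)"
      by (rule sum.reindex_bij_witness[where i="\<lambda>s. inv\<^bsub>G\<^esub> t \<otimes>\<^bsub>G\<^esub> s" and j="\<lambda>s. t \<otimes>\<^bsub>G\<^esub> s"])
        (use t in \<open>simp_all add: m_assoc[symmetric]\<close>)
    finally show "(\<Sum>s\<in>carrier G. Ac t (Ac s \<beta>)) = (\<Sum>s\<in>carrier G. Ac s \<beta>)" .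
  next
    show "linear_on (smul C) (smul C) ?D (\<lambda>c. U \<triangleright> c)"
      using hcomp_bilinear[OF id1_closed id1_closed U_closed U_closed] id2_closed[OF U_closed]
      unfolding bilinear_on_def linear_on_def lwhisk_def cat_dim_def cat_trace_def by simp
    show "inj_on (\<lambda>c. U \<triangleright> c) ?D"
      using U_faithful[of X "[]" "[]"] by (auto simp: inj_on_def cat_dim_def cat_trace_def)
    fix d assume "d \<in> ?D"
    then have d: "ty (mk_cell X X [] [] d) X X [] []" "val (mk_cell X X [] [] d) = d"
      using ty_mk_cell[of X X "[]" "[]" d] val_mk_cell[of X X "[]" "[]" d] by (simp_all add: cat_dim_def cat_trace_def)
    have t: "ty (wh [ua] (mk_cell X X [] [] d) []) X V [ua] [ua]" using ty_wh[OF d(1), of X "[]" V "[ua]"] by simp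
    have v: "val (wh [ua] (mk_cell X X [] [] d) []) = U \<triangleright> d" using val_wh_left[OF d(1), of V "[ua]"] d(2) by simp
    show "U \<triangleright> d \<in> ?E" using Eval(1)[OF t] v by simp
    show "Ac s (U \<triangleright> d) = U \<triangleright> d" if "s \<in> carrier G" for s
      using Act_lifted[OF d(1) that] Eval(2)[OF t] v by (simp add: Ac_def)
  next
    fix \<beta> assume b: "\<beta> \<in> ?E" and fx: "\<And>s. s \<in> carrier G \<Longrightarrow> Ac s \<beta> = \<beta>"
    have "Act s (uc \<beta>) = uc \<beta>" if s: "s \<in> carrier G" for s
      by (rule ty_eqI[OF Act_ty[OF s uc(1)[OF b]] uc(1)[OF b]]) (use fx[OF s] uc(2)[OF b] in \<open>simp add: Ac_def\<close>)
    then obtain c where c: "ty c X X [] []" "uc \<beta> = wh [ua] c []" using lift_fixed[OF uc(1)[OF b]] by blast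
    have "\<beta> = U \<triangleright> val c" using val_wh_left[OF c(1), of V "[ua]"] c(2) uc(2)[OF b] by simp
    moreover have "val c \<in> ?D" using tyD(9)[OF c(1)] by (simp add: cat_dim_def cat_trace_def)
    ultimately show "\<beta> \<in> (\<lambda>c. U \<triangleright> c) ` ?D" by blast
  qed
  have entry: "trace_on (smul C) (?T g) (\<lambda>\<xi>. Ps g (Ac s (Ph g \<xi>)))
      = (if g \<otimes>\<^bsub>G\<^esub> s = s \<otimes>\<^bsub>G\<^esub> g then two_character C G V R g s else 0)" if s: "s \<in> carrier G" and g: "g \<in> carrier G" for s g
  proof -
    let ?t = "s \<otimes>\<^bsub>G\<^esub> g \<otimes>\<^bsub>G\<^esub> inv\<^bsub>G\<^esub> s"
    define q where "q \<longleftrightarrow> g = ?t"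
    have tg: "q \<longleftrightarrow> g \<otimes>\<^bsub>G\<^esub> s = s \<otimes>\<^bsub>G\<^esub> g"
      unfolding q_def using s g inv_solve_right[of g "s \<otimes>\<^bsub>G\<^esub> g" s]
      by (simp add: eq_commute[of "s \<otimes>\<^bsub>G\<^esub> g"])
    have Ps_eq: "Ps g (Ac s (Ph g \<xi>)) = (if q then conj_map C G V R s g \<xi> else 0)" if x: "\<xi> \<in> ?T g" for \<xi>
    proof -
      note tx = trace_cell[OF g x]
      have "Ac s (Ph g \<xi>) = val (Phi ?t (conj_cell s g (trace_cell g \<xi>)))"
        using Eval(2)[OF Phi_ty[OF g tx(1)]] Act_Phi[OF s g tx(1)] by (simp add: Ac_def Ph_def)
      then have "Ps g (Ac s (Ph g \<xi>)) = val (post g ** wh [] (Phi ?t (conj_cell s g (trace_cell g \<xi>))) [l] ** pre)"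
        using Eval(2)[OF Phi_ty[OF _ conj_cell_ty[OF s g tx(1)]]] s g by (simp add: Ps_def)
      then show ?thesis
        using ortho[OF _ g conj_cell_ty[OF s g tx(1)]] val_conj_cell[OF s g tx(1)] tx(2) s g
        unfolding q_def[symmetric] by simp
    qed
    show ?thesis
    proof (cases q)
      case True
      have "trace_on (smul C) (?T g) (\<lambda>\<xi>. Ps g (Ac s (Ph g \<xi>))) = trace_on (smul C) (?T g) (conj_map C G V R s g)"
        by (rule vs.trace_on_cong) (use Ps_eq True in simp)
      then show ?thesis using True unfolding two_character_def tg[symmetric] by simp
    next
      case False
      have "trace_on (smul C) (?T g) (\<lambda>\<xi>. Ps g (Ac s (Ph g \<xi>))) = 0"
        by (rule vs.trace_on_zero) (use Ps_eq False in simp)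
      then show ?thesis using False unfolding tg[symmetric] by simp
    qed
  qed
  let ?P = "{(g, h). g \<in> carrier G \<and> h \<in> carrier G \<and> g \<otimes>\<^bsub>G\<^esub> h = h \<otimes>\<^bsub>G\<^esub> g}"
  have "(\<Sum>s\<in>carrier G. \<Sum>g\<in>carrier G. trace_on (smul C) (?T g) (\<lambda>\<xi>. Ps g (Ac s (Ph g \<xi>))))
      = (\<Sum>g\<in>carrier G. \<Sum>s\<in>carrier G. if g \<otimes>\<^bsub>G\<^esub> s = s \<otimes>\<^bsub>G\<^esub> g then two_character C G V R g s else 0)"
    by (subst sum.swap) (simp add: entry cong: sum.cong)
  also have "\<dots> = (\<Sum>p\<in>carrier G \<times> carrier G. if p \<in> ?P then two_character C G V R (fst p) (snd p) else 0)"
    unfolding sum.cartesian_product by (rule sum.cong) (auto split: if_splits)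
  also have "\<dots> = (\<Sum>p\<in>(carrier G \<times> carrier G) \<inter> ?P. two_character C G V R (fst p) (snd p))"
    by (rule sum.inter_restrict[symmetric]) (use fin in simp)
  also have "(carrier G \<times> carrier G) \<inter> ?P = ?P" by auto
  finally show ?thesis using main by (simp add: case_prod_unfold)
qed

end

section \<open>Characters of tensor products\<close>

locale tensor_cells = monoidal_klinear_2category C + R: rep_cells C G V R + Q: rep_cells C G W Q
  for C :: "('k::field, 'o, 'a, 'm::ab_group_add, 'z) monoidal_two_cat_scheme" (structure)
    and G :: "('g, 'y) monoid_scheme" and V :: 'o and R :: "('g, 'a, 'm) rep2"
    and W :: 'o and Q :: "('g, 'a, 'm) rep2"
begin

definition VW :: 'o where "VW = V \<otimes>\<^sub>0 W"

text \<open>Only endomorphisms of \<open>V\<close> and \<open>W\<close> occur in the 2-representations, so \<open>box1\<close> and \<open>box2\<close> restrict the tensor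
product to these. The value \<open>box1 p p'\<close> is a single arrow, the tensor product of two composites; the cell
\<open>tcomp\<close> fuses two such arrows, and \<open>tunit\<close> creates one from the empty path.\<close>

definition box1 :: "('o, 'a) arrow list \<Rightarrow> ('o, 'a) arrow list \<Rightarrow> ('o, 'a) arrow" where
  "box1 p p' = (VW, VW, pcomp V p \<otimes>\<^sub>1 pcomp W p')"

definition box2 :: "('o, 'a, 'm) cell \<Rightarrow> ('o, 'a, 'm) cell \<Rightarrow> ('o, 'a, 'm) cell" where
  "box2 x x' = mk_cell VW VW [box1 (src x) (src x')] [box1 (tgt x) (tgt x')] (val x \<otimes>\<^sub>2 val x')"

definition tcomp where
  "tcomp p p' q q' = mk_cell VW VW [box1 p p', box1 q q'] [box1 (p @ q) (p' @ q')]
     (ten_comp C (pcomp V p) (pcomp W p') (pcomp V q) (pcomp W q'))"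

definition tunit :: "('o, 'a, 'm) cell" where
  "tunit = mk_cell VW VW [] [box1 [] []] (ten_id C V W)"

lemma box1_closed: "path V V p \<Longrightarrow> path W W p' \<Longrightarrow> pcomp V p \<otimes>\<^sub>1 pcomp W p' \<in> hom1 C VW VW"
  unfolding VW_def by (rule ten1_closed[OF pcomp_closed pcomp_closed])

lemma path_box1 [simp]: "path V V p \<Longrightarrow> path W W p' \<Longrightarrow> path A B (box1 p p' # r) \<longleftrightarrow> B = VW \<and> path A VW r"
  using box1_closed by (auto simp: box1_def)

lemma pdom_box1 [simp]: "pdom B (box1 p p' # r) = pdom VW r" and pcod_box1 [simp]: "pcod B (box1 p p' # r) = VW"
  and pcomp_box1 [simp]: "pcomp A (box1 p p' # r) = (pcomp V p \<otimes>\<^sub>1 pcomp W p') \<cdot> pcomp A r"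
  by (simp_all add: box1_def)

lemma box1_id1 [simp]: "path V V p \<Longrightarrow> path W W p' \<Longrightarrow> (pcomp V p \<otimes>\<^sub>1 pcomp W p') \<cdot> id1 C VW = pcomp V p \<otimes>\<^sub>1 pcomp W p'"
  by (rule comp1_id_right[OF box1_closed])

lemma box2_ty:
  assumes "ty x V V p q" "ty x' W W p' q'"
  shows "ty (box2 x x') VW VW [box1 p p'] [box1 q q']" "val (box2 x x') = val x \<otimes>\<^sub>2 val x'"
proof -
  note d = tyD[OF assms(1)] and d' = tyD[OF assms(2)]
  have m: "val x \<otimes>\<^sub>2 val x' \<in> hom2 C (pcomp VW [box1 p p']) (pcomp VW [box1 q q'])"
    using ten2_closed[OF d(10,11) d'(10,11) d(9) d'(9)] d d' by simp
  have p: "path VW VW [box1 p p']" "path VW VW [box1 q q']" using d d' by simp_all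
  show "ty (box2 x x') VW VW [box1 p p'] [box1 q q']" "val (box2 x x') = val x \<otimes>\<^sub>2 val x'"
    using ty_mk_cell[OF p m] val_mk_cell[OF p m] d d' unfolding box2_def by simp_all
qed

lemma tcomp_inv:
  assumes p: "path V V p" "path W W p'" "path V V q" "path W W q'"
  shows "inv_pair (tcomp p p' q q') (mk_cell VW VW [box1 (p @ q) (p' @ q')] [box1 p p', box1 q q']
      (inv2 C (pcomp VW [box1 p p', box1 q q']) (pcomp VW [box1 (p @ q) (p' @ q')])
        (ten_comp C (pcomp V p) (pcomp W p') (pcomp V q) (pcomp W q'))))
    VW VW [box1 p p', box1 q q'] [box1 (p @ q) (p' @ q')]"
    and "val (tcomp p p' q q') = ten_comp C (pcomp V p) (pcomp W p') (pcomp V q) (pcomp W q')"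
proof -
  have pq: "path V V (p @ q)" "path W W (p' @ q')" using p path_pdom[OF p(1)] path_pdom[OF p(2)] by simp_all
  have pt: "path VW VW [box1 p p', box1 q q']" "path VW VW [box1 (p @ q) (p' @ q')]" using p pq by simp_all
  have pc: "pcomp VW [box1 (p @ q) (p' @ q')] = (pcomp V p \<cdot> pcomp V q) \<otimes>\<^sub>1 (pcomp W p' \<cdot> pcomp W q')"
    using box1_id1[OF pq] by (simp add: pcomp_append[OF p(1,3)] pcomp_append[OF p(2,4)])
  have i: "ten_comp C (pcomp V p) (pcomp W p') (pcomp V q) (pcomp W q')
      \<in> iso2 C (pcomp VW [box1 p p', box1 q q']) (pcomp VW [box1 (p @ q) (p' @ q')])"
    using ten_comp_iso[OF pcomp_closed[OF p(3)] pcomp_closed[OF p(1)] pcomp_closed[OF p(4)] pcomp_closed[OF p(2)]] p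
    unfolding pc by simp
  show "inv_pair (tcomp p p' q q') (mk_cell VW VW [box1 (p @ q) (p' @ q')] [box1 p p', box1 q q']
      (inv2 C (pcomp VW [box1 p p', box1 q q']) (pcomp VW [box1 (p @ q) (p' @ q')])
        (ten_comp C (pcomp V p) (pcomp W p') (pcomp V q) (pcomp W q'))))
    VW VW [box1 p p', box1 q q'] [box1 (p @ q) (p' @ q')]"
    unfolding tcomp_def by (rule inv_pair_iso2[OF pt i])
  show "val (tcomp p p' q q') = ten_comp C (pcomp V p) (pcomp W p') (pcomp V q) (pcomp W q')"
    unfolding tcomp_def by (rule val_mk_cell[OF pt]) (use i in \<open>simp add: iso2_def\<close>)
qed

lemmas tcomp_ty = inv_pairD(1)[OF tcomp_inv(1)] and val_tcomp = tcomp_inv(2)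

definition tunit' :: "('o, 'a, 'm) cell" where
  "tunit' = mk_cell VW VW [box1 [] []] [] (inv2 C (id1 C VW) (id1 C V \<otimes>\<^sub>1 id1 C W) (ten_id C V W))"

lemma tunit_inv: "inv_pair tunit tunit' VW VW [] [box1 [] []]" and val_tunit: "val tunit = ten_id C V W"
proof -
  have b: "(id1 C V \<otimes>\<^sub>1 id1 C W) \<cdot> id1 C VW = id1 C V \<otimes>\<^sub>1 id1 C W" using box1_id1[of "[]" "[]"] by simp
  have i: "ten_id C V W \<in> iso2 C (pcomp VW []) (pcomp VW [box1 [] []])"
    using ten_id_iso[of V W] b by (simp flip: VW_def)
  show "inv_pair tunit tunit' VW VW [] [box1 [] []]"
    using inv_pair_iso2[OF _ _ i] b by (simp add: tunit_def tunit'_def)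
  show "val tunit = ten_id C V W"
    unfolding tunit_def by (rule val_mk_cell) (use i in \<open>simp_all add: iso2_def\<close>)
qed

lemmas tunit_ty = inv_pairD(1)[OF tunit_inv] and tunit'_ty = inv_pairD(2)[OF tunit_inv]

lemma box2_vc:
  assumes x: "ty x V V p q" "ty y V V q r" and x': "ty x' W W p' q'" "ty y' W W q' r'"
  shows "box2 (y ** x) (y' ** x') = box2 y y' ** box2 x x'"
proof (rule ty_eqI[OF box2_ty(1)[OF ty_vc[OF x] ty_vc[OF x']] ty_vc[OF box2_ty(1)[OF x(1) x'(1)] box2_ty(1)[OF x(2) x'(2)]]])
  note d = tyD[OF x(1)] tyD[OF x(2)] and d' = tyD[OF x'(1)] tyD[OF x'(2)]
  show "val (box2 (y ** x) (y' ** x')) = val (box2 y y' ** box2 x x')"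
    unfolding box2_ty(2)[OF ty_vc[OF x] ty_vc[OF x']] val_vc[OF box2_ty(1)[OF x(1) x'(1)] box2_ty(1)[OF x(2) x'(2)]]
      box2_ty(2)[OF x(1) x'(1)] box2_ty(2)[OF x(2) x'(2)] val_vc[OF x] val_vc[OF x']
    by (rule ten2_vcomp[OF d(10,11,22) d'(10,11,22) d(9,20) d'(9,20)])
qed

lemma box2_inv:
  assumes x: "inv_pair x y V V p q" and x': "inv_pair x' y' W W p' q'"
  shows "inv_pair (box2 x x') (box2 y y') VW VW [box1 p p'] [box1 q q']"
proof -
  note d = inv_pairD[OF x] and d' = inv_pairD[OF x']
  have i: "box2 (id_cell V V r) (id_cell W W r') = id_cell VW VW [box1 r r']" if "path V V r" "path W W r'" for r r'
  proof (rule ty_eqI[OF box2_ty(1)[OF ty_id_cell[OF that(1)] ty_id_cell[OF that(2)]] ty_id_cell])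
    show p: "path VW VW [box1 r r']" using that by simp
    show "val (box2 (id_cell V V r) (id_cell W W r')) = val (id_cell VW VW [box1 r r'])"
      using box2_ty(2)[OF ty_id_cell[OF that(1)] ty_id_cell[OF that(2)]]
        ten2_id[OF pcomp_closed[OF that(1)] pcomp_closed[OF that(2)]] that
      by (simp add: id_cell_eq[OF that(1)] id_cell_eq[OF that(2)] id_cell_eq[OF p])
  qed
  show ?thesis
    unfolding inv_pair_def box2_vc[OF d(1,2) d'(1,2), symmetric] box2_vc[OF d(2,1) d'(2,1), symmetric] d(3,4) d'(3,4)
    using i[OF tyD(7)[OF d(1)] tyD(7)[OF d'(1)]] i[OF tyD(8)[OF d(1)] tyD(8)[OF d'(1)]] box2_ty(1)[OF d(1) d'(1)] box2_ty(1)[OF d(2) d'(2)]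
    by blast
qed

lemma tcomp_nat_right:
  assumes x: "ty x V V p q" and x': "ty x' W W p' q'" and s: "path V V s" "path W W s'"
  shows "tcomp q q' s s' ** wh [] (box2 x x') [box1 s s'] = box2 (wh [] x s) (wh [] x' s') ** tcomp p p' s s'"
proof -
  note d = tyD[OF x] and d' = tyD[OF x']
  note S = pcomp_closed[OF s(1)] and S' = pcomp_closed[OF s(2)]
  have w: "ty (wh [] x s) V V (p @ s) (q @ s)" "ty (wh [] x' s') W W (p' @ s') (q' @ s')"
    using ty_wh[OF x s(1), of V "[]"] ty_wh[OF x' s(2), of W "[]"] by simp_all
  have v: "val (wh [] x s) = val x \<star> id2 C (pcomp V s)" "val (wh [] x' s') = val x' \<star> id2 C (pcomp W s')"
    using val_wh_right[OF x s(1)] val_wh_right[OF x' s(2)] by (simp_all add: rwhisk_def)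
  have pb: "path VW VW [box1 s s']" using s by simp
  have b: "ty (wh [] (box2 x x') [box1 s s']) VW VW [box1 p p', box1 s s'] [box1 q q', box1 s s']"
    using ty_wh[OF box2_ty(1)[OF x x'] pb, of VW "[]"] by simp
  have vb: "val (wh [] (box2 x x') [box1 s s']) = (val x \<otimes>\<^sub>2 val x') \<star> (id2 C (pcomp V s) \<otimes>\<^sub>2 id2 C (pcomp W s'))"
    using val_wh_right[OF box2_ty(1)[OF x x'] pb] box2_ty(2)[OF x x'] s ten2_id[OF S S'] by (simp add: rwhisk_def)
  note t = tcomp_ty[OF d(8) d'(8) s] tcomp_ty[OF d(7) d'(7) s]
  show ?thesis
  proof (rule ty_eqI[OF ty_vc[OF b t(1)] ty_vc[OF t(2) box2_ty(1)[OF w]]])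
    show "val (tcomp q q' s s' ** wh [] (box2 x x') [box1 s s']) = val (box2 (wh [] x s) (wh [] x' s') ** tcomp p p' s s')"
      unfolding val_vc[OF b t(1)] val_vc[OF t(2) box2_ty(1)[OF w]] vb box2_ty(2)[OF w] v
        val_tcomp[OF d(8) d'(8) s] val_tcomp[OF d(7) d'(7) s]
      by (rule ten_comp_natural[OF S S d(10,11) S' S' d'(10,11) id2_closed[OF S] d(9) id2_closed[OF S'] d'(9)])
  qed
qed

lemma tcomp_nat_left:
  assumes x: "ty x V V p q" and x': "ty x' W W p' q'" and s: "path V V s" "path W W s'"
  shows "tcomp s s' q q' ** wh [box1 s s'] (box2 x x') [] = box2 (wh s x []) (wh s' x' []) ** tcomp s s' p p'"
proof -
  note d = tyD[OF x] and d' = tyD[OF x']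
  note S = pcomp_closed[OF s(1)] and S' = pcomp_closed[OF s(2)]
  have w: "ty (wh s x []) V V (s @ p) (s @ q)" "ty (wh s' x' []) W W (s' @ p') (s' @ q')"
    using ty_wh[OF x _ s(1), of V "[]"] ty_wh[OF x' _ s(2), of W "[]"] by simp_all
  have v: "val (wh s x []) = id2 C (pcomp V s) \<star> val x" "val (wh s' x' []) = id2 C (pcomp W s') \<star> val x'"
    using val_wh_left[OF x s(1)] val_wh_left[OF x' s(2)] by (simp_all add: lwhisk_def)
  have pb: "path VW VW [box1 s s']" using s by simp
  have b: "ty (wh [box1 s s'] (box2 x x') []) VW VW [box1 s s', box1 p p'] [box1 s s', box1 q q']"
    using ty_wh[OF box2_ty(1)[OF x x'] _ pb, of VW "[]"] by simp
  have vb: "val (wh [box1 s s'] (box2 x x') []) = (id2 C (pcomp V s) \<otimes>\<^sub>2 id2 C (pcomp W s')) \<star> (val x \<otimes>\<^sub>2 val x')"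
    using val_wh_left[OF box2_ty(1)[OF x x'] pb] box2_ty(2)[OF x x'] s ten2_id[OF S S'] by (simp add: lwhisk_def)
  note t = tcomp_ty[OF s d(8) d'(8)] tcomp_ty[OF s d(7) d'(7)]
  show ?thesis
  proof (rule ty_eqI[OF ty_vc[OF b t(1)] ty_vc[OF t(2) box2_ty(1)[OF w]]])
    show "val (tcomp s s' q q' ** wh [box1 s s'] (box2 x x') []) = val (box2 (wh s x []) (wh s' x' []) ** tcomp s s' p p')"
      unfolding val_vc[OF b t(1)] val_vc[OF t(2) box2_ty(1)[OF w]] vb box2_ty(2)[OF w] v
        val_tcomp[OF s d(8) d'(8)] val_tcomp[OF s d(7) d'(7)]
      by (rule ten_comp_natural[OF d(10,11) S S d'(10,11) S' S' d(9) id2_closed[OF S] d'(9) id2_closed[OF S']])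
  qed
qed

lemma tcomp_assoc:
  assumes p: "path V V k" "path V V h" "path V V f" and p': "path W W k'" "path W W h'" "path W W f'"
  shows "tcomp (k @ h) (k' @ h') f f' ** wh [] (tcomp k k' h h') [box1 f f']
    = tcomp k k' (h @ f) (h' @ f') ** wh [box1 k k'] (tcomp h h' f f') []"
proof -
  have q: "path V V (k @ h)" "path V V (h @ f)" "path W W (k' @ h')" "path W W (h' @ f')"
    using p p' path_pdom[OF p(1)] path_pdom[OF p(2)] path_pdom[OF p'(1)] path_pdom[OF p'(2)] by simp_all
  note t = tcomp_ty[OF p(1) p'(1) p(2) p'(2)] tcomp_ty[OF q(1,3) p(3) p'(3)] tcomp_ty[OF p(2) p'(2) p(3) p'(3)] tcomp_ty[OF p(1) p'(1) q(2,4)]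
  have bf: "path VW VW [box1 f f']" "path VW VW [box1 k k']" using p p' by simp_all
  have w: "ty (wh [] (tcomp k k' h h') [box1 f f']) VW VW [box1 k k', box1 h h', box1 f f'] [box1 (k @ h) (k' @ h'), box1 f f']"
    "ty (wh [box1 k k'] (tcomp h h' f f') []) VW VW [box1 k k', box1 h h', box1 f f'] [box1 k k', box1 (h @ f) (h' @ f')]"
    using ty_wh[OF t(1) bf(1), of VW "[]"] ty_wh[OF t(3) _ bf(2), of VW "[]"] by simp_all
  have v: "val (wh [] (tcomp k k' h h') [box1 f f']) = ten_comp C (pcomp V k) (pcomp W k') (pcomp V h) (pcomp W h') \<triangleleft> (pcomp V f \<otimes>\<^sub>1 pcomp W f')"
    "val (wh [box1 k k'] (tcomp h h' f f') []) = (pcomp V k \<otimes>\<^sub>1 pcomp W k') \<triangleright> ten_comp C (pcomp V h) (pcomp W h') (pcomp V f) (pcomp W f')"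
    using val_wh_right[OF t(1) bf(1)] val_wh_left[OF t(3) bf(2)] val_tcomp[OF p(1) p'(1) p(2) p'(2)] val_tcomp[OF p(2) p'(2) p(3) p'(3)] p p'
    by simp_all
  show ?thesis
  proof (rule ty_eqI[OF ty_vc[OF w(1) t(2)] ty_vc[OF w(2) t(4), unfolded append_assoc[symmetric]]])
    show "val (tcomp (k @ h) (k' @ h') f f' ** wh [] (tcomp k k' h h') [box1 f f']) = val (tcomp k k' (h @ f) (h' @ f') ** wh [box1 k k'] (tcomp h h' f f') [])"
      unfolding val_vc[OF w(1) t(2)] val_vc[OF w(2) t(4)] v val_tcomp[OF q(1,3) p(3) p'(3)] val_tcomp[OF p(1) p'(1) q(2,4)]
        pcomp_append[OF p(1,2)] pcomp_append[OF p(2,3)] pcomp_append[OF p'(1,2)] pcomp_append[OF p'(2,3)]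
      by (rule ten_comp_assoc) (rule pcomp_closed p p')+
  qed
qed

lemma tcomp_unit_right:
  assumes p: "path V V p" "path W W p'"
  shows "tcomp p p' [] [] ** wh [box1 p p'] tunit [] = id_cell VW VW [box1 p p']"
proof -
  have n: "path V V []" "path W W []" by simp_all
  have b: "path VW VW [box1 p p']" using p by simp
  note t = tcomp_ty[OF p n, unfolded append_Nil2]
  have w: "ty (wh [box1 p p'] tunit []) VW VW [box1 p p'] [box1 p p', box1 [] []]" using ty_wh[OF tunit_ty _ b, of VW "[]"] by simp
  have v: "val (wh [box1 p p'] tunit []) = (pcomp V p \<otimes>\<^sub>1 pcomp W p') \<triangleright> ten_id C V W" using val_wh_left[OF tunit_ty b] val_tunit p by simp
  show ?thesis
    by (rule ty_eqI[OF ty_vc[OF w t] ty_id_cell[OF b]])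
      (use ten_id_right[OF pcomp_closed[OF p(1)] pcomp_closed[OF p(2)]] p in
        \<open>simp add: val_vc[OF w t] v val_tcomp[OF p n] id_cell_eq[OF b]\<close>)
qed

lemma tcomp_unit_left:
  assumes p: "path V V p" "path W W p'"
  shows "tcomp [] [] p p' ** wh [] tunit [box1 p p'] = id_cell VW VW [box1 p p']"
proof -
  have n: "path V V []" "path W W []" by simp_all
  have b: "path VW VW [box1 p p']" using p by simp
  note t = tcomp_ty[OF n p, unfolded append_Nil]
  have w: "ty (wh [] tunit [box1 p p']) VW VW [box1 p p'] [box1 [] [], box1 p p']" using ty_wh[OF tunit_ty b, of VW "[]"] by simp
  have v: "val (wh [] tunit [box1 p p']) = ten_id C V W \<triangleleft> (pcomp V p \<otimes>\<^sub>1 pcomp W p')" using val_wh_right[OF tunit_ty b] val_tunit p by simp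
  show ?thesis
    by (rule ty_eqI[OF ty_vc[OF w t] ty_id_cell[OF b]])
      (use ten_id_left[OF pcomp_closed[OF p(1)] pcomp_closed[OF p(2)]] p in
        \<open>simp add: val_vc[OF w t] v val_tcomp[OF n p] id_cell_eq[OF b]\<close>)
qed

text \<open>By the unit law of the pseudofunctor, whiskering the inverse of \<open>tunit\<close> is the same as fusing with an
empty box.\<close>

lemma wh_tunit'_left:
  assumes p: "path V V p" "path W W p'"
  shows "wh [] tunit' [box1 p p'] = tcomp [] [] p p'"
proof -
  have b: "path VW VW [box1 p p']" using p by simp
  note i = inv_pair_wh[OF tunit_inv b, of VW "[]"]
  note t = tcomp_ty[of "[]" "[]" p p', simplified, OF p]
  have "tcomp [] [] p p' = tcomp [] [] p p' ** wh [] tunit [box1 p p'] ** wh [] tunit' [box1 p p']"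
    using inv_pairD(4)[OF i] vc_id_cell_right[OF t] by simp
  also have "\<dots> = wh [] tunit' [box1 p p']"
    unfolding vc_assoc[symmetric] tcomp_unit_left[OF p]
    using vc_id_cell_left[of "wh [] tunit' [box1 p p']" VW VW "[box1 [] [], box1 p p']" "[box1 p p']"] inv_pairD(2)[OF i] by simp
  finally show ?thesis by simp
qed

lemma wh_tunit'_right:
  assumes p: "path V V p" "path W W p'"
  shows "wh [box1 p p'] tunit' [] = tcomp p p' [] []"
proof -
  have b: "path VW VW [box1 p p']" using p by simp
  note i = inv_pair_wh[OF tunit_inv _ b, of VW "[]"]
  note t = tcomp_ty[of p p' "[]" "[]", simplified, OF p]
  have "tcomp p p' [] [] = tcomp p p' [] [] ** wh [box1 p p'] tunit [] ** wh [box1 p p'] tunit' []"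
    using inv_pairD(4)[OF i] vc_id_cell_right[OF t] by simp
  also have "\<dots> = wh [box1 p p'] tunit' []"
    unfolding vc_assoc[symmetric] tcomp_unit_right[OF p]
    using vc_id_cell_left[of "wh [box1 p p'] tunit' []" VW VW "[box1 p p', box1 [] []]" "[box1 p p']"] inv_pairD(2)[OF i] by simp
  finally show ?thesis by simp
qed

abbreviation TR :: "('g, 'a, 'm) rep2" where "TR \<equiv> tensor_rep C G V R W Q"

definition rhoT :: "'g \<Rightarrow> ('o, 'a) arrow" where "rhoT g = box1 [R.rho g] [Q.rho g]"

definition phiT :: "'g \<Rightarrow> 'g \<Rightarrow> ('o, 'a, 'm) cell" where
  "phiT g h = box2 (R.phi g h) (Q.phi g h) ** tcomp [R.rho g] [Q.rho g] [R.rho h] [Q.rho h]"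

definition phi1T :: "('o, 'a, 'm) cell" where
  "phi1T = tunit' ** box2 R.phi1 Q.phi1"

lemma rhoT_eq: "g \<in> carrier G \<Longrightarrow> rhoT g = (VW, VW, act TR g)"
  by (simp add: rhoT_def box1_def tensor_rep_def)

lemma act_TR [simp]: "act TR g = act R g \<otimes>\<^sub>1 act Q g"
  by (simp add: tensor_rep_def)

lemma act_TR_closed: "g \<in> carrier G \<Longrightarrow> act R g \<otimes>\<^sub>1 act Q g \<in> hom1 C VW VW"
  unfolding VW_def by (rule ten1_closed[OF R.act_closed Q.act_closed])

lemma path_rhoT [simp]: "g \<in> carrier G \<Longrightarrow> path A B (rhoT g # p) \<longleftrightarrow> B = VW \<and> path A VW p"
  by (simp add: rhoT_def)

lemma pdom_rhoT [simp]: "pdom B (rhoT g # p) = pdom VW p" and pcod_rhoT [simp]: "pcod B (rhoT g # p) = VW"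
  by (simp_all add: rhoT_def)

lemma pcomp_rhoT [simp]: "g \<in> carrier G \<Longrightarrow> pcomp A (rhoT g # p) = (act R g \<otimes>\<^sub>1 act Q g) \<cdot> pcomp A p"
  by (simp add: rhoT_def)

lemma rhoT_id1 [simp]: "g \<in> carrier G \<Longrightarrow> (act R g \<otimes>\<^sub>1 act Q g) \<cdot> id1 C VW = act R g \<otimes>\<^sub>1 act Q g"
  by (rule comp1_id_right[OF act_TR_closed])

lemma tcomp_rhoT_ty: "g \<in> carrier G \<Longrightarrow> h \<in> carrier G \<Longrightarrow>
    ty (tcomp [R.rho g] [Q.rho g] [R.rho h] [Q.rho h]) VW VW [rhoT g, rhoT h] [box1 [R.rho g, R.rho h] [Q.rho g, Q.rho h]]"
  using tcomp_ty[of "[R.rho g]" "[Q.rho g]" "[R.rho h]" "[Q.rho h]"] by (simp add: rhoT_def)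

lemma phiT_inv:
  assumes "g \<in> carrier G" "h \<in> carrier G"
  shows "\<exists>y. inv_pair (phiT g h) y VW VW [rhoT g, rhoT h] [rhoT (g \<otimes>\<^bsub>G\<^esub> h)]"
  using inv_pair_vc[OF tcomp_inv(1)[of "[R.rho g]" "[Q.rho g]" "[R.rho h]" "[Q.rho h]"], of "box2 (R.phi g h) (Q.phi g h)"
      "box2 (R.phi' g h) (Q.phi' g h)" "[rhoT (g \<otimes>\<^bsub>G\<^esub> h)]"] box2_inv[OF R.phi_inv[OF assms] Q.phi_inv[OF assms]] assms
  unfolding phiT_def rhoT_def by auto

lemma phiT_ty: "g \<in> carrier G \<Longrightarrow> h \<in> carrier G \<Longrightarrow> ty (phiT g h) VW VW [rhoT g, rhoT h] [rhoT (g \<otimes>\<^bsub>G\<^esub> h)]"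
  using phiT_inv[of g h] inv_pairD(1) by blast

lemma phi1T_inv: "\<exists>y. inv_pair phi1T y VW VW [rhoT \<one>\<^bsub>G\<^esub>] []"
  unfolding phi1T_def rhoT_def
  using inv_pair_vc[OF box2_inv[OF R.phi1_inv Q.phi1_inv] inv_pair_sym[OF tunit_inv]] by blast

lemma phi1T_ty: "ty phi1T VW VW [rhoT \<one>\<^bsub>G\<^esub>] []"
  using phi1T_inv inv_pairD(1) by blast

lemma val_phiT: "g \<in> carrier G \<Longrightarrow> h \<in> carrier G \<Longrightarrow> val (phiT g h) = act_mult TR g h"
  using val_vc[OF tcomp_rhoT_ty, of g h "box2 (R.phi g h) (Q.phi g h)" "[rhoT (g \<otimes>\<^bsub>G\<^esub> h)]"]
    box2_ty[OF R.phi_ty Q.phi_ty, of g h g h] val_tcomp[of "[R.rho g]" "[Q.rho g]" "[R.rho h]" "[Q.rho h]"]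
  by (simp add: phiT_def tensor_rep_def rhoT_def)

lemma val_phi1T: "val phi1T = act_one TR"
proof -
  have "val tunit' = inv2 C (id1 C VW) (id1 C V \<otimes>\<^sub>1 id1 C W) (ten_id C V W)"
    using inv_pair_val(3)[OF tunit_inv] val_tunit box1_id1[of "[]" "[]"] by simp
  then show ?thesis
    using val_vc[OF box2_ty(1)[OF R.phi1_ty Q.phi1_ty] tunit'_ty] box2_ty(2)[OF R.phi1_ty Q.phi1_ty]
    by (simp add: phi1T_def tensor_rep_def flip: VW_def)
qed

text \<open>Naturality moves the fusing cells to the right of all multiplications. The multiplications then
agree by associativity in both factors, and the fusing cells by the associativity of the
pseudofunctor.\<close>

lemma phiT_assoc:
  assumes g: "g \<in> carrier G" and h: "h \<in> carrier G" and l: "l \<in> carrier G"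
  shows "phiT (g \<otimes>\<^bsub>G\<^esub> h) l ** wh [] (phiT g h) [rhoT l] = phiT g (h \<otimes>\<^bsub>G\<^esub> l) ** wh [rhoT g] (phiT h l) []"
proof -
  note [simp] = g h l
  let ?r = "\<lambda>x. [R.rho x]" and ?q = "\<lambda>x. [Q.rho x]"
  have gh: "g \<otimes>\<^bsub>G\<^esub> h \<in> carrier G" and hl: "h \<otimes>\<^bsub>G\<^esub> l \<in> carrier G" by simp_all
  have p: "path V V (?r x)" "path W W (?q x)" if "x \<in> carrier G" for x using that by simp_all
  have wr: "ty (wh [] (R.phi g h) (?r l)) V V [R.rho g, R.rho h, R.rho l] [R.rho (g \<otimes>\<^bsub>G\<^esub> h), R.rho l]"
    "ty (wh (?r g) (R.phi h l) []) V V [R.rho g, R.rho h, R.rho l] [R.rho g, R.rho (h \<otimes>\<^bsub>G\<^esub> l)]"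
    using ty_wh[OF R.phi_ty[OF g h], of V "?r l" V "[]"] ty_wh[OF R.phi_ty[OF h l], of V "[]" V "?r g"] by simp_all
  have wq: "ty (wh [] (Q.phi g h) (?q l)) W W [Q.rho g, Q.rho h, Q.rho l] [Q.rho (g \<otimes>\<^bsub>G\<^esub> h), Q.rho l]"
    "ty (wh (?q g) (Q.phi h l) []) W W [Q.rho g, Q.rho h, Q.rho l] [Q.rho g, Q.rho (h \<otimes>\<^bsub>G\<^esub> l)]"
    using ty_wh[OF Q.phi_ty[OF g h], of W "?q l" W "[]"] ty_wh[OF Q.phi_ty[OF h l], of W "[]" W "?q g"] by simp_all
  have "phiT (g \<otimes>\<^bsub>G\<^esub> h) l ** wh [] (phiT g h) [rhoT l]
      = box2 (R.phi (g \<otimes>\<^bsub>G\<^esub> h) l) (Q.phi (g \<otimes>\<^bsub>G\<^esub> h) l) **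
        (tcomp (?r (g \<otimes>\<^bsub>G\<^esub> h)) (?q (g \<otimes>\<^bsub>G\<^esub> h)) (?r l) (?q l) ** wh [] (box2 (R.phi g h) (Q.phi g h)) [rhoT l]) **
        wh [] (tcomp (?r g) (?q g) (?r h) (?q h)) [rhoT l]"
    unfolding phiT_def by (simp add: wh_vc vc_assoc)
  also have "\<dots> = (box2 (R.phi (g \<otimes>\<^bsub>G\<^esub> h) l) (Q.phi (g \<otimes>\<^bsub>G\<^esub> h) l) ** box2 (wh [] (R.phi g h) (?r l)) (wh [] (Q.phi g h) (?q l))) **
        (tcomp (?r g @ ?r h) (?q g @ ?q h) (?r l) (?q l) ** wh [] (tcomp (?r g) (?q g) (?r h) (?q h)) [rhoT l])"
    unfolding rhoT_def tcomp_nat_right[OF R.phi_ty[OF g h] Q.phi_ty[OF g h] p[OF l]] by (simp add: vc_assoc)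
  also have "\<dots> = box2 (R.phi (g \<otimes>\<^bsub>G\<^esub> h) l ** wh [] (R.phi g h) (?r l)) (Q.phi (g \<otimes>\<^bsub>G\<^esub> h) l ** wh [] (Q.phi g h) (?q l)) **
        (tcomp (?r g) (?q g) (?r h @ ?r l) (?q h @ ?q l) ** wh [rhoT g] (tcomp (?r h) (?q h) (?r l) (?q l)) [])"
    unfolding rhoT_def tcomp_assoc[OF p(1)[OF g] p(1)[OF h] p(1)[OF l] p(2)[OF g] p(2)[OF h] p(2)[OF l]]
      box2_vc[OF wr(1) R.phi_ty[OF gh l] wq(1) Q.phi_ty[OF gh l]] ..
  also have "\<dots> = box2 (R.phi g (h \<otimes>\<^bsub>G\<^esub> l) ** wh (?r g) (R.phi h l) []) (Q.phi g (h \<otimes>\<^bsub>G\<^esub> l) ** wh (?q g) (Q.phi h l) []) **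
        (tcomp (?r g) (?q g) (?r h @ ?r l) (?q h @ ?q l) ** wh [rhoT g] (tcomp (?r h) (?q h) (?r l) (?q l)) [])"
    unfolding R.phi_assoc[OF g h l] Q.phi_assoc[OF g h l] ..
  also have "\<dots> = box2 (R.phi g (h \<otimes>\<^bsub>G\<^esub> l)) (Q.phi g (h \<otimes>\<^bsub>G\<^esub> l)) **
        (box2 (wh (?r g) (R.phi h l) []) (wh (?q g) (Q.phi h l) []) ** tcomp (?r g) (?q g) [R.rho h, R.rho l] [Q.rho h, Q.rho l]) **
        wh [rhoT g] (tcomp (?r h) (?q h) (?r l) (?q l)) []"
    unfolding box2_vc[OF wr(2) R.phi_ty[OF g hl] wq(2) Q.phi_ty[OF g hl]] by (simp add: vc_assoc)
  also have "\<dots> = phiT g (h \<otimes>\<^bsub>G\<^esub> l) ** wh [rhoT g] (phiT h l) []"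
    unfolding tcomp_nat_left[OF R.phi_ty[OF h l] Q.phi_ty[OF h l] p[OF g], symmetric] phiT_def
    by (simp add: wh_vc vc_assoc rhoT_def)
  finally show ?thesis .
qed

lemma phiT_one_left:
  assumes g: "g \<in> carrier G"
  shows "phiT \<one>\<^bsub>G\<^esub> g = wh [] phi1T [rhoT g]"
proof -
  have p: "path V V [R.rho g]" "path W W [Q.rho g]" using g by simp_all
  show ?thesis
    using tcomp_nat_right[OF R.phi1_ty Q.phi1_ty p] wh_tunit'_left[OF p] R.phi_one_left[OF g] Q.phi_one_left[OF g]
    by (simp add: phiT_def phi1T_def wh_vc rhoT_def)
qed

lemma phiT_one_right:
  assumes g: "g \<in> carrier G"
  shows "phiT g \<one>\<^bsub>G\<^esub> = wh [rhoT g] phi1T []"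
proof -
  have p: "path V V [R.rho g]" "path W W [Q.rho g]" using g by simp_all
  show ?thesis
    using tcomp_nat_left[OF R.phi1_ty Q.phi1_ty p] wh_tunit'_right[OF p] R.phi_one_right[OF g] Q.phi_one_right[OF g]
    by (simp add: phiT_def phi1T_def wh_vc rhoT_def)
qed

lemma tensor_two_representation: "two_representation C G VW TR"
proof
  fix g assume g: "g \<in> carrier G"
  show "act TR g \<in> hom1 C VW VW" using act_TR_closed[OF g] by simp
  have b: "path VW VW [rhoT g]" using g by simp
  show "act_mult TR \<one>\<^bsub>G\<^esub> g = act_one TR \<triangleleft> act TR g"
    using arg_cong[OF phiT_one_left[OF g], of val] val_phiT[OF _ g] val_wh_right[OF phi1T_ty b] val_phi1T g by simp
  show "act_mult TR g \<one>\<^bsub>G\<^esub> = act TR g \<triangleright> act_one TR"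
    using arg_cong[OF phiT_one_right[OF g], of val] val_phiT[OF g] val_wh_left[OF phi1T_ty b] val_phi1T g by simp
  fix h assume h: "h \<in> carrier G"
  show "act_mult TR g h \<in> iso2 C (act TR g \<cdot> act TR h) (act TR (g \<otimes>\<^bsub>G\<^esub> h))"
    using phiT_inv[OF g h] inv_pair_val(2) val_phiT[OF g h] g h by fastforce
  fix l assume l: "l \<in> carrier G"
  have bl: "path VW VW [rhoT l]" using l by simp
  have w: "ty (wh [] (phiT g h) [rhoT l]) VW VW [rhoT g, rhoT h, rhoT l] [rhoT (g \<otimes>\<^bsub>G\<^esub> h), rhoT l]"
    "ty (wh [rhoT g] (phiT h l) []) VW VW [rhoT g, rhoT h, rhoT l] [rhoT g, rhoT (h \<otimes>\<^bsub>G\<^esub> l)]"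
    using ty_wh[OF phiT_ty[OF g h] bl, of VW "[]"] ty_wh[OF phiT_ty[OF h l] _ b, of VW "[]"] by simp_all
  show "act_mult TR (g \<otimes>\<^bsub>G\<^esub> h) l \<bullet> (act_mult TR g h \<triangleleft> act TR l)
      = act_mult TR g (h \<otimes>\<^bsub>G\<^esub> l) \<bullet> (act TR g \<triangleright> act_mult TR h l)"
    using arg_cong[OF phiT_assoc[OF g h l], of val] val_vc[OF w(1) phiT_ty] val_vc[OF w(2) phiT_ty]
      val_wh_right[OF phiT_ty[OF g h] bl] val_wh_left[OF phiT_ty[OF h l] b] g h l by (simp add: val_phiT)
next
  show "act_one TR \<in> iso2 C (act TR \<one>\<^bsub>G\<^esub>) (id1 C VW)"
    using phi1T_inv inv_pair_val(2) val_phi1T by fastforce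
qed

end

sublocale tensor_cells \<subseteq> T: rep_cells C G VW "tensor_rep C G V R W Q"
  by (intro rep_cells.intro klinear_2category_axioms tensor_two_representation R.is_group)

context tensor_cells
begin

lemma T_rho: "g \<in> carrier G \<Longrightarrow> T.rho g = rhoT g"
  using rhoT_eq by (simp add: T.rho_def)

lemma T_phi: "g \<in> carrier G \<Longrightarrow> h \<in> carrier G \<Longrightarrow> T.phi g h = phiT g h"
  using T.phi_ty[of g h] phiT_ty[of g h] by (intro ty_eqI) (simp_all add: T_rho val_phiT)

lemma T_phi1: "T.phi1 = phi1T"
  using T.phi1_ty phi1T_ty by (intro ty_eqI) (simp_all add: T_rho val_phi1T)

text \<open>By \<open>conj_cell_iff\<close> it suffices to compare two cells without inverses. On either side, naturality
moves the cell fusing \<open>s\<close> and \<open>s\<inverse>\<close> to the right, and what remains is the characterization of the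
conjugations in the two factors; \<open>tunit\<close> disappears by the unit law.\<close>

lemma conj_cell_box:
  assumes s: "s \<in> carrier G" and g: "g \<in> carrier G" and x: "ty x V V [] [R.rho g]" and x': "ty x' W W [] [Q.rho g]"
  shows "T.conj_cell s g (box2 x x' ** tunit) = box2 (R.conj_cell s g x) (Q.conj_cell s g x') ** tunit"
proof -
  let ?s = "inv\<^bsub>G\<^esub> s" and ?sg = "s \<otimes>\<^bsub>G\<^esub> g"
  note [simp] = s g tyD(1-5)[OF x] tyD(1-5)[OF x']
  have s': "?s \<in> carrier G" and sg: "?sg \<in> carrier G" by simp_all
  let ?r = "\<lambda>x. [R.rho x]" and ?q = "\<lambda>x. [Q.rho x]"
  have p: "path V V (?r x)" "path W W (?q x)" if "x \<in> carrier G" for x using that by simp_all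
  let ?y = "R.conj_cell s g x" and ?y' = "Q.conj_cell s g x'" and ?t = "?sg \<otimes>\<^bsub>G\<^esub> ?s"
  note ty1 = R.conj_cell_ty[OF s g x] and ty1' = Q.conj_cell_ty[OF s g x']
  have X: "ty (box2 x x' ** tunit) VW VW [] [T.rho g]"
    using ty_vc[OF tunit_ty box2_ty(1)[OF x x']] by (simp add: T_rho rhoT_def)
  have Y: "ty (box2 ?y ?y' ** tunit) VW VW [] [T.rho ?t]"
    using ty_vc[OF tunit_ty box2_ty(1)[OF ty1 ty1']] by (simp add: T_rho rhoT_def)
  have u: "ty (R.phi1 ** R.phi s ?s) V V [R.rho s, R.rho ?s] []" "ty (Q.phi1 ** Q.phi s ?s) W W [Q.rho s, Q.rho ?s] []"
    by (simp_all add: tys)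
  have phs: "ty (R.phi s ?s) V V [R.rho s, R.rho ?s] [R.rho \<one>\<^bsub>G\<^esub>]" "ty (Q.phi s ?s) W W [Q.rho s, Q.rho ?s] [Q.rho \<one>\<^bsub>G\<^esub>]"
    using R.phi_ty[OF s s'] Q.phi_ty[OF s s'] by simp_all
  have "(box2 ?y ?y' ** tunit) ** T.phi1 ** T.phi s ?s
     = box2 ?y ?y' ** ((tunit ** tunit') ** box2 R.phi1 Q.phi1) ** box2 (R.phi s ?s) (Q.phi s ?s) ** tcomp (?r s) (?q s) (?r ?s) (?q ?s)"
    by (simp add: T_phi1 T_phi phi1T_def phiT_def vc_assoc)
  also have "(tunit ** tunit') ** box2 R.phi1 Q.phi1 = box2 R.phi1 Q.phi1"
    unfolding inv_pairD(4)[OF tunit_inv] by (rule vc_id_cell_left[OF box2_ty(1)[OF R.phi1_ty Q.phi1_ty]])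
  also have "box2 ?y ?y' ** box2 R.phi1 Q.phi1 ** box2 (R.phi s ?s) (Q.phi s ?s) ** tcomp (?r s) (?q s) (?r ?s) (?q ?s)
     = box2 (?y ** R.phi1 ** R.phi s ?s) (?y' ** Q.phi1 ** Q.phi s ?s) ** tcomp (?r s) (?q s) (?r ?s) (?q ?s)"
    unfolding box2_vc[OF u(1) ty1 u(2) ty1'] box2_vc[OF phs(1) R.phi1_ty phs(2) Q.phi1_ty] by (simp add: vc_assoc)
  also have "?y ** R.phi1 ** R.phi s ?s = R.phi ?sg ?s ** wh [] (R.phi s g) (?r ?s) ** wh (?r s) x (?r ?s)"
    using R.conj_cell_iff[OF s g x ty1] by simp
  also have "?y' ** Q.phi1 ** Q.phi s ?s = Q.phi ?sg ?s ** wh [] (Q.phi s g) (?q ?s) ** wh (?q s) x' (?q ?s)"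
    using Q.conj_cell_iff[OF s g x' ty1'] by simp
  finally have L: "(box2 ?y ?y' ** tunit) ** T.phi1 ** T.phi s ?s
     = box2 (R.phi ?sg ?s ** wh [] (R.phi s g) (?r ?s) ** wh (?r s) x (?r ?s))
          (Q.phi ?sg ?s ** wh [] (Q.phi s g) (?q ?s) ** wh (?q s) x' (?q ?s)) ** tcomp (?r s) (?q s) (?r ?s) (?q ?s)" .
  have sx: "ty (wh (?r s) x []) V V (?r s) [R.rho s, R.rho g]" "ty (wh (?q s) x' []) W W (?q s) [Q.rho s, Q.rho g]"
    using ty_wh[OF x, of V "[]" V "?r s"] ty_wh[OF x', of W "[]" W "?q s"] by simp_all
  have sxs: "ty (wh (?r s) x (?r ?s)) V V [R.rho s, R.rho ?s] [R.rho s, R.rho g, R.rho ?s]"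
    "ty (wh (?q s) x' (?q ?s)) W W [Q.rho s, Q.rho ?s] [Q.rho s, Q.rho g, Q.rho ?s]"
    using ty_wh[OF x, of V "?r ?s" V "?r s"] ty_wh[OF x', of W "?q ?s" W "?q s"] by simp_all
  have ps: "ty (wh [] (R.phi s g) (?r ?s)) V V [R.rho s, R.rho g, R.rho ?s] [R.rho ?sg, R.rho ?s]"
    "ty (wh [] (Q.phi s g) (?q ?s)) W W [Q.rho s, Q.rho g, Q.rho ?s] [Q.rho ?sg, Q.rho ?s]"
    using ty_wh[OF R.phi_ty[OF s g], of V "?r ?s" V "[]"] ty_wh[OF Q.phi_ty[OF s g], of W "?q ?s" W "[]"] by simp_all
  have inner: "tcomp (?r s) (?q s) (?r g) (?q g) ** wh [rhoT s] (box2 x x' ** tunit) [] = box2 (wh (?r s) x []) (wh (?q s) x' [])"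
  proof -
    have "tcomp (?r s) (?q s) (?r g) (?q g) ** wh [rhoT s] (box2 x x' ** tunit) []
        = box2 (wh (?r s) x []) (wh (?q s) x' []) ** (tcomp (?r s) (?q s) [] [] ** wh [rhoT s] tunit [])"
      using arg_cong[OF tcomp_nat_left[OF x x' p[OF s]], of "\<lambda>z. z ** wh [rhoT s] tunit []"]
      by (simp add: wh_vc vc_assoc rhoT_def)
    then show ?thesis
      using tcomp_unit_right[OF p[OF s]] vc_id_cell_right[OF box2_ty(1)[OF sx]] by (simp add: rhoT_def)
  qed
  have "T.phi ?sg ?s ** wh [] (T.phi s g) [T.rho ?s] ** wh [T.rho s] (box2 x x' ** tunit) [T.rho ?s]
     = box2 (R.phi ?sg ?s) (Q.phi ?sg ?s) ** (tcomp (?r ?sg) (?q ?sg) (?r ?s) (?q ?s) ** wh [] (box2 (R.phi s g) (Q.phi s g)) [rhoT ?s])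
       ** wh [] (tcomp (?r s) (?q s) (?r g) (?q g) ** wh [rhoT s] (box2 x x' ** tunit) []) [rhoT ?s]"
    by (simp add: T_phi T_rho phiT_def wh_vc wh_wh vc_assoc)
  also have "\<dots> = box2 (R.phi ?sg ?s) (Q.phi ?sg ?s) ** box2 (wh [] (R.phi s g) (?r ?s)) (wh [] (Q.phi s g) (?q ?s))
       ** (tcomp [R.rho s, R.rho g] [Q.rho s, Q.rho g] (?r ?s) (?q ?s) ** wh [] (box2 (wh (?r s) x []) (wh (?q s) x' [])) [rhoT ?s])"
    unfolding inner unfolding rhoT_def tcomp_nat_right[OF R.phi_ty[OF s g] Q.phi_ty[OF s g] p[OF s']] by (simp add: vc_assoc)
  also have "tcomp [R.rho s, R.rho g] [Q.rho s, Q.rho g] (?r ?s) (?q ?s) ** wh [] (box2 (wh (?r s) x []) (wh (?q s) x' [])) [rhoT ?s]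
       = box2 (wh (?r s) x (?r ?s)) (wh (?q s) x' (?q ?s)) ** tcomp (?r s) (?q s) (?r ?s) (?q ?s)"
    using tcomp_nat_right[OF sx p[OF s']] by (simp add: wh_wh rhoT_def)
  also have "box2 (R.phi ?sg ?s) (Q.phi ?sg ?s) ** box2 (wh [] (R.phi s g) (?r ?s)) (wh [] (Q.phi s g) (?q ?s))
       ** box2 (wh (?r s) x (?r ?s)) (wh (?q s) x' (?q ?s)) ** tcomp (?r s) (?q s) (?r ?s) (?q ?s)
     = box2 (R.phi ?sg ?s ** wh [] (R.phi s g) (?r ?s) ** wh (?r s) x (?r ?s))
          (Q.phi ?sg ?s ** wh [] (Q.phi s g) (?q ?s) ** wh (?q s) x' (?q ?s)) ** tcomp (?r s) (?q s) (?r ?s) (?q ?s)"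
    unfolding box2_vc[OF ty_vc[OF sxs(1) ps(1)] R.phi_ty[OF sg s'] ty_vc[OF sxs(2) ps(2)] Q.phi_ty[OF sg s']]
      box2_vc[OF sxs(1) ps(1) sxs(2) ps(2)] by (simp add: vc_assoc)
  finally show ?thesis using L T.conj_cell_iff[OF s g X Y] by simp
qed

lemma trace_pairing_cell:
  assumes "ty x V V [] [R.rho g]" "ty x' W W [] [Q.rho g]"
  shows "val (box2 x x' ** tunit) = trace_pairing C V W (val x) (val x')"
  using val_vc[OF tunit_ty box2_ty(1)[OF assms]] box2_ty(2)[OF assms] val_tunit by (simp add: trace_pairing_def)

lemma conj_map_pairing:
  assumes s: "s \<in> carrier G" and g: "g \<in> carrier G"
    and x: "\<xi> \<in> cat_trace C V (act R g)" and x': "\<xi>' \<in> cat_trace C W (act Q g)"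
  shows "conj_map C G VW TR s g (trace_pairing C V W \<xi> \<xi>')
    = trace_pairing C V W (conj_map C G V R s g \<xi>) (conj_map C G W Q s g \<xi>')"
proof -
  note t = R.trace_cell[OF g x] and t' = Q.trace_cell[OF g x']
  have X: "ty (box2 (R.trace_cell g \<xi>) (Q.trace_cell g \<xi>') ** tunit) VW VW [] [T.rho g]"
    using ty_vc[OF tunit_ty box2_ty(1)[OF t(1) t'(1)]] g by (simp add: T_rho rhoT_def)
  show ?thesis
    using T.val_conj_cell[OF s g X] conj_cell_box[OF s g t(1) t'(1)] trace_pairing_cell[OF t(1) t'(1)]
      trace_pairing_cell[OF R.conj_cell_ty[OF s g t(1)] Q.conj_cell_ty[OF s g t'(1)]]
      R.val_conj_cell[OF s g t(1)] Q.val_conj_cell[OF s g t'(1)] t(2) t'(2) by simp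
qed

text \<open>Both conjugations preserve the spaces, since \<open>h\<close> commutes with \<open>g\<close>, and they determine the conjugation
for the tensor product on pairings.\<close>

lemma two_character_tensor:
  assumes g: "g \<in> carrier G" and h: "h \<in> carrier G" and gh: "g \<otimes>\<^bsub>G\<^esub> h = h \<otimes>\<^bsub>G\<^esub> g"
    and fd: "fin_dim (smul C) (cat_trace C V (act R g))" "fin_dim (smul C) (cat_trace C W (act Q g))"
    and ti: "tensor_iso (smul C) (cat_trace C V (act R g)) (cat_trace C W (act Q g))
            (cat_trace C VW (act TR g)) (trace_pairing C V W)"
  shows "two_character C G VW TR g h = two_character C G V R g h * two_character C G W Q g h"
proof -
  have t: "h \<otimes>\<^bsub>G\<^esub> g \<otimes>\<^bsub>G\<^esub> inv\<^bsub>G\<^esub> h = g"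
    unfolding gh[symmetric] using g h by (simp add: R.m_assoc)
  show ?thesis
    unfolding two_character_def
    by (rule vs.trace_tensor[OF R.cat_trace_subspace[OF g] fd(1) Q.cat_trace_subspace[OF g] fd(2)
          T.cat_trace_subspace[OF g] ti])
      (use R.conj_map_linear[OF h g] Q.conj_map_linear[OF h g] T.conj_map_linear[OF h g] conj_map_pairing[OF h g]
        in \<open>auto simp only: t image_subset_iff\<close>)
qed

end

section \<open>The inner product of two 2-representations\<close>

theorem mainTheorem5:
  fixes C :: "('k::alg_closed_field, 'o, 'a, 'm::ab_group_add, 'z) monoidal_two_cat_scheme" (structure)
    and G :: "('g, 'y) monoid_scheme"
    and V W X :: 'o
    and \<rho> \<pi> S :: "('g, 'a, 'm) rep2"
    and \<epsilon> \<tau> :: "'g \<Rightarrow> 'm" and U :: 'a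
  assumes "monoidal_klinear_2category C"
    and "group G" and "finite (carrier G)"
    and card_G: "(of_nat (card (carrier G)) :: 'k) \<noteq> 0"
    and "two_representation C G V \<rho>" and "two_representation C G W \<pi>"
    and "\<And>g. g \<in> carrier G \<Longrightarrow> fin_dim (smul C) (cat_trace C V (act \<rho> g))"
    and "\<And>g. g \<in> carrier G \<Longrightarrow> fin_dim (smul C) (cat_trace C W (act \<pi> g))"
    and trace_product: "\<And>g. g \<in> carrier G \<Longrightarrow>
          tensor_iso (smul C) (cat_trace C V (act \<rho> g)) (cat_trace C W (act \<pi> g))
            (cat_trace C (V \<otimes>\<^sub>0 W) (act \<rho> g \<otimes>\<^sub>1 act \<pi> g)) (trace_pairing C V W)"
    and "is_invariants C G (V \<otimes>\<^sub>0 W) (tensor_rep C G V \<rho> W \<pi>) X S \<epsilon> U \<tau>"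
  shows "fin_dim (smul C) (cat_dim C X) \<and>
         (of_nat (vector_space.dim (smul C) (cat_dim C X)) :: 'k) =
           1 / of_nat (card (carrier G)) *
           (\<Sum>(g, h) \<in> {(g, h). g \<in> carrier G \<and> h \<in> carrier G \<and> g \<otimes>\<^bsub>G\<^esub> h = h \<otimes>\<^bsub>G\<^esub> g}.
              two_character C G V \<rho> g h * two_character C G W \<pi> g h)"
proof -
  interpret M: monoidal_klinear_2category C by fact
  interpret G: group G by fact
  interpret T: tensor_cells C G V \<rho> W \<pi>
    by (intro tensor_cells.intro rep_cells.intro M.klinear_2category_axioms assms(1,2,5,6))
  interpret I: invariant_cells C G "V \<otimes>\<^sub>0 W" "tensor_rep C G V \<rho> W \<pi>" X S \<epsilon> \<tau> U
    using T.T.rep_cells_axioms M.klinear_2category_axioms assms(2,10)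
    by (intro invariant_cells.intro invariant_cells_axioms.intro rep_cells.intro)
      (simp_all add: T.VW_def rep_cells_def is_invariants_def)
  note R = T.R.cat_trace_subspace and Q = T.Q.cat_trace_subspace
  have fd: "fin_dim (smul C) (cat_trace C (V \<otimes>\<^sub>0 W) (act (tensor_rep C G V \<rho> W \<pi>) g))" if "g \<in> carrier G" for g
    using M.vs.tensor_iso_fin_dim[OF R[OF that] assms(7)[OF that] Q[OF that] assms(8)[OF that] trace_product[OF that]]
    by simp
  have "(\<Sum>(g, h) \<in> {(g, h). g \<in> carrier G \<and> h \<in> carrier G \<and> g \<otimes>\<^bsub>G\<^esub> h = h \<otimes>\<^bsub>G\<^esub> g}.
      two_character C G (V \<otimes>\<^sub>0 W) (tensor_rep C G V \<rho> W \<pi>) g h)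
    = (\<Sum>(g, h) \<in> {(g, h). g \<in> carrier G \<and> h \<in> carrier G \<and> g \<otimes>\<^bsub>G\<^esub> h = h \<otimes>\<^bsub>G\<^esub> g}.
      two_character C G V \<rho> g h * two_character C G W \<pi> g h)"
    by (rule sum.cong)
      (use T.two_character_tensor assms(7,8) trace_product in \<open>auto simp: T.VW_def\<close>)
  then show ?thesis using I.dim_invariants[OF assms(3) card_G fd] by simp
qed

end
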